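(* Let $(\vartheta_0,D_4,D_3)$ be one of the triples $(0.729,1,2)$, $(0.616,3,6)$, $(0.554,4,8)$, $(0.515,7,12)$, and suppose some $\vartheta>\vartheta_0$ satisfies both conditions (A) and (B) below. Then at least one of the following holds: (i) there exists an integer $d$ with $0<|d|\le D_4$ such that $\lambda(p+d)=-1$ for infinitely many primes $p$; (ii) $\liminf_{n\to\infty}(p_{n+1}-p_n)\le D_3$.
   Context: $p_n$ is the $n$-th prime. $\Omega(n)$ is the number of prime factors of $n$ counted with multiplicity and $\lambda(n)=(-1)^{\Omega(n)}$. Condition (A): for every $\varepsilon>0$, $A>0$, $\sum_{q\le N^{\vartheta-\varepsilon}}\max_{a:(a,q)=1}\bigl|\sum_{p\le N,\,p\equiv a\ (\mathrm{mod}\ q)}\log p-\frac{N}{\varphi(q)}\bigr|\ll_{\varepsilon,A}\frac{N}{(\log N)^A}$ ($p$ over primes). Condition (B): for every $\varepsilon>0$, $A>0$, $\sum_{q\le N^{\vartheta-\varepsilon}}\max_{y\le N}\max_a\bigl|\sum_{n\le y,\,n\equiv a\ (\mathrm{mod}\ q)}\lambda(n)\bigr|\ll_{\varepsilon,A}\frac{N}{(\log N)^A}$. *)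

theory Defs
  imports "HOL-Analysis.Analysis" "HOL-Number_Theory.Number_Theory"
begin

definition bigOmega :: "nat \<Rightarrow> nat" where
  "bigOmega n = size (prime_factorization n)"

definition liouville :: "nat \<Rightarrow> int" where
  "liouville n = (-1) ^ bigOmega n"

text \<open>0-indexed enumeration of the primes: nth_prime 0 = 2.\<close>
definition nth_prime :: "nat \<Rightarrow> nat" where
  "nth_prime n = enumerate {p. prime p} n"

definition condA :: "real \<Rightarrow> bool" where
  "condA \<theta> \<longleftrightarrow> (\<forall>\<epsilon>>0. \<forall>A>0. \<exists>C. \<forall>\<^sub>F N in at_top.
     (\<Sum>q\<in>{q::nat. 1 \<le> q \<and> real q \<le> N powr (\<theta> - \<epsilon>)}.
        Max ((\<lambda>a. \<bar>(\<Sum>p\<in>{p::nat. prime p \<and> real p \<le> N \<and> [p = a] (mod q)}. ln (real p))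
                    - N / real (totient q)\<bar>) ` {a. a < q \<and> coprime a q}))
     \<le> C * N / (ln N) powr A)"

definition condB :: "real \<Rightarrow> bool" where
  "condB \<theta> \<longleftrightarrow> (\<forall>\<epsilon>>0. \<forall>A>0. \<exists>C. \<forall>\<^sub>F N in at_top.
     (\<Sum>q\<in>{q::nat. 1 \<le> q \<and> real q \<le> N powr (\<theta> - \<epsilon>)}.
        Max ((\<lambda>(y, a). \<bar>real_of_int (\<Sum>n\<in>{n::nat. 1 \<le> n \<and> n \<le> y \<and> [n = a] (mod q)}. liouville n)\<bar>)
              ` ({y::nat. real y \<le> N} \<times> {a. a < q})))
     \<le> C * N / (ln N) powr A)"

end

theory Submission
  imports Defs "HOL-Real_Asymp.Real_Asymp"
begin

text \<open>
  If both alternatives fail, then for a suitable admissible tuple \<open>H\<close> of diameter at most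
  \<open>D\<^sub>3\<close> and a suitable centre \<open>b\<close> every large \<open>m\<close> satisfies
  \<open>#{h \<in> H. m + h prime} \<le> (1 + \<lambda>(m + b)) / 2\<close>.
  This is averaged over \<open>N < m \<le> 2N\<close>, \<open>m \<equiv> \<nu> (mod W)\<close>, against
  the Goldston--Pintz--Yildirim weight: the square of a sum of \<open>\<lambda>\<^sub>d\<close> over squarefree
  \<open>d\<close> dividing \<open>\<Prod>(m + h)\<close>. By condition (B) the Liouville term contributes nothing,
  by condition (A) the left side is a computable quadratic form, and both forms are diagonalised
  exactly in the manner of Selberg. With a linear profile \<open>F(u) = 1 + u\<^sub>0 (1 - u)\<close> the average of
  the left side exceeds one half as soon as the level of distribution exceeds \<open>\<theta>\<^sub>0\<close>.

  Squarefree integers coprime to \<open>W\<close> are represented by their finite sets of prime factors, so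
  that divisibility, lcm and gcd become inclusion, union and intersection.
\<close>

section \<open>Sums over subsets and truncated powers\<close>

text \<open>If (ii) fails, at most one m + h is prime, because \<open>H\<close> has diameter at most
  \<open>D3\<close>. If (i) fails as well, m + h prime forces \<lambda>(m + b) = 1, because m + b =
  (m + h) + (b - h) with 0 < |b - h| \<le> \<open>D4\<close>. As \<lambda> averages to zero against
  the weight, the value to beat is 1/2 rather than 1, so for a given tuple half the usual level of
  distribution suffices. No asymptotic formula and no singular series is needed: the total form is
  bounded only from above, the prime form only from below, and nonnegative profile coefficients let
  one-sided bounds be added term by term. Here W is the product of the primes up to D, so only
  primes p > D are sieved; passing from p - k to p then costs at most a factor exp(2 k / D)^k. First
  N tends to infinity with D fixed, then D is taken large enough for a strict inequality to absorb
  this factor. In the error terms a modulus comes with a weight exponential in its number of prime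
  factors, which (A) and (B) do not carry. Such weights are split against a power of log N, which is
  why (A) and (B) are invoked with a large exponent.\<close>

lemma sum_Pow_insert:
  fixes f :: "'a set \<Rightarrow> 'b::comm_monoid_add"
  assumes "finite A" "a \<notin> A"
  shows "(\<Sum>S\<in>Pow (insert a A). f S) = (\<Sum>S\<in>Pow A. f S) + (\<Sum>S\<in>Pow A. f (insert a S))"
proof -
  have inj: "inj_on (insert a) (Pow A)"
    using assms(2) by (auto simp: inj_on_def)
  have "(\<Sum>S\<in>Pow (insert a A). f S) = (\<Sum>S\<in>Pow A \<union> insert a ` Pow A. f S)"
    by (simp add: Pow_insert)
  also have "\<dots> = (\<Sum>S\<in>Pow A. f S) + (\<Sum>S\<in>insert a ` Pow A. f S)"
    using assms by (intro sum.union_disjoint) auto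
  also have "(\<Sum>S\<in>insert a ` Pow A. f S) = (\<Sum>S\<in>Pow A. f (insert a S))"
    using inj by (simp add: sum.reindex)
  finally show ?thesis .
qed

lemma prod_one_plus_eq_sum_Pow:
  fixes f :: "'a \<Rightarrow> 'b::comm_semiring_1"
  assumes "finite A"
  shows "(\<Prod>p\<in>A. 1 + f p) = (\<Sum>S\<in>Pow A. \<Prod>p\<in>S. f p)"
  using prod_add[OF assms, of f "\<lambda>_. 1"] by (simp add: add.commute)

text \<open>Expanding the product sends every prime of V either to A or to B: the set form of
  convolving two multiplicative functions on squarefree numbers. The inductions on the dimension and
  the comparison of 1/(p - k) with 1/p both split sums this way.\<close>

lemma sum_Pow_prod_add:
  fixes f g :: "'a \<Rightarrow> 'b::comm_semiring_1"
  assumes "finite P"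
  shows "(\<Sum>V\<in>Pow P. (\<Prod>p\<in>V. f p + g p) * G V) =
    (\<Sum>A\<in>Pow P. \<Sum>B\<in>Pow (P - A). prod f A * prod g B * G (A \<union> B))"
proof -
  have "(\<Sum>V\<in>Pow P. (\<Prod>p\<in>V. f p + g p) * G V) =
     (\<Sum>V\<in>Pow P. \<Sum>X\<in>Pow V. prod f X * prod g (V - X) * G V)"
    by (intro sum.cong refl, subst prod_add) (use assms in \<open>auto simp: sum_distrib_right intro: finite_subset\<close>)
  also have "\<dots> = (\<Sum>(V,X)\<in>Sigma (Pow P) Pow. prod f X * prod g (V - X) * G V)"
    using assms by (subst sum.Sigma) (auto intro: finite_subset)
  also have "\<dots> = (\<Sum>(A,B)\<in>Sigma (Pow P) (\<lambda>A. Pow (P - A)). prod f A * prod g B * G (A \<union> B))"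
    by (rule sum.reindex_bij_witness[of _ "\<lambda>(A,B). (A \<union> B, A)" "\<lambda>(V,X). (X, V - X)"])
       (auto simp: Un_absorb1 subset_iff Un_Diff Int_absorb1 intro!: arg_cong2[of _ _ _ _ "(*)"] arg_cong[of _ _ "prod g"] arg_cong[of _ _ G])
  also have "\<dots> = (\<Sum>A\<in>Pow P. \<Sum>B\<in>Pow (P - A). prod f A * prod g B * G (A \<union> B))"
    using assms by (subst sum.Sigma) (auto intro: finite_subset)
  finally show ?thesis .
qed

definition lnprod :: "nat set \<Rightarrow> real" where
  "lnprod S = (\<Sum>p\<in>S. ln (real p))"

text \<open>The truncated power \<open>x\<^sub>+\<^sup>m\<close>; for \<open>m = 0\<close> it is the indicator of \<open>x \<ge> 0\<close>, including \<open>x = 0\<close>.\<close>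
definition tpow :: "nat \<Rightarrow> real \<Rightarrow> real" where
  "tpow m x = (if x \<ge> 0 then x ^ m else 0)"

text \<open>
  For \<open>a p = \<kappa> / p + \<dots>\<close> this sums a multiplicative function of dimension \<open>\<kappa>\<close>, weighted by
  \<open>log(x / t)\<close> to the power \<open>m\<close>, over squarefree \<open>t \<le> x = e\<^sup>v\<close>.
\<close>
abbreviation dim_sum :: "nat set \<Rightarrow> (nat \<Rightarrow> real) \<Rightarrow> nat \<Rightarrow> real \<Rightarrow> real" where
  "dim_sum P a m v \<equiv> (\<Sum>T\<in>Pow P. prod a T * tpow m (v - lnprod T))"

lemma tpow_nonneg: "tpow m x \<ge> 0"
  by (simp add: tpow_def)

lemma tpow_mono: "x \<le> y \<Longrightarrow> tpow m x \<le> tpow m y"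
  by (auto simp: tpow_def power_mono)

lemma tpow_mult: "tpow i x * tpow j x = tpow (i + j) x"
  by (simp add: tpow_def power_add)

lemma lnprod_empty [simp]: "lnprod {} = 0"
  by (simp add: lnprod_def)

lemma lnprod_insert: "finite S \<Longrightarrow> p \<notin> S \<Longrightarrow> lnprod (insert p S) = ln (real p) + lnprod S"
  by (simp add: lnprod_def)

lemma lnprod_Un_disjoint:
  "finite S \<Longrightarrow> finite T \<Longrightarrow> S \<inter> T = {} \<Longrightarrow> lnprod (S \<union> T) = lnprod S + lnprod T"
  by (simp add: lnprod_def sum.union_disjoint)

lemma lnprod_nonneg: "(\<And>p. p \<in> S \<Longrightarrow> prime p) \<Longrightarrow> lnprod S \<ge> 0"
  unfolding lnprod_def by (intro sum_nonneg) (auto simp: Suc_le_eq prime_gt_0_nat)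

lemma lnprod_mono:
  assumes "finite T" "S \<subseteq> T" "\<And>p. p \<in> T \<Longrightarrow> prime p"
  shows "lnprod S \<le> lnprod T"
  unfolding lnprod_def using assms
  by (intro sum_mono2) (auto simp: Suc_le_eq prime_gt_0_nat)

lemma ln_prod_primes:
  assumes "finite S" "\<And>p. p \<in> S \<Longrightarrow> prime p"
  shows "ln (real (\<Prod>S)) = lnprod S"
proof -
  have "ln (\<Prod>p\<in>S. real p) = (\<Sum>p\<in>S. ln (real p))"
    using assms by (intro ln_prod) (auto simp: prime_gt_0_nat)
  thus ?thesis by (simp add: lnprod_def)
qed

section \<open>Integration in the cut-off\<close>

text \<open>Integrating over the cut-off raises the exponent of the truncated power by one. This
  takes the place of partial summation: a bound for exponent 0 is integrated repeatedly.\<close>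

lemma tpow_has_integral:
  assumes "0 \<le> \<tau>" "0 \<le> v"
  shows "((\<lambda>s. tpow m (s - \<tau>)) has_integral (tpow (Suc m) (v - \<tau>) / real (Suc m))) {0..v}"
proof (cases "v < \<tau>")
  case True
  then show ?thesis
    by (auto simp: tpow_def intro!: has_integral_is_0)
next
  case False
  have "((\<lambda>s. (s - \<tau>) ^ m) has_integral
     ((v - \<tau>) ^ Suc m / real (Suc m) - (\<tau> - \<tau>) ^ Suc m / real (Suc m))) {\<tau>..v}"
    using False
    by (intro fundamental_theorem_of_calculus)
       (auto intro!: derivative_eq_intros simp flip: has_real_derivative_iff_has_vector_derivative simp del: power_Suc)
  hence 1: "((\<lambda>s. tpow m (s - \<tau>)) has_integral (tpow (Suc m) (v - \<tau>) / real (Suc m))) {\<tau>..v}"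
    using False by (subst has_integral_cong[where g = "\<lambda>s. (s - \<tau>) ^ m"]) (auto simp: tpow_def)
  \<comment> \<open>At s = \<tau> the integrand is \<open>0 ^ m\<close>, which is 1 for
    \<open>m = 0\<close>; this single point is discarded.\<close>
  have 2: "((\<lambda>s. tpow m (s - \<tau>)) has_integral 0) {0..\<tau>}"
    by (rule has_integral_spike_finite[where S = "{\<tau>}" and f = "\<lambda>_. 0"]) (auto simp: tpow_def)
  show ?thesis
    using has_integral_combine[OF _ _ 2 1] assms False by simp
qed

lemma sum_tpow_has_integral:
  assumes "finite X" "\<And>x. x \<in> X \<Longrightarrow> 0 \<le> \<tau> x" "0 \<le> v"
  shows "((\<lambda>s. \<Sum>x\<in>X. a x * tpow m (s - \<tau> x)) has_integral
           ((\<Sum>x\<in>X. a x * tpow (Suc m) (v - \<tau> x)) / real (Suc m))) {0..v}"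
proof -
  have "((\<lambda>s. \<Sum>x\<in>X. a x * tpow m (s - \<tau> x)) has_integral
           (\<Sum>x\<in>X. a x * (tpow (Suc m) (v - \<tau> x) / real (Suc m)))) {0..v}"
    using assms by (intro has_integral_sum has_integral_mult_right tpow_has_integral) auto
  thus ?thesis by (simp add: sum_divide_distrib)
qed

lemma power_has_integral:
  assumes "0 \<le> (v::real)"
  shows "((\<lambda>s. D * ((s + C) ^ m)) has_integral (D * ((v + C) ^ Suc m - C ^ Suc m) / real (Suc m))) {0..v}"
proof -
  have "((\<lambda>s. (s + C) ^ m) has_integral
     ((v + C) ^ Suc m / real (Suc m) - (0 + C) ^ Suc m / real (Suc m))) {0..v}"
    using assms
    by (intro fundamental_theorem_of_calculus)
       (auto intro!: derivative_eq_intros simp flip: has_real_derivative_iff_has_vector_derivative simp del: power_Suc)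
  from has_integral_mult_right[OF this, of D] show ?thesis
    by (simp add: diff_divide_distrib right_diff_distrib)
qed

text \<open>The linear base bound is integrated \<open>m\<close> times. It is assumed only up to
  \<open>L\<close>, where the set of sieving primes stops; for negative \<open>v\<close> the left
  side vanishes.\<close>

lemma sum_tpow_lower:
  assumes "finite X" "\<And>x. x \<in> X \<Longrightarrow> 0 \<le> \<tau> x" "\<And>x. x \<in> X \<Longrightarrow> 0 \<le> a x"
    and base: "\<And>s. 0 \<le> s \<Longrightarrow> s \<le> L \<Longrightarrow> D * s \<le> (\<Sum>x\<in>X. a x * tpow 0 (s - \<tau> x))"
    and "v \<le> L"
  shows "D * tpow (Suc m) v / real (Suc m) \<le> (\<Sum>x\<in>X. a x * tpow m (v - \<tau> x))"
proof -
  have main: "D * v ^ Suc m / real (Suc m) \<le> (\<Sum>x\<in>X. a x * tpow m (v - \<tau> x))"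
    if "0 \<le> v" "v \<le> L" for v
    using that
  proof (induction m arbitrary: v)
    case 0
    then show ?case using base[of v] by simp
  next
    case (Suc m)
    have i1: "((\<lambda>s. (D / real (Suc m)) * (s + 0) ^ Suc m) has_integral
       ((D / real (Suc m)) * ((v + 0) ^ Suc (Suc m) - 0 ^ Suc (Suc m)) / real (Suc (Suc m)))) {0..v}"
      by (rule power_has_integral) (use Suc in auto)
    have i2: "((\<lambda>s. \<Sum>x\<in>X. a x * tpow m (s - \<tau> x)) has_integral
           ((\<Sum>x\<in>X. a x * tpow (Suc m) (v - \<tau> x)) / real (Suc m))) {0..v}"
      using assms Suc by (intro sum_tpow_has_integral) auto
    have "(D / real (Suc m)) * ((v + 0) ^ Suc (Suc m) - 0 ^ Suc (Suc m)) / real (Suc (Suc m)) \<le>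
       (\<Sum>x\<in>X. a x * tpow (Suc m) (v - \<tau> x)) / real (Suc m)"
      using Suc by (intro has_integral_le[OF i1 i2]) (auto simp del: power_Suc of_nat_Suc)
    thus ?case by (simp add: field_simps del: of_nat_Suc)
  qed
  show ?thesis
  proof (cases "v \<ge> 0")
    case True
    with main[of v] assms show ?thesis by (simp add: tpow_def)
  next
    case False
    with assms show ?thesis by (auto simp: tpow_def[of "Suc m"] intro!: sum_nonneg mult_nonneg_nonneg tpow_nonneg)
  qed
qed

text \<open>Same integration from above; the boundary term \<open>C ^ Suc m\<close> at cut-off 0
  enters with a favourable sign and is dropped.\<close>

lemma sum_tpow_upper:
  assumes "finite X" "\<And>x. x \<in> X \<Longrightarrow> 0 \<le> \<tau> x" "0 \<le> K" "0 \<le> C"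
    and base: "\<And>s. 0 \<le> s \<Longrightarrow> (\<Sum>x\<in>X. a x * tpow 0 (s - \<tau> x)) \<le> K * (s + C)"
    and "0 \<le> v"
  shows "(\<Sum>x\<in>X. a x * tpow m (v - \<tau> x)) \<le> K * (v + C) ^ Suc m / real (Suc m)"
  using \<open>0 \<le> v\<close>
proof (induction m arbitrary: v)
  case 0
  then show ?case using base[of v] by simp
next
  case (Suc m)
  have i1: "((\<lambda>s. (K / real (Suc m)) * (s + C) ^ Suc m) has_integral
     ((K / real (Suc m)) * ((v + C) ^ Suc (Suc m) - C ^ Suc (Suc m)) / real (Suc (Suc m)))) {0..v}"
    by (rule power_has_integral) (use Suc in auto)
  have i2: "((\<lambda>s. \<Sum>x\<in>X. a x * tpow m (s - \<tau> x)) has_integral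
         ((\<Sum>x\<in>X. a x * tpow (Suc m) (v - \<tau> x)) / real (Suc m))) {0..v}"
    using assms Suc by (intro sum_tpow_has_integral) auto
  have "(\<Sum>x\<in>X. a x * tpow (Suc m) (v - \<tau> x)) / real (Suc m) \<le>
     (K / real (Suc m)) * ((v + C) ^ Suc (Suc m) - C ^ Suc (Suc m)) / real (Suc (Suc m))"
    using Suc by (intro has_integral_le[OF i2 i1]) (auto simp del: power_Suc of_nat_Suc)
  also have "\<dots> \<le> (K / real (Suc m)) * (v + C) ^ Suc (Suc m) / real (Suc (Suc m))"
    using assms by (intro divide_right_mono mult_left_mono) auto
  finally show ?case by (simp add: field_simps del: of_nat_Suc power_Suc)
qed

section \<open>Harmonic sums over squarefree numbers\<close>

text \<open>Repeated prime factors are allowed, so that a large \<open>Q\<close> captures the whole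
  harmonic sum up to \<open>x\<close>. Removing primes one at a time then trades repetitions for
  factors p/(p - 1) and 1/(p - 1).\<close>

definition smooth_harm :: "nat set \<Rightarrow> real \<Rightarrow> real" where
  "smooth_harm Q x = (\<Sum>n\<in>{n. 0 < n \<and> real n \<le> x \<and> prime_factors n \<subseteq> Q}. 1 / real n)"

lemma finite_nat_le_real: "finite {n::nat. real n \<le> x}"
proof (rule finite_subset)
  show "{n::nat. real n \<le> x} \<subseteq> {..nat \<lfloor>x\<rfloor>}" by (auto simp: le_nat_floor)
qed simp

lemma finite_smooth: "finite {n::nat. 0 < n \<and> real n \<le> x \<and> prime_factors n \<subseteq> Q}"
  by (rule finite_subset[OF _ finite_nat_le_real[of x]]) auto

lemma smooth_harm_mono: "x \<le> y \<Longrightarrow> smooth_harm Q x \<le> smooth_harm Q y"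
  unfolding smooth_harm_def by (intro sum_mono2 finite_smooth) auto

text \<open>Sort n by whether p divides it. The cofactor m in n = p m may contain p again, hence
  \<open>insert p Q\<close> on the right too.\<close>

lemma smooth_harm_insert:
  assumes "prime p" "p \<notin> Q"
  shows "smooth_harm (insert p Q) x = smooth_harm Q x + smooth_harm (insert p Q) (x / real p) / real p"
proof -
  have p: "p > 0" using assms prime_gt_0_nat by blast
  define A where "A = {n::nat. 0 < n \<and> real n \<le> x \<and> prime_factors n \<subseteq> Q}"
  define B where "B = {n::nat. 0 < n \<and> real n \<le> x / real p \<and> prime_factors n \<subseteq> insert p Q}"
  have pf: "prime_factors (p * n) = insert p (prime_factors n)" if "n > 0" for n
    using that assms p by (simp add: prime_factors_product prime_prime_factors)
  have "{n::nat. 0 < n \<and> real n \<le> x \<and> prime_factors n \<subseteq> insert p Q} = A \<union> (\<lambda>n. p * n) ` B"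
  proof (intro equalityI subsetI)
    fix n assume n: "n \<in> {n::nat. 0 < n \<and> real n \<le> x \<and> prime_factors n \<subseteq> insert p Q}"
    show "n \<in> A \<union> (\<lambda>n. p * n) ` B"
    proof (cases "p dvd n")
      case True
      then obtain m where m: "n = p * m" by blast
      with n have "m > 0" by auto
      hence "m \<in> B" using n p pf[of m] by (auto simp: B_def m field_simps)
      thus ?thesis using m by blast
    next
      case False
      hence "p \<notin> prime_factors n" by auto
      thus ?thesis using n by (auto simp: A_def)
    qed
  next
    fix n assume "n \<in> A \<union> (\<lambda>n. p * n) ` B"
    thus "n \<in> {n::nat. 0 < n \<and> real n \<le> x \<and> prime_factors n \<subseteq> insert p Q}"
    proof
      assume "n \<in> A" thus ?thesis by (auto simp: A_def)
    next
      assume "n \<in> (\<lambda>n. p * n) ` B"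
      then obtain m where "n = p * m" "m \<in> B" by blast
      thus ?thesis using p pf[of m] by (auto simp: B_def field_simps)
    qed
  qed
  moreover have "A \<inter> (\<lambda>n. p * n) ` B = {}"
    using assms pf by (auto simp: A_def B_def)
  moreover have "finite A" "finite B" unfolding A_def B_def by (rule finite_smooth)+
  moreover have "inj_on (\<lambda>n. p * n) B" using p by (auto simp: inj_on_def)
  ultimately have "smooth_harm (insert p Q) x = (\<Sum>n\<in>A. 1 / real n) + (\<Sum>n\<in>B. 1 / real (p * n))"
    unfolding smooth_harm_def by (simp add: sum.union_disjoint sum.reindex)
  also have "(\<Sum>n\<in>B. 1 / real (p * n)) = smooth_harm (insert p Q) (x / real p) / real p"
    by (simp add: smooth_harm_def B_def sum_divide_distrib field_simps)
  finally show ?thesis by (simp add: A_def smooth_harm_def)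
qed

lemma smooth_harm_neg: "x < 1 \<Longrightarrow> smooth_harm Q x = 0"
  unfolding smooth_harm_def by (intro sum.neutral) auto

lemma smooth_harm_insert_le:
  assumes "prime p" "p \<notin> Q"
  shows "smooth_harm (insert p Q) x \<le> real p / (real p - 1) * smooth_harm Q x"
proof (cases "x < 1")
  case True
  then show ?thesis by (simp add: smooth_harm_neg)
next
  case False
  have p: "real p \<ge> 2" using assms prime_ge_2_nat by fastforce
  have "x / real p \<le> x" using p False by (simp add: field_simps)
  hence "smooth_harm (insert p Q) (x / real p) / real p \<le> smooth_harm (insert p Q) x / real p"
    using p by (intro divide_right_mono smooth_harm_mono) auto
  hence "smooth_harm (insert p Q) x \<le> smooth_harm Q x + smooth_harm (insert p Q) x / real p"
    using smooth_harm_insert[OF assms, of x] by linarith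
  thus ?thesis using p by (simp add: field_simps)
qed

text \<open>The previous bound is used only inside the term with cut-off x / p. The resulting 1/(p -
  1) accounts for all powers of p, while one factor p stays visible in the cut-off.\<close>

lemma smooth_harm_insert_le':
  assumes "prime p" "p \<notin> Q"
  shows "smooth_harm (insert p Q) x \<le> smooth_harm Q x + smooth_harm Q (x / real p) / (real p - 1)"
proof -
  have p: "real p \<ge> 2" using assms prime_ge_2_nat by fastforce
  have "smooth_harm (insert p Q) (x / real p) / real p \<le> real p / (real p - 1) * smooth_harm Q (x / real p) / real p"
    using p by (intro divide_right_mono smooth_harm_insert_le assms) auto
  also have "\<dots> = smooth_harm Q (x / real p) / (real p - 1)" using p by simp
  finally show ?thesis using smooth_harm_insert[OF assms, of x] by linarith
qed

lemma smooth_harm_empty_le: "0 < x \<Longrightarrow> smooth_harm {} x \<le> tpow 0 (ln x)"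
proof (cases "x < 1")
  case True
  then show ?thesis by (simp add: smooth_harm_neg tpow_nonneg)
next
  case False
  have "{n. 0 < n \<and> real n \<le> x \<and> prime_factors n \<subseteq> {}} = {1}"
    using False by (auto simp: prime_factorization_empty_iff)
  thus ?thesis using False by (simp add: smooth_harm_def tpow_def)
qed

lemma smooth_harm_le_prod:
  assumes "finite Q" "\<And>p. p \<in> Q \<Longrightarrow> prime p" "0 < x"
  shows "smooth_harm Q x \<le> (\<Prod>p\<in>Q. real p / (real p - 1)) * tpow 0 (ln x)"
  using assms
proof (induction Q rule: finite_induct)
  case empty
  then show ?case using smooth_harm_empty_le by simp
next
  case (insert p Q)
  have p: "real p \<ge> 2" using insert prime_ge_2_nat by fastforce
  have "smooth_harm (insert p Q) x \<le> real p / (real p - 1) * smooth_harm Q x"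
    using insert by (intro smooth_harm_insert_le) auto
  also have "\<dots> \<le> real p / (real p - 1) * ((\<Prod>p\<in>Q. real p / (real p - 1)) * tpow 0 (ln x))"
    using p insert by (intro mult_left_mono) auto
  finally show ?case using insert by (simp add: mult.assoc)
qed

text \<open>Primes of \<open>Q1\<close> cost their full Euler factor and leave the cut-off alone. A
  prime of \<open>Q2\<close> dividing n is recorded in T, where 1/(p - 1) sums all its powers and
  the cut-off keeps just one of them.\<close>

lemma smooth_harm_le_sum_Pow:
  assumes "finite Q1" "finite Q2" "Q1 \<inter> Q2 = {}" "\<And>p. p \<in> Q1 \<union> Q2 \<Longrightarrow> prime p" "0 < x"
  shows "smooth_harm (Q1 \<union> Q2) x \<le> (\<Prod>p\<in>Q1. real p / (real p - 1)) *
    dim_sum Q2 (\<lambda>p. 1 / (real p - 1)) 0 (ln x)"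
  using assms(2-5)
proof (induction Q2 arbitrary: x rule: finite_induct)
  case empty
  then show ?case using smooth_harm_le_prod[OF assms(1), of x] by simp
next
  case (insert p Q2)
  have p: "real p \<ge> 2" using insert.prems prime_ge_2_nat by fastforce
  let ?c = "\<Prod>p\<in>Q1. real p / (real p - 1)"
  let ?S = "\<lambda>x. \<Sum>T\<in>Pow Q2. (\<Prod>p\<in>T. 1 / (real p - 1)) * tpow 0 (ln x - lnprod T)"
  have "smooth_harm (Q1 \<union> insert p Q2) x = smooth_harm (insert p (Q1 \<union> Q2)) x" by simp
  also have "\<dots> \<le> smooth_harm (Q1 \<union> Q2) x + smooth_harm (Q1 \<union> Q2) (x / real p) / (real p - 1)"
    using insert by (intro smooth_harm_insert_le') auto
  also have "\<dots> \<le> ?c * ?S x + ?c * ?S (x / real p) / (real p - 1)"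
    using insert p by (intro add_mono divide_right_mono insert.IH) auto
  also have "?S (x / real p) / (real p - 1) =
     (\<Sum>T\<in>Pow Q2. (\<Prod>p\<in>insert p T. 1 / (real p - 1)) * tpow 0 (ln x - lnprod (insert p T)))"
    unfolding sum_divide_distrib
  proof (intro sum.cong refl)
    fix T assume "T \<in> Pow Q2"
    hence T: "finite T" "p \<notin> T" using insert finite_subset by auto
    show "(\<Prod>p\<in>T. 1 / (real p - 1)) * tpow 0 (ln (x / real p) - lnprod T) / (real p - 1) =
      (\<Prod>p\<in>insert p T. 1 / (real p - 1)) * tpow 0 (ln x - lnprod (insert p T))"
      using T p insert.prems by (simp add: lnprod_insert ln_div algebra_simps)
  qed
  hence "?c * ?S x + ?c * ?S (x / real p) / (real p - 1) = ?c * (?S x + 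
     (\<Sum>T\<in>Pow Q2. (\<Prod>p\<in>insert p T. 1 / (real p - 1)) * tpow 0 (ln x - lnprod (insert p T))))"
    by (simp only: times_divide_eq_right[symmetric] distrib_left)
  also have "\<dots> = ?c * dim_sum (insert p Q2) (\<lambda>p. 1 / (real p - 1)) 0 (ln x)"
    using insert by (subst sum_Pow_insert) auto
  finally show ?case .
qed

text \<open>
  The set form of \<open>\<Sum> \<mu>\<^sup>2(t)/\<phi>(t) \<ge> (\<phi>(q)/q) log x\<close>, the sum being over \<open>t \<le> x\<close> coprime to
  \<open>q\<close>. It is free of error terms, hence uniform in \<open>q\<close>.
\<close>
lemma sum_Pow_inverse_totient_ge:
  assumes "finite Q1" "finite Q2" "Q1 \<inter> Q2 = {}" "\<And>p. p \<in> Q1 \<union> Q2 \<Longrightarrow> prime p"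
    and "\<And>p. prime p \<Longrightarrow> ln (real p) \<le> L \<Longrightarrow> p \<in> Q1 \<union> Q2"
    and "0 \<le> v" "v \<le> L"
  shows "(\<Prod>p\<in>Q1. 1 - 1 / real p) * v \<le>
    dim_sum Q2 (\<lambda>p. 1 / (real p - 1)) 0 v"
proof -
  define n where "n = nat \<lfloor>exp v\<rfloor>"
  have n: "real n \<le> exp v" "exp v \<le> real n + 1"
    unfolding n_def by (simp_all add: of_nat_nat)
  \<comment> \<open>Rounding loses nothing: n is the integer part of exp v, so v is at most ln (n +
    1), which in turn is at most the harmonic sum up to n.\<close>
  have "v \<le> ln (real n + 1)" using n by (simp add: ln_ge_iff)
  also have "\<dots> \<le> harm n" by (rule ln_le_harm)
  also have "\<dots> = (\<Sum>k\<in>{1..n}. 1 / real k)" by (simp add: harm_def divide_simps)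
  also have "\<dots> \<le> smooth_harm (Q1 \<union> Q2) (exp v)"
    unfolding smooth_harm_def
  proof (intro sum_mono2 finite_smooth subsetI)
    fix k assume "k \<in> {1..n}"
    hence k: "0 < k" "real k \<le> exp v" using n by auto
    have "p \<in> Q1 \<union> Q2" if "p \<in> prime_factors k" for p
    proof (rule assms(5))
      show pp: "prime p" using that by auto
      have "p \<le> k" using that k by (auto dest: dvd_imp_le)
      hence "real p \<le> exp v" using k by linarith
      hence "ln (real p) \<le> ln (exp v)" using pp by (subst ln_le_cancel_iff) (auto simp: prime_gt_0_nat)
      hence "ln (real p) \<le> v" by simp
      thus "ln (real p) \<le> L" using assms by linarith
    qed
    thus "k \<in> {k. 0 < k \<and> real k \<le> exp v \<and> prime_factors k \<subseteq> Q1 \<union> Q2}" using k by auto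
  qed auto
  also have "\<dots> \<le> (\<Prod>p\<in>Q1. real p / (real p - 1)) *
    dim_sum Q2 (\<lambda>p. 1 / (real p - 1)) 0 (ln (exp v))"
    using assms by (intro smooth_harm_le_sum_Pow) auto
  finally have *: "v \<le> (\<Prod>p\<in>Q1. real p / (real p - 1)) *
    dim_sum Q2 (\<lambda>p. 1 / (real p - 1)) 0 v" (is "_ \<le> ?c * ?S") by simp
  have "(\<Prod>p\<in>Q1. 1 - 1 / real p) * ?c = (\<Prod>p\<in>Q1. (1 - 1 / real p) * (real p / (real p - 1)))"
    by (simp only: prod.distrib)
  also have "\<dots> = 1"
  proof (intro prod.neutral ballI)
    fix p assume "p \<in> Q1"
    hence "real p \<ge> 2" using assms(4) prime_ge_2_nat by fastforce
    thus "(1 - 1 / real p) * (real p / (real p - 1)) = 1" by (simp add: field_simps)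
  qed
  finally have 1: "(\<Prod>p\<in>Q1. 1 - 1 / real p) * ?c = 1" .
  have "(\<Prod>p\<in>Q1. 1 - 1 / real p) * v \<le> (\<Prod>p\<in>Q1. 1 - 1 / real p) * (?c * ?S)"
  proof (intro mult_left_mono * prod_nonneg)
    fix p assume "p \<in> Q1"
    hence "real p \<ge> 2" using assms(4) prime_ge_2_nat by fastforce
    thus "0 \<le> 1 - 1 / real p" by simp
  qed
  also have "\<dots> = ?S" using 1 by (simp add: mult.assoc[symmetric])
  finally show ?thesis .
qed

section \<open>Harmonic sums over integers coprime to W\<close>

lemma coprime_add_mult_iff: "coprime (m + j * W) W \<longleftrightarrow> coprime m (W::nat)"
  by (metis add.commute coprime_iff_gcd_eq_1 gcd.commute gcd_add_mult)

lemma card_coprime_block: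
  "card {n\<in>{j*W<..Suc j*W}. coprime n W} = totient W"
proof -
  have "bij_betw (\<lambda>n. n + j * W) (totatives W) {n\<in>{j*W<..Suc j*W}. coprime n W}"
  proof (rule bij_betwI[where g = "\<lambda>n. n - j * W"])
    show "(\<lambda>n. n + j * W) \<in> totatives W \<rightarrow> {n\<in>{j*W<..Suc j*W}. coprime n W}"
      by (auto simp: totatives_def coprime_add_mult_iff)
    show "(\<lambda>n. n - j * W) \<in> {n\<in>{j*W<..Suc j*W}. coprime n W} \<rightarrow> totatives W"
    proof
      fix n assume n: "n \<in> {n\<in>{j*W<..Suc j*W}. coprime n W}"
      define m where "m = n - j * W"
      have nm: "n = m + j * W" using n by (auto simp: m_def)
      show "n - j * W \<in> totatives W" using n unfolding totatives_def m_def[symmetric]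
        by (simp add: nm coprime_add_mult_iff)
    qed
  qed auto
  thus ?thesis by (simp add: totient_def bij_betw_same_card)
qed

text \<open>Each block of W consecutive integers following j W holds exactly
  \<open>totient W\<close> integers coprime to W, each contributing at most 1/(j W). The initial
  block is bounded trivially by W.\<close>

lemma sum_coprime_inverse_blocks:
  assumes "W > 0"
  shows "(\<Sum>n\<in>{n\<in>{0<..Suc J*W}. coprime n W}. 1 / real n) \<le> real W + real (totient W) / real W * harm J"
proof (induction J)
  case 0
  have "(\<Sum>n\<in>{n\<in>{0<..Suc 0*W}. coprime n W}. 1 / real n) \<le> (\<Sum>n\<in>{0<..W}. 1)"
    by (rule sum_le_included[where i = id]) (auto simp: field_simps)
  then show ?case by (simp add: harm_expand)
next
  case (Suc J)
  let ?A = "{n\<in>{0<..Suc J*W}. coprime n W}" and ?B = "{n\<in>{Suc J*W<..Suc (Suc J)*W}. coprime n W}"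
  have "{n\<in>{0<..Suc (Suc J)*W}. coprime n W} = ?A \<union> ?B"
    by (auto simp del: mult_Suc simp: not_le) (simp_all add: algebra_simps)
  hence 0: "(\<Sum>n\<in>{n\<in>{0<..Suc (Suc J)*W}. coprime n W}. 1 / real n) = (\<Sum>n\<in>?A. 1 / real n) + (\<Sum>n\<in>?B. 1 / real n)"
    by (simp only:) (rule sum.union_disjoint; force simp del: mult_Suc)
  have "(\<Sum>n\<in>?B. 1 / real n) \<le> (\<Sum>n\<in>?B. 1 / real (Suc J * W))"
  proof (intro sum_mono divide_left_mono)
    fix n assume n: "n \<in> ?B"
    have *: "Suc J * W < n" using n by (simp only: mem_Collect_eq greaterThanAtMost_iff)
    thus "real (Suc J * W) \<le> real n" by (simp only: of_nat_le_iff less_imp_le)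
    have "0 < n" "0 < Suc J * W" using * assms by (simp_all only: mult_pos_pos zero_less_Suc)
    thus "0 < real n * real (Suc J * W)" by (simp only: of_nat_0_less_iff mult_pos_pos)
  qed simp
  also have "\<dots> = real (card ?B) * (1 / real (Suc J * W))" by (simp only: sum_constant)
  also have "\<dots> = real (totient W) / real W * (1 / real (Suc J))"
    unfolding card_coprime_block of_nat_mult by simp
  finally have 1: "(\<Sum>n\<in>?B. 1 / real n) \<le> real (totient W) / real W * (1 / real (Suc J))" .
  have 2: "harm (Suc J) = harm J + 1 / real (Suc J)" by (simp add: harm_Suc inverse_eq_divide)
  show ?case unfolding 0 2 distrib_left using Suc 1 by linarith
qed

lemma sum_coprime_inverse_le:
  assumes "W > 0" "0 \<le> v"
  shows "(\<Sum>n\<in>{n. 0 < n \<and> real n \<le> exp v \<and> coprime n W}. 1 / real n) \<le>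
     real (totient W) / real W * (v + (real W * real W + 1))"
proof -
  define J where "J = nat \<lfloor>exp v\<rfloor>"
  have Jge: "J \<ge> 1" using assms by (auto simp: J_def le_nat_floor)
  have J: "real J \<le> exp v" unfolding J_def by (simp add: of_nat_nat)
  have "(\<Sum>n\<in>{n. 0 < n \<and> real n \<le> exp v \<and> coprime n W}. 1 / real n) \<le>
     (\<Sum>n\<in>{n\<in>{0<..Suc J*W}. coprime n W}. 1 / real n)"
  proof (intro sum_mono2)
    show "{n. 0 < n \<and> real n \<le> exp v \<and> coprime n W} \<subseteq> {n\<in>{0<..Suc J*W}. coprime n W}"
    proof safe
      fix n assume n: "0 < n" "real n \<le> exp v"
      have "n \<le> J" using n by (simp add: J_def le_nat_floor)
      also have "J \<le> Suc J * W" using assms by (cases W) auto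
      finally show "n \<in> {0<..Suc J*W}" using n by auto
    qed
  qed auto
  also have "\<dots> \<le> real W + real (totient W) / real W * harm J"
    by (rule sum_coprime_inverse_blocks) fact
  also have "\<dots> \<le> real W + real (totient W) / real W * (v + 1)"
  proof -
    have "ln (real J) \<le> ln (exp v)" using J Jge by (subst ln_le_cancel_iff) auto
    hence "harm J \<le> v + (1::real)"
      using euler_mascheroni_sequence_decreasing[of 1 J] Jge by (simp add: harm_expand)
    thus ?thesis by (intro add_left_mono mult_left_mono) auto
  qed
  \<comment> \<open>Because \<open>totient W\<close> is at least 1, the stray term W is at most
    (\<open>totient W\<close> / W) W^2. This is the origin of the constant W^2 + 1, later called
    \<open>C\<close>.\<close>
  also have "real W + real (totient W) / real W * (v + 1) \<le> real (totient W) / real W * (v + (real W * real W + 1))"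
  proof -
    have "real (totient W) \<ge> 1" using assms by (simp add: Suc_le_eq)
    hence "real W \<le> real (totient W) * real W" using assms by simp
    also have "\<dots> = real (totient W) / real W * (real W * real W)" using assms by simp
    finally show ?thesis by (simp add: distrib_left)
  qed
  finally show ?thesis .
qed

lemma prime_factors_prod_primes:
  assumes "finite T" "\<And>p. p \<in> T \<Longrightarrow> prime (p::nat)"
  shows "prime_factors (\<Prod>T) = T"
proof -
  have "0 \<notin> id ` T" using assms(2) by fastforce
  hence "prime_factors (prod id T) = \<Union>((prime_factors \<circ> id) ` T)"
    using assms by (intro prime_factors_prod) auto
  also have "\<dots> = T" using assms(2) by (auto simp: prime_prime_factors)
  finally show ?thesis by (simp add: id_def)
qed

lemma inj_on_prod_primes:
  assumes "finite P" "\<And>p. p \<in> P \<Longrightarrow> prime (p::nat)"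
  shows "inj_on (\<lambda>T. \<Prod>T) (Pow P)"
proof (rule inj_onI)
  fix S T assume "S \<in> Pow P" "T \<in> Pow P" "\<Prod>S = \<Prod>T"
  thus "S = T" using prime_factors_prod_primes[of S] prime_factors_prod_primes[of T] assms
    by (metis PowD finite_subset subsetD)
qed

text \<open>The products over T are distinct integers below exp v coprime to W, so the sum embeds in
  the harmonic sum over all such integers. Forgetting squarefreeness is cheap when all primes of
  \<open>P\<close> are large.\<close>

lemma sum_Pow_inverse_le:
  assumes "finite P" "\<And>p. p \<in> P \<Longrightarrow> prime p" "\<And>p. p \<in> P \<Longrightarrow> coprime p W" "W > 0" "0 \<le> v"
  shows "dim_sum P (\<lambda>p. 1 / real p) 0 v \<le>
     real (totient W) / real W * (v + (real W * real W + 1))"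
proof -
  let ?A = "{T\<in>Pow P. lnprod T \<le> v}"
  have fin: "finite T" if "T \<in> Pow P" for T using that assms finite_subset by auto
  have "dim_sum P (\<lambda>p. 1 / real p) 0 v = (\<Sum>T\<in>?A. 1 / real (\<Prod>T))"
    using assms by (intro sum.mono_neutral_cong_right) (auto simp: tpow_def prod_dividef)
  also have "\<dots> = (\<Sum>n\<in>(\<lambda>T. \<Prod>T) ` ?A. 1 / real n)"
    using inj_on_subset[OF inj_on_prod_primes[OF assms(1,2)], of ?A] by (subst sum.reindex) auto
  also have "\<dots> \<le> (\<Sum>n\<in>{n. 0 < n \<and> real n \<le> exp v \<and> coprime n W}. 1 / real n)"
  proof (intro sum_mono2 subsetI)
    show "finite {n. 0 < n \<and> real n \<le> exp v \<and> coprime n W}"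
      by (rule finite_subset[OF _ finite_nat_le_real[of "exp v"]]) auto
    fix n assume "n \<in> (\<lambda>T. \<Prod>T) ` ?A"
    then obtain T where T: "n = \<Prod>T" "T \<in> Pow P" "lnprod T \<le> v" by auto
    have pr: "\<And>p. p \<in> T \<Longrightarrow> prime p" using T assms by auto
    have pos: "\<Prod>T > 0" using pr by (intro prod_pos) (auto simp: prime_gt_0_nat)
    have "ln (real (\<Prod>T)) \<le> v" using ln_prod_primes[OF fin[OF T(2)] pr] T by simp
    hence "real (\<Prod>T) \<le> exp v" using pos by (metis ln_ge_iff exp_le_cancel_iff exp_ln of_nat_0_less_iff)
    moreover have "coprime (\<Prod>T) W" using T assms by (intro prod_coprime_left) auto
    ultimately show "n \<in> {n. 0 < n \<and> real n \<le> exp v \<and> coprime n W}" using pos T by simp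
  qed auto
  also have "\<dots> \<le> real (totient W) / real W * (v + (real W * real W + 1))"
    using assms by (intro sum_coprime_inverse_le) auto
  finally show ?thesis .
qed

lemma sum_inverse_squares_le:
  assumes "finite P" "\<And>p. p \<in> P \<Longrightarrow> p > D" "D > (0::nat)"
  shows "(\<Sum>p\<in>P. 1 / (real p)\<^sup>2) \<le> 1 / real D"
proof -
  have tele: "(\<Sum>n\<in>{D<..D+m}. 1 / (real n)\<^sup>2) \<le> 1 / real D - 1 / real (D + m)" for m
  proof (induction m)
    case 0
    then show ?case by simp
  next
    case (Suc m)
    have "{D<..D + Suc m} = insert (D + Suc m) {D<..D+m}" by auto
    hence "(\<Sum>n\<in>{D<..D+Suc m}. 1 / (real n)\<^sup>2) = 1 / (real (D + Suc m))\<^sup>2 + (\<Sum>n\<in>{D<..D+m}. 1 / (real n)\<^sup>2)"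
      by simp
    moreover have "1 / (real (D + Suc m))\<^sup>2 \<le> 1 / real (D + m) - 1 / real (D + Suc m)"
    proof -
      define y where "y = real (D + m)"
      have y: "y > 0" "real (D + Suc m) = y + 1" using assms by (auto simp: y_def)
      have "1 / (y + 1)\<^sup>2 \<le> 1 / (y * (y + 1))" using y
        by (intro divide_left_mono) (auto simp: power2_eq_square)
      also have "\<dots> = 1 / y - 1 / (y + 1)" using y by (simp add: field_simps)
      finally show ?thesis unfolding y(2) by (simp add: y_def)
    qed
    ultimately show ?case using Suc by linarith
  qed
  define M where "M = Max (insert D P)"
  have "P \<subseteq> {D<..D+M}" using assms by (auto simp: M_def) (meson Max_ge finite_insert insertI2 trans_le_add2)
  hence "(\<Sum>p\<in>P. 1 / (real p)\<^sup>2) \<le> (\<Sum>n\<in>{D<..D+M}. 1 / (real n)\<^sup>2)"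
    by (intro sum_mono2) auto
  also have "\<dots> \<le> 1 / real D" using tele[of M] by (rule order_trans) simp
  finally show ?thesis .
qed

text \<open>Write 1/(p - k) = 1/p + k/(p (p - k)). The second part is summable over p > D, and its
  full Euler product, taken without any cut-off, is at most exp(2 k / D).\<close>

lemma sum_Pow_shifted_inverse_le:
  assumes "finite P" "\<And>p. p \<in> P \<Longrightarrow> prime p" "\<And>p. p \<in> P \<Longrightarrow> coprime p W" "W > 0" "0 \<le> v"
    and "\<And>p. p \<in> P \<Longrightarrow> p > D" "2 * k \<le> D" "D > 0"
  shows "dim_sum P (\<lambda>p. 1 / (real p - real k)) 0 v \<le>
     exp (2 * real k / real D) * (real (totient W) / real W) * (v + (real W * real W + 1))"
proof -
  let ?f = "\<lambda>p. real k / (real p * (real p - real k))" and ?g = "\<lambda>p. 1 / real p"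
  have p: "real p > 2 * real k" "real p > 0" if "p \<in> P" for p
    using assms(6)[OF that] assms(7,8) by linarith+
  have fpos: "?f p \<ge> 0" if "p \<in> P" for p using p[OF that] by (intro divide_nonneg_nonneg mult_nonneg_nonneg) auto
  let ?S = "\<Sum>B\<in>Pow P. prod ?g B * tpow 0 (v - lnprod B)"
  have "dim_sum P (\<lambda>p. 1 / (real p - real k)) 0 v =
    dim_sum P (\<lambda>p. ?f p + ?g p) 0 v"
  proof (intro sum.cong refl arg_cong2[of _ _ _ _ "(*)"] prod.cong)
    fix T q assume "T \<in> Pow P" "q \<in> T"
    hence "q \<in> P" by auto
    from p[OF this] show "1 / (real q - real k) = ?f q + ?g q" by (simp add: field_simps)
  qed
  also have "\<dots> = (\<Sum>A\<in>Pow P. \<Sum>B\<in>Pow (P - A). prod ?f A * prod ?g B * tpow 0 (v - lnprod (A \<union> B)))"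
    by (rule sum_Pow_prod_add) fact
  also have "\<dots> \<le> (\<Sum>A\<in>Pow P. prod ?f A * ?S)"
  proof (rule sum_mono)
    fix A assume A: "A \<in> Pow P"
    have fA: "prod ?f A \<ge> 0" using A fpos by (intro prod_nonneg) auto
    have "(\<Sum>B\<in>Pow (P - A). prod ?f A * prod ?g B * tpow 0 (v - lnprod (A \<union> B))) \<le>
       (\<Sum>B\<in>Pow (P - A). prod ?f A * (prod ?g B * tpow 0 (v - lnprod B)))"
      unfolding mult.assoc
    proof (intro sum_mono mult_left_mono fA tpow_mono diff_left_mono lnprod_mono prod_nonneg)
      fix B assume "B \<in> Pow (P - A)"
      thus "finite (A \<union> B)" using A assms(1) by (auto intro: finite_subset)
    qed (use A assms in auto)
    also have "\<dots> = prod ?f A * dim_sum (P - A) ?g 0 v"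
      by (simp add: sum_distrib_left)
    also have "\<dots> \<le> prod ?f A * ?S"
      using assms by (intro mult_left_mono fA sum_mono2 mult_nonneg_nonneg prod_nonneg tpow_nonneg) auto
    finally show "(\<Sum>B\<in>Pow (P - A). prod ?f A * prod ?g B * tpow 0 (v - lnprod (A \<union> B))) \<le> prod ?f A * ?S" .
  qed
  also have "\<dots> = (\<Prod>p\<in>P. 1 + ?f p) * ?S"
    using assms(1) by (simp add: prod_one_plus_eq_sum_Pow sum_distrib_right)
  also have "\<dots> \<le> exp (2 * real k / real D) * ?S"
  proof (intro mult_right_mono sum_nonneg mult_nonneg_nonneg prod_nonneg tpow_nonneg)
    have "(\<Prod>p\<in>P. 1 + ?f p) \<le> (\<Prod>p\<in>P. exp (2 * real k * (1 / (real p)\<^sup>2)))"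
    proof (intro prod_mono conjI)
      fix q assume q: "q \<in> P"
      show "0 \<le> 1 + ?f q" using fpos[OF q] by simp
      \<comment> \<open>From D \<ge> 2 k every p in \<open>P\<close> satisfies p - k \<ge> p / 2.
        With the sum of 1/p^2 over p > D being at most 1/D, this gives the exponent 2 k / D.\<close>
      have "?f q \<le> real k / (real q * (real q / 2))"
        using p[OF q] by (intro divide_left_mono mult_left_mono mult_pos_pos) auto
      also have "\<dots> = 2 * real k * (1 / (real q)\<^sup>2)" by (simp add: power2_eq_square)
      finally have "1 + ?f q \<le> 1 + 2 * real k * (1 / (real q)\<^sup>2)" by simp
      also have "\<dots> \<le> exp (2 * real k * (1 / (real q)\<^sup>2))" by (rule exp_ge_add_one_self)
      finally show "1 + ?f q \<le> exp (2 * real k * (1 / (real q)\<^sup>2))" .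
    qed
    also have "\<dots> = exp (2 * real k * (\<Sum>p\<in>P. 1 / (real p)\<^sup>2))"
      by (simp add: exp_sum assms(1) sum_distrib_left)
    also have "\<dots> \<le> exp (2 * real k * (1 / real D))"
      using sum_inverse_squares_le[OF assms(1,6,8)] by (subst exp_le_cancel_iff, intro mult_left_mono) auto
    finally show "(\<Prod>p\<in>P. 1 + ?f p) \<le> exp (2 * real k / real D)" by simp
  qed auto
  also have "\<dots> \<le> exp (2 * real k / real D) * (real (totient W) / real W * (v + (real W * real W + 1)))"
    using assms by (intro mult_left_mono sum_Pow_inverse_le) auto
  finally show ?thesis by (simp add: mult.assoc)
qed

section \<open>From dimension one to higher dimensions\<close>

text \<open>The primes of \<open>A\<close> join the excluded set \<open>Q\<close>, at the price of
  their factors 1 - 1/p. The harmonic lower bound is uniform in the excluded set, so no error term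
  accumulates when this is later summed over \<open>A\<close>.\<close>

lemma sum_Pow_inner_lower:
  assumes "finite P" "finite Q" "Q \<inter> P = {}" "\<And>p. p \<in> Q \<union> P \<Longrightarrow> prime p"
    and "\<And>p. prime p \<Longrightarrow> ln (real p) \<le> L \<Longrightarrow> p \<in> Q \<union> P"
    and "A \<subseteq> P" "\<And>p. p \<in> P \<Longrightarrow> 1 / (real p - 1) \<le> x p" "v \<le> L"
  shows "(\<Prod>p\<in>Q. 1 - 1 / real p) * (\<Prod>p\<in>A. 1 - 1 / real p) * tpow (Suc m) v / real (Suc m) \<le>
    dim_sum (P - A) x m v"
proof (rule sum_tpow_lower[where L = L])
  have pg: "real p \<ge> 2" if "p \<in> P" for p using assms(4) that prime_ge_2_nat by fastforce
  have xpos: "0 < x p" if "p \<in> P" for p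
    using assms(7)[OF that] pg[OF that] by (smt (verit) divide_pos_pos)
  show "0 \<le> lnprod B" if "B \<in> Pow (P - A)" for B
    using that assms by (intro lnprod_nonneg) auto
  show "0 \<le> prod x B" if "B \<in> Pow (P - A)" for B
    using that xpos by (intro prod_nonneg) (auto simp: less_imp_le)
  fix s assume s: "0 \<le> s" "s \<le> L"
  have "(\<Prod>p\<in>Q. 1 - 1 / real p) * (\<Prod>p\<in>A. 1 - 1 / real p) * s = (\<Prod>p\<in>Q \<union> A. 1 - 1 / real p) * s"
    using assms finite_subset by (subst prod.union_disjoint) auto
  also have "\<dots> \<le> dim_sum (P - A) (\<lambda>p. 1 / (real p - 1)) 0 s"
    using assms s finite_subset by (intro sum_Pow_inverse_totient_ge[where L = L]) auto
  also have "\<dots> \<le> dim_sum (P - A) x 0 s"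
  proof (intro sum_mono mult_right_mono prod_mono tpow_nonneg)
    fix T q assume "T \<in> Pow (P - A)" "q \<in> T"
    hence "q \<in> P" by auto
    thus "0 \<le> 1 / (real q - 1) \<and> 1 / (real q - 1) \<le> x q" using assms(7) pg by fastforce
  qed
  finally show "(\<Prod>p\<in>Q. 1 - 1 / real p) * (\<Prod>p\<in>A. 1 - 1 / real p) * s \<le>
    dim_sum (P - A) x 0 s" .
qed (use assms in auto)

text \<open>
  The coprimality of the \<open>j + 1\<close> factors costs a factor \<open>1 - 1/p\<close> at each step, which the
  assumption on \<open>x\<close> absorbs.
\<close>
lemma sum_Pow_iterated_lower:
  assumes "finite P" "finite Q" "Q \<inter> P = {}" "\<And>p. p \<in> Q \<union> P \<Longrightarrow> prime p"
    and "\<And>p. prime p \<Longrightarrow> ln (real p) \<le> L \<Longrightarrow> p \<in> Q \<union> P"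
    and "\<And>p. p \<in> P \<Longrightarrow> 1 / (real p - 1) \<le> x p * (1 - 1 / real p) ^ j" "v \<le> L"
  shows "(\<Prod>p\<in>Q. 1 - 1 / real p) ^ Suc j * (fact m / fact (m + Suc j)) * tpow (m + Suc j) v \<le>
    dim_sum P (\<lambda>p. real (Suc j) * x p) m v"
  using assms(6)
proof (induction j arbitrary: m x)
  case 0
  have "(\<Prod>p\<in>Q. 1 - 1 / real p) * (\<Prod>p\<in>{}. 1 - 1 / real p) * tpow (Suc m) v / real (Suc m) \<le>
    dim_sum (P - {}) x m v"
    using assms 0 by (intro sum_Pow_inner_lower) auto
  moreover have "fact m / fact (Suc m) = 1 / real (Suc m)" by simp
  moreover have s0: "real (Suc 0) = 1" by simp
  ultimately show ?case by (simp del: of_nat_Suc fact_Suc add: s0)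
next
  case (Suc j)
  let ?d = "\<Prod>p\<in>Q. 1 - 1 / real p"
  have pg: "real p \<ge> 2" if "p \<in> P" for p using assms(4) that prime_ge_2_nat by fastforce
  have x1: "1 / (real p - 1) \<le> x p" if "p \<in> P" for p
  proof -
    have *: "0 < 1 / (real p - 1)" "0 < 1 - 1 / real p" "1 - 1 / real p \<le> 1" using pg[OF that] by auto
    have xp: "x p > 0"
    proof (rule ccontr)
      assume "\<not> x p > 0"
      hence "x p * (1 - 1 / real p) ^ Suc j \<le> 0"
        using * by (intro mult_nonpos_nonneg zero_le_power) auto
      thus False using Suc.prems[OF that] * by linarith
    qed
    have "x p * (1 - 1 / real p) ^ Suc j \<le> x p * 1"
      using xp * by (intro mult_left_mono power_le_one) auto
    thus ?thesis using Suc.prems[OF that] by simp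
  qed
  have d0: "?d \<ge> 0"
  proof (intro prod_nonneg)
    fix p assume "p \<in> Q"
    hence "real p \<ge> 2" using assms(4) prime_ge_2_nat by fastforce
    thus "0 \<le> 1 - 1 / real p" by simp
  qed
  have xpos: "0 \<le> x p" if "p \<in> P" for p
    using x1[OF that] pg[OF that] by (smt (verit) divide_pos_pos)
  have e1: "fact m / fact (Suc m + Suc j) = 1 / real (Suc m) * (fact (Suc m) / fact (Suc m + Suc j))"
    by (simp only: fact_Suc[of m]) simp
  have e2: "m + Suc (Suc j) = Suc m + Suc j" by simp
  have "?d ^ Suc (Suc j) * (fact m / fact (m + Suc (Suc j))) * tpow (m + Suc (Suc j)) v =
    ?d / real (Suc m) * (?d ^ Suc j * (fact (Suc m) / fact (Suc m + Suc j)) * tpow (Suc m + Suc j) v)"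
    by (simp only: e1 e2 power_Suc[of _ "Suc j"] times_divide_eq_left times_divide_eq_right mult_ac mult_1_left)
  \<comment> \<open>The induction hypothesis is used for exponent \<open>Suc m\<close> and for x p
    (1 - 1/p) in place of x p. The extra factors 1 - 1/p over A are exactly those needed to turn the
    truncated power into a sum over subsets of P - A.\<close>
  also have "\<dots> \<le> ?d / real (Suc m) * dim_sum P (\<lambda>p. real (Suc j) * (x p * (1 - 1 / real p))) (Suc m) v"
    using Suc.prems d0 by (intro mult_left_mono Suc.IH) (auto simp: mult.assoc)
  also have "\<dots> = (\<Sum>A\<in>Pow P. (\<Prod>p\<in>A. real (Suc j) * x p) * (?d * (\<Prod>p\<in>A. 1 - 1 / real p) * tpow (Suc m) (v - lnprod A) / real (Suc m)))"
    unfolding sum_distrib_left by (intro sum.cong refl) (simp add: prod.distrib mult_ac)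
  also have "\<dots> \<le> (\<Sum>A\<in>Pow P. (\<Prod>p\<in>A. real (Suc j) * x p) * dim_sum (P - A) x m (v - lnprod A))"
  proof (intro sum_mono mult_left_mono sum_Pow_inner_lower prod_nonneg)
    fix A assume A: "A \<in> Pow P"
    hence "lnprod A \<ge> 0" using assms by (intro lnprod_nonneg) auto
    thus "v - lnprod A \<le> L" using assms by simp
  qed (use assms x1 xpos in auto)
  also have "\<dots> = (\<Sum>A\<in>Pow P. \<Sum>B\<in>Pow (P - A). (\<Prod>p\<in>A. real (Suc j) * x p) * prod x B * tpow m (v - lnprod (A \<union> B)))"
    unfolding sum_distrib_left mult.assoc
  proof (intro sum.cong refl arg_cong2[of _ _ _ _ "(*)"] arg_cong[of _ _ "tpow m"])
    fix A B assume "A \<in> Pow P" "B \<in> Pow (P - A)"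
    hence "lnprod (A \<union> B) = lnprod A + lnprod B"
      using assms(1) by (intro lnprod_Un_disjoint) (auto intro: finite_subset)
    thus "v - lnprod A - lnprod B = v - lnprod (A \<union> B)" by simp
  qed
  also have "\<dots> = dim_sum P (\<lambda>p. real (Suc j) * x p + x p) m v"
    by (rule sum_Pow_prod_add[symmetric]) fact
  also have "\<dots> = dim_sum P (\<lambda>p. real (Suc (Suc j)) * x p) m v"
    by (simp add: algebra_simps)
  finally show ?case .
qed

text \<open>Each step splits off one more copy of \<open>a\<close>, forgets that B must avoid A, and
  moves the cut-off from v to v + C. The shift keeps the bound in truncated-power form, so the
  induction hypothesis applies at v + C.\<close>

lemma sum_Pow_iterated_upper:
  assumes "finite P" "\<And>p. p \<in> P \<Longrightarrow> prime p" "\<And>p. p \<in> P \<Longrightarrow> 0 \<le> a p" "0 \<le> K" "0 \<le> C"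
    and base: "\<And>s. 0 \<le> s \<Longrightarrow> dim_sum P a 0 s \<le> K * (s + C)"
    and "0 \<le> v"
  shows "dim_sum P (\<lambda>p. real j * a p) m v \<le>
    K ^ j * (fact m / fact (m + j)) * (v + real j * C) ^ (m + j)"
  using assms(7)
proof (induction j arbitrary: m v)
  case 0
  have "dim_sum P (\<lambda>p. real 0 * a p) m v =
     (\<Sum>V\<in>{{}}. (\<Prod>p\<in>V. real 0 * a p) * tpow m (v - lnprod V))"
    using assms(1) by (intro sum.mono_neutral_right) (auto simp: card_eq_0_iff dest: finite_subset)
  also have "\<dots> = v ^ m" using 0 by (simp add: tpow_def)
  finally show ?case by simp
next
  case (Suc j)
  have aA: "0 \<le> (\<Prod>p\<in>A. real j * a p)" "0 \<le> prod a A" if "A \<subseteq> P" for A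
    using that assms by (intro prod_nonneg; auto)+
  have lnn: "0 \<le> lnprod A" if "A \<subseteq> P" for A using that assms by (intro lnprod_nonneg) auto
  have "dim_sum P (\<lambda>p. real (Suc j) * a p) m v =
    dim_sum P (\<lambda>p. real j * a p + a p) m v"
    by (simp add: algebra_simps)
  also have "\<dots> = (\<Sum>A\<in>Pow P. \<Sum>B\<in>Pow (P - A). (\<Prod>p\<in>A. real j * a p) * prod a B * tpow m (v - lnprod (A \<union> B)))"
    by (rule sum_Pow_prod_add) fact
  also have "\<dots> \<le> (\<Sum>A\<in>Pow P. (\<Prod>p\<in>A. real j * a p) * (K / real (Suc m) * tpow (Suc m) (v + C - lnprod A)))"
  proof (rule sum_mono)
    fix A assume "A \<in> Pow P"
    hence A: "A \<subseteq> P" by simp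
    have "(\<Sum>B\<in>Pow (P - A). (\<Prod>p\<in>A. real j * a p) * prod a B * tpow m (v - lnprod (A \<union> B))) =
       (\<Prod>p\<in>A. real j * a p) * dim_sum (P - A) a m (v - lnprod A)"
      unfolding sum_distrib_left mult.assoc
    proof (intro sum.cong refl arg_cong2[of _ _ _ _ "(*)"] arg_cong[of _ _ "tpow m"])
      fix B assume "B \<in> Pow (P - A)"
      hence "lnprod (A \<union> B) = lnprod A + lnprod B"
        using A assms(1) by (intro lnprod_Un_disjoint) (auto intro: finite_subset)
      thus "v - lnprod (A \<union> B) = v - lnprod A - lnprod B" by simp
    qed
    also have "\<dots> \<le> (\<Prod>p\<in>A. real j * a p) * dim_sum P a m (v - lnprod A)"
      using assms(1) by (intro mult_left_mono aA A sum_mono2 mult_nonneg_nonneg tpow_nonneg) auto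
    also have "\<dots> \<le> (\<Prod>p\<in>A. real j * a p) * (K / real (Suc m) * tpow (Suc m) (v + C - lnprod A))"
    proof (intro mult_left_mono aA A)
      show "dim_sum P a m (v - lnprod A) \<le> K / real (Suc m) * tpow (Suc m) (v + C - lnprod A)"
      proof (cases "v - lnprod A \<ge> 0")
        case True
        have "dim_sum P a m (v - lnprod A) \<le> K * (v - lnprod A + C) ^ Suc m / real (Suc m)"
          using assms True lnn by (intro sum_tpow_upper) auto
        also have "\<dots> = K / real (Suc m) * tpow (Suc m) (v + C - lnprod A)"
        proof -
          have e: "v - lnprod A + C = v + C - lnprod A" by simp
          have "v + C - lnprod A \<ge> 0" using True assms(5) by auto
          thus ?thesis unfolding e by (simp add: tpow_def del: of_nat_Suc power_Suc)
        qed
        finally show ?thesis .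
      next
        case False
        have "dim_sum P a m (v - lnprod A) = 0"
        proof (intro sum.neutral ballI)
          fix B assume "B \<in> Pow P"
          hence "lnprod B \<ge> 0" using lnn by auto
          thus "prod a B * tpow m (v - lnprod A - lnprod B) = 0" using False by (simp add: tpow_def)
        qed
        thus ?thesis using assms(4) by (simp add: tpow_nonneg del: of_nat_Suc)
      qed
    qed
    finally show "(\<Sum>B\<in>Pow (P - A). (\<Prod>p\<in>A. real j * a p) * prod a B * tpow m (v - lnprod (A \<union> B))) \<le>
      (\<Prod>p\<in>A. real j * a p) * (K / real (Suc m) * tpow (Suc m) (v + C - lnprod A))" .
  qed
  also have "\<dots> = K / real (Suc m) * dim_sum P (\<lambda>p. real j * a p) (Suc m) (v + C)"
    by (simp add: sum_distrib_left mult_ac)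
  also have "\<dots> \<le> K / real (Suc m) * (K ^ j * (fact (Suc m) / fact (Suc m + j)) * (v + C + real j * C) ^ (Suc m + j))"
    using assms(4,5) Suc.prems by (intro mult_left_mono Suc.IH) auto
  also have "\<dots> = K ^ Suc j * (fact m / fact (m + Suc j)) * (v + real (Suc j) * C) ^ (m + Suc j)"
  proof -
    have "fact m / fact (m + Suc j) = 1 / real (Suc m) * (fact (Suc m) / fact (Suc m + j))"
      by (simp only: fact_Suc[of m] add_Suc add_Suc_right) simp
    moreover have "v + C + real j * C = v + real (Suc j) * C" "Suc m + j = m + Suc j"
      by (simp_all add: algebra_simps)
    ultimately show ?thesis by (simp only: power_Suc[of K] times_divide_eq_left times_divide_eq_right mult_ac mult_1_left)
  qed
  finally show ?case .
qed

section \<open>Selberg diagonalisation\<close>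

text \<open>With lcm and gcd for union and intersection: g([d,e]) = g(d) g(e) / g((d,e)), and
  1/g((d,e)) is expanded over the divisors V of the gcd. The function 1/g - 1 is Selberg's
  multiplicative function dual to g.\<close>

lemma prod_Un_multiplicative:
  fixes g :: "'a \<Rightarrow> real"
  assumes "finite S" "finite T" "\<And>p. p \<in> S \<union> T \<Longrightarrow> g p \<noteq> 0"
  shows "prod g (S \<union> T) = prod g S * prod g T * (\<Sum>V\<in>Pow (S \<inter> T). \<Prod>p\<in>V. 1 / g p - 1)"
proof -
  have 1: "prod g (S \<union> T) * prod g (S \<inter> T) = prod g S * prod g T"
    using assms by (intro prod.union_inter)
  have nz: "prod g (S \<inter> T) \<noteq> 0" using assms by auto
  have "(\<Sum>V\<in>Pow (S \<inter> T). \<Prod>p\<in>V. 1 / g p - 1) = (\<Prod>p\<in>S \<inter> T. 1 + (1 / g p - 1))"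
    using assms by (subst prod_one_plus_eq_sum_Pow) auto
  also have "\<dots> = 1 / prod g (S \<inter> T)" by (simp add: prod_dividef)
  finally have 2: "(\<Sum>V\<in>Pow (S \<inter> T). \<Prod>p\<in>V. 1 / g p - 1) = 1 / prod g (S \<inter> T)" .
  have "x = a * b * (1 / i)" if "x * i = a * b" "i \<noteq> 0" for x a b i :: real
    using that by (simp add: field_simps)
  from this[OF 1 nz] show ?thesis unfolding 2 .
qed

text \<open>Once the lcm is separated, summing over the common divisor V first decouples S from T,
  and the form becomes a weighted sum of squares.\<close>

lemma Selberg_diagonalisation:
  fixes g :: "'a \<Rightarrow> real" and l :: "'a set \<Rightarrow> real"
  assumes "finite P" "\<And>p. p \<in> P \<Longrightarrow> g p \<noteq> 0"
  shows "(\<Sum>S\<in>Pow P. \<Sum>T\<in>Pow P. l S * l T * prod g (S \<union> T)) =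
    (\<Sum>V\<in>Pow P. (\<Prod>p\<in>V. 1 / g p - 1) * (\<Sum>B\<in>Pow (P - V). l (V \<union> B) * prod g (V \<union> B))\<^sup>2)"
proof -
  let ?h = "\<lambda>V. \<Prod>p\<in>V. 1 / g p - 1" and ?G = "\<lambda>S. l S * prod g S"
  have "(\<Sum>S\<in>Pow P. \<Sum>T\<in>Pow P. l S * l T * prod g (S \<union> T)) =
     (\<Sum>S\<in>Pow P. \<Sum>T\<in>Pow P. \<Sum>V\<in>Pow P. ?h V * ((of_bool (V \<subseteq> S) * ?G S) * (of_bool (V \<subseteq> T) * ?G T)))"
  proof (intro sum.cong refl)
    fix S T assume "S \<in> Pow P" "T \<in> Pow P"
    hence ST: "finite S" "finite T" "S \<subseteq> P" "T \<subseteq> P" using assms(1) by (auto intro: finite_subset)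
    have "l S * l T * prod g (S \<union> T) = ?G S * ?G T * (\<Sum>V\<in>Pow (S \<inter> T). ?h V)"
      using ST assms by (subst prod_Un_multiplicative) auto
    also have "(\<Sum>V\<in>Pow (S \<inter> T). ?h V) = (\<Sum>V\<in>Pow P. ?h V * of_bool (V \<subseteq> S) * of_bool (V \<subseteq> T))"
      using ST assms(1) by (intro sum.mono_neutral_cong_left) auto
    finally show "l S * l T * prod g (S \<union> T) =
       (\<Sum>V\<in>Pow P. ?h V * ((of_bool (V \<subseteq> S) * ?G S) * (of_bool (V \<subseteq> T) * ?G T)))"
      by (simp add: sum_distrib_left mult_ac)
  qed
  also have "\<dots> = (\<Sum>S\<in>Pow P. \<Sum>V\<in>Pow P. \<Sum>T\<in>Pow P. ?h V * ((of_bool (V \<subseteq> S) * ?G S) * (of_bool (V \<subseteq> T) * ?G T)))"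
    by (intro sum.cong refl sum.swap)
  also have "\<dots> = (\<Sum>V\<in>Pow P. \<Sum>S\<in>Pow P. \<Sum>T\<in>Pow P. ?h V * ((of_bool (V \<subseteq> S) * ?G S) * (of_bool (V \<subseteq> T) * ?G T)))"
    by (rule sum.swap)
  also have "\<dots> = (\<Sum>V\<in>Pow P. ?h V * (\<Sum>S\<in>Pow P. of_bool (V \<subseteq> S) * ?G S)\<^sup>2)"
    unfolding power2_eq_square sum_product by (simp only: sum_distrib_left)
  also have "\<dots> = (\<Sum>V\<in>Pow P. ?h V * (\<Sum>B\<in>Pow (P - V). ?G (V \<union> B))\<^sup>2)"
  proof (rule sum.cong[OF refl])
    fix V assume V: "V \<in> Pow P"
    have "(\<Sum>S\<in>Pow P. of_bool (V \<subseteq> S) * ?G S) = (\<Sum>S\<in>{S\<in>Pow P. V \<subseteq> S}. ?G S)"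
      using assms(1) by (intro sum.mono_neutral_cong_right) auto
    also have "\<dots> = (\<Sum>B\<in>Pow (P - V). ?G (V \<union> B))"
      by (rule sum.reindex_bij_witness[of _ "\<lambda>B. V \<union> B" "\<lambda>S. S - V"]) (use V in \<open>auto simp: Un_absorb1\<close>)
    finally show "?h V * (\<Sum>S\<in>Pow P. of_bool (V \<subseteq> S) * ?G S)\<^sup>2 = ?h V * (\<Sum>B\<in>Pow (P - V). ?G (V \<union> B))\<^sup>2"
      by (simp only:)
  qed
  finally show ?thesis .
qed

text \<open>Collect the terms with B \<union> E = T; the subsets B of T then sum to the product of
  the 1 + u p.\<close>

lemma sum_Pow_nested:
  fixes u :: "'a \<Rightarrow> real"
  assumes "finite R"
  shows "(\<Sum>B\<in>Pow R. prod u B * (\<Sum>E\<in>Pow (R - B). G (B \<union> E))) =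
     (\<Sum>T\<in>Pow R. (\<Prod>p\<in>T. 1 + u p) * G T)"
proof -
  have "(\<Sum>T\<in>Pow R. (\<Prod>p\<in>T. u p + 1) * G T) = 
    (\<Sum>A\<in>Pow R. \<Sum>B\<in>Pow (R - A). prod u A * (\<Prod>p\<in>B. 1) * G (A \<union> B))"
    by (rule sum_Pow_prod_add) fact
  thus ?thesis by (simp add: sum_distrib_left add.commute)
qed

text \<open>
  Here \<open>y\<close> is the diagonalising vector of the form with density \<open>k / p\<close>: the weights are
  recovered from it by Moebius inversion.
\<close>
definition sieve_weight :: "nat \<Rightarrow> nat set \<Rightarrow> (nat set \<Rightarrow> real) \<Rightarrow> nat set \<Rightarrow> real" where
  "sieve_weight k P y S = (\<Prod>p\<in>S. - (real p / real k)) *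
     (\<Sum>B\<in>Pow (P - S). y (S \<union> B) * (\<Prod>p\<in>S \<union> B. real k / (real p - real k)))"

text \<open>The density f is left general because the same weights enter two forms. For f p = k / p
  the factor 1 - (p / k) f p vanishes and only T = {} survives; for f p = (k - 1)/(p - 1) the
  summand over T carries 1/(p - 1) at each prime.\<close>

lemma sieve_weight_dual:
  assumes "finite P" "V \<subseteq> P"
  shows "(\<Sum>B\<in>Pow (P - V). sieve_weight k P y (V \<union> B) * prod f (V \<union> B)) =
    (\<Prod>p\<in>V. - (real p / real k) * f p * (real k / (real p - real k))) *
    (\<Sum>T\<in>Pow (P - V). (\<Prod>p\<in>T. (1 - real p / real k * f p) * (real k / (real p - real k))) * y (V \<union> T))"
proof -
  let ?r = "\<lambda>p. real k / (real p - real k)" and ?u = "\<lambda>p. - (real p / real k) * f p"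
  have fin: "finite V" "\<And>B. B \<subseteq> P \<Longrightarrow> finite B" using assms finite_subset by auto
  have "(\<Sum>B\<in>Pow (P - V). sieve_weight k P y (V \<union> B) * prod f (V \<union> B)) =
    (\<Sum>B\<in>Pow (P - V). prod ?u V * (prod ?u B * (\<Sum>E\<in>Pow ((P - V) - B). y (V \<union> (B \<union> E)) * (\<Prod>p\<in>V \<union> (B \<union> E). ?r p))))"
  proof (intro sum.cong refl)
    fix B assume B: "B \<in> Pow (P - V)"
    hence fB: "finite B" "V \<inter> B = {}" using fin by auto
    have "sieve_weight k P y (V \<union> B) * prod f (V \<union> B) = prod ?u (V \<union> B) *
       (\<Sum>E\<in>Pow (P - (V \<union> B)). y (V \<union> B \<union> E) * (\<Prod>p\<in>V \<union> B \<union> E. ?r p))"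
      unfolding sieve_weight_def by (simp only: prod.distrib mult_ac)
    also have "prod ?u (V \<union> B) = prod ?u V * prod ?u B"
      using fB fin by (intro prod.union_disjoint) auto
    finally show "sieve_weight k P y (V \<union> B) * prod f (V \<union> B) =
      prod ?u V * (prod ?u B * (\<Sum>E\<in>Pow ((P - V) - B). y (V \<union> (B \<union> E)) * (\<Prod>p\<in>V \<union> (B \<union> E). ?r p)))"
      by (simp only: Diff_Diff_Int Un_assoc mult.assoc set_diff_eq Un_iff de_Morgan_disj conj_assoc Diff_iff)
         (simp add: set_diff_eq conj_assoc)
  qed
  also have "\<dots> = prod ?u V * (\<Sum>T\<in>Pow (P - V). (\<Prod>p\<in>T. 1 + ?u p) * (y (V \<union> T) * prod ?r (V \<union> T)))"
    unfolding sum_distrib_left[symmetric] using assms(1) by (subst sum_Pow_nested) auto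
  also have "\<dots> = prod ?u V * (\<Sum>T\<in>Pow (P - V). prod ?r V * ((\<Prod>p\<in>T. (1 + ?u p) * ?r p) * y (V \<union> T)))"
  proof (rule arg_cong[of _ _ "\<lambda>x. prod ?u V * x"], rule sum.cong[OF refl])
    fix T assume "T \<in> Pow (P - V)"
    hence "finite T" "V \<inter> T = {}" using fin by auto
    hence "prod ?r (V \<union> T) = prod ?r V * prod ?r T"
      using fin by (intro prod.union_disjoint) auto
    thus "(\<Prod>p\<in>T. 1 + ?u p) * (y (V \<union> T) * prod ?r (V \<union> T)) =
      prod ?r V * ((\<Prod>p\<in>T. (1 + ?u p) * ?r p) * y (V \<union> T))"
      by (simp only: prod.distrib mult_ac)
  qed
  also have "\<dots> = (\<Prod>p\<in>V. ?u p * ?r p) * (\<Sum>T\<in>Pow (P - V). (\<Prod>p\<in>T. (1 + ?u p) * ?r p) * y (V \<union> T))"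
    unfolding sum_distrib_left[symmetric] by (simp only: prod.distrib mult.assoc)
  finally show ?thesis by simp
qed

text \<open>This is the density the weights were built for: the diagonal variable is
  \<open>y\<close> up to sign, and the local factor is (1/g - 1)(k/(p - k))^2 = k/(p - k) with g = k
  / p.\<close>

lemma sieve_form_all:
  assumes "finite P" "k > 0" "\<And>p. p \<in> P \<Longrightarrow> p > k"
  shows "(\<Sum>S\<in>Pow P. \<Sum>T\<in>Pow P. sieve_weight k P y S * sieve_weight k P y T * (\<Prod>p\<in>S \<union> T. real k / real p)) =
    (\<Sum>V\<in>Pow P. (\<Prod>p\<in>V. real k / (real p - real k)) * (y V)\<^sup>2)"
proof -
  let ?z = "\<lambda>p. (1 - real p / real k * (real k / real p)) * (real k / (real p - real k))"
  have pk: "real p > real k" "real p > 0" if "p \<in> P" for p using assms(3)[OF that] by auto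
  have k: "real k > 0" using assms by simp
  have "(\<Sum>S\<in>Pow P. \<Sum>T\<in>Pow P. sieve_weight k P y S * sieve_weight k P y T * (\<Prod>p\<in>S \<union> T. real k / real p)) =
    (\<Sum>V\<in>Pow P. (\<Prod>p\<in>V. 1 / (real k / real p) - 1) *
      (\<Sum>B\<in>Pow (P - V). sieve_weight k P y (V \<union> B) * (\<Prod>p\<in>V \<union> B. real k / real p))\<^sup>2)"
    using k pk by (intro Selberg_diagonalisation assms(1)) fastforce
  also have "\<dots> = (\<Sum>V\<in>Pow P. (\<Prod>p\<in>V. real k / (real p - real k)) * (y V)\<^sup>2)"
  proof (intro sum.cong refl)
    fix V assume "V \<in> Pow P"
    hence V: "V \<subseteq> P" "finite V" using assms finite_subset by auto
    have "(\<Sum>B\<in>Pow (P - V). sieve_weight k P y (V \<union> B) * (\<Prod>p\<in>V \<union> B. real k / real p)) =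
      (\<Prod>p\<in>V. - (real p / real k) * (real k / real p) * (real k / (real p - real k))) *
      (\<Sum>T\<in>Pow (P - V). prod ?z T * y (V \<union> T))"
      by (rule sieve_weight_dual) (use assms V in auto)
    also have "(\<Sum>T\<in>Pow (P - V). prod ?z T * y (V \<union> T)) =
      (\<Sum>T\<in>{{}}. prod ?z T * y (V \<union> T))"
    proof (intro sum.mono_neutral_right ballI)
      fix T assume "T \<in> Pow (P - V) - {{}}"
      then obtain q where q: "q \<in> T" "q \<in> P" "T \<subseteq> P" by auto
      have "finite T" using q assms finite_subset by auto
      moreover have "(1 - real q / real k * (real k / real q)) * (real k / (real q - real k)) = 0"
        using pk[OF q(2)] k by simp
      ultimately have "prod ?z T = 0"
        using q(1) by (intro prod_zero) blast+
      thus "prod ?z T * y (V \<union> T) = 0" by simp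
    qed (use assms in auto)
    also have "\<dots> = y V" by simp
    finally have "(\<Prod>p\<in>V. 1 / (real k / real p) - 1) *
      (\<Sum>B\<in>Pow (P - V). sieve_weight k P y (V \<union> B) * (\<Prod>p\<in>V \<union> B. real k / real p))\<^sup>2 =
      (\<Prod>p\<in>V. (1 / (real k / real p) - 1) * (- (real p / real k) * (real k / real p) * (real k / (real p - real k)))\<^sup>2) * (y V)\<^sup>2"
      by (simp only: power_mult_distrib prod.distrib prod_power_distrib mult_ac)
    also have "(\<Prod>p\<in>V. (1 / (real k / real p) - 1) * (- (real p / real k) * (real k / real p) * (real k / (real p - real k)))\<^sup>2) =
       (\<Prod>p\<in>V. real k / (real p - real k))"
    proof (rule prod.cong[OF refl])
      fix q assume "q \<in> V"
      hence q: "real q - real k > 0" "real q > 0" using pk V by force+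
      have "1 / (real k / real q) - 1 = (real q - real k) / real k" using q k by (simp add: field_simps)
      moreover have "- (real q / real k) * (real k / real q) = -1" using q k by simp
      ultimately show "(1 / (real k / real q) - 1) * (- (real q / real k) * (real k / real q) * (real k / (real q - real k)))\<^sup>2 = real k / (real q - real k)"
        using q k by (simp add: power2_eq_square)
    qed
    finally show "(\<Prod>p\<in>V. 1 / (real k / real p) - 1) *
      (\<Sum>B\<in>Pow (P - V). sieve_weight k P y (V \<union> B) * (\<Prod>p\<in>V \<union> B. real k / real p))\<^sup>2 =
      (\<Prod>p\<in>V. real k / (real p - real k)) * (y V)\<^sup>2" .
  qed
  finally show ?thesis .
qed

text \<open>For a prime m + h only k - 1 of the p - 1 reduced classes of m + h modulo p make p
  divide one of the other entries, whence the density (k - 1)/(p - 1). This form is diagonal not in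
  \<open>y\<close> itself but in averages of \<open>y\<close> over multiples of V.\<close>

lemma sieve_form_primes:
  assumes "finite P" "k \<ge> 2" "\<And>p. p \<in> P \<Longrightarrow> p > k"
  shows "(\<Sum>S\<in>Pow P. \<Sum>T\<in>Pow P. sieve_weight k P y S * sieve_weight k P y T * (\<Prod>p\<in>S \<union> T. (real k - 1) / (real p - 1))) =
    (\<Sum>V\<in>Pow P. (\<Prod>p\<in>V. (real k - 1) / (real p - real k) * (real p / (real p - 1))\<^sup>2) *
      (\<Sum>T\<in>Pow (P - V). (\<Prod>p\<in>T. 1 / (real p - 1)) * y (V \<union> T))\<^sup>2)"
proof -
  let ?h = "\<lambda>V. \<Prod>p\<in>V. (real k - 1) / (real p - real k) * (real p / (real p - 1))\<^sup>2"
  let ?Y = "\<lambda>V. \<Sum>T\<in>Pow (P - V). (\<Prod>p\<in>T. 1 / (real p - 1)) * y (V \<union> T)"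
  have k: "real k \<ge> 2" using assms by simp
  have pk: "real p > real k" "real p > 2" if "p \<in> P" for p using assms(3)[OF that] k by linarith+
  have "(\<Sum>S\<in>Pow P. \<Sum>T\<in>Pow P. sieve_weight k P y S * sieve_weight k P y T * (\<Prod>p\<in>S \<union> T. (real k - 1) / (real p - 1))) =
    (\<Sum>V\<in>Pow P. (\<Prod>p\<in>V. 1 / ((real k - 1) / (real p - 1)) - 1) *
      (\<Sum>B\<in>Pow (P - V). sieve_weight k P y (V \<union> B) * (\<Prod>p\<in>V \<union> B. (real k - 1) / (real p - 1)))\<^sup>2)"
    using k pk by (intro Selberg_diagonalisation assms(1)) fastforce
  also have "\<dots> = (\<Sum>V\<in>Pow P. ?h V *
      (?Y V)\<^sup>2)"
  proof (intro sum.cong refl)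
    fix V assume "V \<in> Pow P"
    hence V: "V \<subseteq> P" "finite V" using assms finite_subset by auto
    let ?f = "\<lambda>p. (real k - 1) / (real p - 1)"
    have "(\<Sum>B\<in>Pow (P - V). sieve_weight k P y (V \<union> B) * prod ?f (V \<union> B)) =
      (\<Prod>p\<in>V. - (real p / real k) * ?f p * (real k / (real p - real k))) *
      (\<Sum>T\<in>Pow (P - V). (\<Prod>p\<in>T. (1 - real p / real k * ?f p) * (real k / (real p - real k))) * y (V \<union> T))"
      by (rule sieve_weight_dual) (use assms V in auto)
    also have "(\<Sum>T\<in>Pow (P - V). (\<Prod>p\<in>T. (1 - real p / real k * ?f p) * (real k / (real p - real k))) * y (V \<union> T)) =
      ?Y V"
    proof (intro sum.cong arg_cong2[of _ _ _ _ "(*)"] refl prod.cong)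
      fix T q assume "T \<in> Pow (P - V)" "q \<in> T"
      hence "q \<in> P" by auto
      hence q: "real q > real k" "real q > 2" using pk by auto
      have "1 - real q / real k * ?f q = (real q - real k) / (real k * (real q - 1))"
        using q k by (simp add: field_simps)
      thus "(1 - real q / real k * ?f q) * (real k / (real q - real k)) = 1 / (real q - 1)"
        using q k by simp
    qed
    finally have "(\<Prod>p\<in>V. 1 / ?f p - 1) *
      (\<Sum>B\<in>Pow (P - V). sieve_weight k P y (V \<union> B) * prod ?f (V \<union> B))\<^sup>2 =
      (\<Prod>p\<in>V. (1 / ?f p - 1) * (- (real p / real k) * ?f p * (real k / (real p - real k)))\<^sup>2) *
      (?Y V)\<^sup>2"
      by (simp only: power_mult_distrib prod.distrib prod_power_distrib mult_ac)
    also have "(\<Prod>p\<in>V. (1 / ?f p - 1) * (- (real p / real k) * ?f p * (real k / (real p - real k)))\<^sup>2) =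
       ?h V"
    proof (rule prod.cong[OF refl])
      fix q assume "q \<in> V"
      hence q: "real q - real k > 0" "real q - 1 > 0" "real k - 1 > 0" using pk V k by force+
      have "1 / ?f q - 1 = (real q - real k) / (real k - 1)"
        using q by (simp add: field_simps)
      moreover have "- (real q / real k) * ?f q * (real k / (real q - real k)) = - (real q / (real q - 1)) * ((real k - 1) / (real q - real k))"
        using k by simp
      ultimately have "(1 / ?f q - 1) * (- (real q / real k) * ?f q * (real k / (real q - real k)))\<^sup>2 =
        (real q - real k) / (real k - 1) * ((real k - 1) / (real q - real k))\<^sup>2 * (real q / (real q - 1))\<^sup>2"
        by (simp only: power_mult_distrib power2_minus mult_ac)
      also have "(real q - real k) / (real k - 1) * ((real k - 1) / (real q - real k))\<^sup>2 = (real k - 1) / (real q - real k)"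
        using q by (simp add: power2_eq_square)
      finally show "(1 / ?f q - 1) * (- (real q / real k) * ?f q * (real k / (real q - real k)))\<^sup>2 =
        (real k - 1) / (real q - real k) * (real q / (real q - 1))\<^sup>2" .
    qed
    finally show "(\<Prod>p\<in>V. 1 / ?f p - 1) *
      (\<Sum>B\<in>Pow (P - V). sieve_weight k P y (V \<union> B) * prod ?f (V \<union> B))\<^sup>2 =
      ?h V *
      (?Y V)\<^sup>2" .
  qed
  finally show ?thesis .
qed

section \<open>The two quadratic forms\<close>

definition small_primes :: "nat \<Rightarrow> nat set" where
  "small_primes D = {p. prime p \<and> p \<le> D}"

definition primorial :: "nat \<Rightarrow> nat" where
  "primorial D = \<Prod>(small_primes D)"

definition sieve_primes :: "nat \<Rightarrow> real \<Rightarrow> nat set" where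
  "sieve_primes D L = {p. prime p \<and> D < p \<and> ln (real p) \<le> L}"

definition primorial_density :: "nat \<Rightarrow> real" where
  "primorial_density D = real (totient (primorial D)) / real (primorial D)"

lemma finite_small_primes: "finite (small_primes D)"
  by (rule finite_subset[of _ "{..D}"]) (auto simp: small_primes_def)

lemma primorial_pos: "primorial D > 0"
  unfolding primorial_def by (intro prod_pos) (auto simp: small_primes_def prime_gt_0_nat)

lemma primorial_density_eq: "primorial_density D = (\<Prod>p\<in>small_primes D. 1 - 1 / real p)"
proof -
  have "prime_factors (primorial D) = small_primes D"
    unfolding primorial_def by (intro prime_factors_prod_primes finite_small_primes) (auto simp: small_primes_def)
  thus ?thesis using totient_formula2[of "primorial D"] primorial_pos[of D]
    by (simp add: primorial_density_def)
qed

lemma primorial_density_pos: "primorial_density D > 0"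
  using primorial_pos by (simp add: primorial_density_def)

lemma finite_sieve_primes: "finite (sieve_primes D L)"
proof (rule finite_subset)
  show "sieve_primes D L \<subseteq> {n. real n \<le> exp L}"
  proof
    fix p assume p: "p \<in> sieve_primes D L"
    hence "exp (ln (real p)) \<le> exp L" by (subst exp_le_cancel_iff) (simp add: sieve_primes_def)
    moreover have "real p > 0" using p by (simp add: sieve_primes_def prime_gt_0_nat)
    ultimately show "p \<in> {n. real n \<le> exp L}" by (simp only: exp_ln mem_Collect_eq)
  qed
qed (rule finite_nat_le_real)

lemma coprime_primorial:
  assumes "prime p" "D < p"
  shows "coprime p (primorial D)"
  unfolding primorial_def
  by (intro prod_coprime_right) (use assms in \<open>auto simp: small_primes_def intro!: primes_coprime\<close>)

text \<open>The function \<open>F(log t / log R)\<close> with \<open>F(u) = \<Sum> c\<^sub>i (1 - u)\<^sup>i\<close> on \<open>[0, 1]\<close> and \<open>L = log R\<close>.\<close>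
definition gpy_profile :: "(nat \<Rightarrow> real) \<Rightarrow> nat \<Rightarrow> real \<Rightarrow> nat set \<Rightarrow> real" where
  "gpy_profile c n L T = (\<Sum>i<n. c i / L ^ i * tpow i (L - lnprod T))"

text \<open>The parameter \<open>D\<close> bounds the primes fixed by the residue class modulo W;
  \<open>2 * k \<le> D\<close> gives p - k \<ge> p / 2 for sieving primes. Nonnegative
  \<open>c\<close> permits termwise use of one-sided bounds.\<close>

locale gpy =
  fixes k D :: nat and L :: real and c :: "nat \<Rightarrow> real" and n :: nat
  assumes k_ge: "2 \<le> k" and D_ge: "2 * k \<le> D" and L_pos: "0 < L" and c_nonneg: "\<And>i. 0 \<le> c i"
begin

abbreviation "P \<equiv> sieve_primes D L"
abbreviation "W \<equiv> primorial D"
abbreviation "\<delta> \<equiv> primorial_density D"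
abbreviation "K \<equiv> exp (2 * real k / real D) * \<delta>"
abbreviation "C \<equiv> real W * real W + 1"
abbreviation "y \<equiv> gpy_profile c n L"
abbreviation "lam \<equiv> sieve_weight k P y"
text \<open>The shift \<open>real k * C\<close> comes from k steps of the upper induction. Divided
  by \<open>L ^ k\<close>, this tends to \<open>gpy_J1 k n c\<close> as L grows with D
  fixed.\<close>

abbreviation "J1 \<equiv> (\<Sum>i<n. \<Sum>j<n. c i * c j * (fact (i + j) / fact (i + j + k)) * ((L + real k * C) ^ (i + j + k) / L ^ (i + j)))"
abbreviation "J2 \<equiv> (\<Sum>i<n. \<Sum>j<n. c i * c j / (real (Suc i) * real (Suc j)) * (fact (i + j + 2) / fact (i + j + k + 1)))"
abbreviation "small_sets \<equiv> {U\<in>Pow P. lnprod U \<le> 2 * L}"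
abbreviation "range_set N \<nu> \<equiv> {m\<in>{N<..N+N}. [m = \<nu>] (mod W)}"
abbreviation "\<rho> U \<equiv> (\<Prod>p\<in>U. 1 / (real p - real k))"
abbreviation "form_all \<equiv> (\<Sum>S\<in>Pow P. \<Sum>T\<in>Pow P. lam S * lam T * (\<Prod>p\<in>S \<union> T. real k / real p))"
abbreviation "form_primes \<equiv> (\<Sum>S\<in>Pow P. \<Sum>T\<in>Pow P. lam S * lam T * (\<Prod>p\<in>S \<union> T. (real k - 1) / (real p - 1)))"

lemma P_prime: "p \<in> P \<Longrightarrow> prime p" and P_gt: "p \<in> P \<Longrightarrow> D < p"
  and P_real: "p \<in> P \<Longrightarrow> real p > 2 * real k"
  using D_ge by (auto simp: sieve_primes_def)

lemma subset_P_finite: "S \<subseteq> P \<Longrightarrow> finite S"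
  using finite_sieve_primes finite_subset by blast

lemma lnprod_P_nonneg: "S \<subseteq> P \<Longrightarrow> lnprod S \<ge> 0"
  using P_prime by (intro lnprod_nonneg) auto

lemma K_nonneg: "K \<ge> 0" and C_nonneg: "C \<ge> 0"
  using primorial_density_pos[of D] by auto

lemma primes_covered: "prime p \<Longrightarrow> ln (real p) \<le> L \<Longrightarrow> p \<in> small_primes D \<union> P"
  by (auto simp: small_primes_def sieve_primes_def)

lemma small_primes_P: "small_primes D \<inter> P = {}" "p \<in> small_primes D \<union> P \<Longrightarrow> prime p"
  by (auto simp: small_primes_def sieve_primes_def)

lemma dim_upper:
  assumes "0 \<le> v"
  shows "dim_sum P (\<lambda>p. real j / (real p - real k)) m v \<le>
    K ^ j * (fact m / fact (m + j)) * (v + real j * C) ^ (m + j)"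
proof -
  have "dim_sum P (\<lambda>p. real j * (1 / (real p - real k))) m v \<le>
    K ^ j * (fact m / fact (m + j)) * (v + real j * C) ^ (m + j)"
  proof (rule sum_Pow_iterated_upper)
    show "0 \<le> 1 / (real p - real k)" if "p \<in> P" for p using P_real[OF that] by simp
    fix s :: real assume "0 \<le> s"
    thus "dim_sum P (\<lambda>p. 1 / (real p - real k)) 0 s \<le> K * (s + C)"
      unfolding primorial_density_def
      using P_prime P_gt D_ge k_ge coprime_primorial primorial_pos
      by (intro sum_Pow_shifted_inverse_le finite_sieve_primes) auto
  qed (use assms K_nonneg C_nonneg P_prime in \<open>auto intro: finite_sieve_primes\<close>)
  thus ?thesis by simp
qed

lemma profile_square:
  "(\<Sum>i<n. a i * tpow (i + r) x)\<^sup>2 = (\<Sum>i<n. \<Sum>j<n. a i * a j * tpow (i + j + 2 * r) x)"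
  unfolding power2_eq_square sum_product
  by (intro sum.cong refl) (simp add: tpow_mult[symmetric] mult_2 power_add tpow_def)

lemma form_all_le:
  "form_all \<le>
    K ^ k * J1"
proof -
  have sq: "(y V)\<^sup>2 = (\<Sum>i<n. \<Sum>j<n. c i / L ^ i * (c j / L ^ j) * tpow (i + j) (L - lnprod V))" for V
    using profile_square[of "\<lambda>i. c i / L ^ i" 0] by (simp add: gpy_profile_def)
  have "form_all =
    (\<Sum>V\<in>Pow P. (\<Prod>p\<in>V. real k / (real p - real k)) * (y V)\<^sup>2)"
    using k_ge P_real by (intro sieve_form_all finite_sieve_primes) (auto, fastforce)
  also have "\<dots> = (\<Sum>V\<in>Pow P. \<Sum>i<n. \<Sum>j<n. c i / L ^ i * (c j / L ^ j) *
      ((\<Prod>p\<in>V. real k / (real p - real k)) * tpow (i + j) (L - lnprod V)))"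
    unfolding sq by (simp add: sum_distrib_left mult_ac)
  also have "\<dots> = (\<Sum>i<n. \<Sum>j<n. \<Sum>V\<in>Pow P. c i / L ^ i * (c j / L ^ j) *
      ((\<Prod>p\<in>V. real k / (real p - real k)) * tpow (i + j) (L - lnprod V)))"
    by (subst sum.swap, intro sum.cong refl, rule sum.swap)
  also have "\<dots> = (\<Sum>i<n. \<Sum>j<n. c i / L ^ i * (c j / L ^ j) *
      dim_sum P (\<lambda>p. real k / (real p - real k)) (i + j) L)"
    by (simp only: sum_distrib_left)
  also have "\<dots> \<le> (\<Sum>i<n. \<Sum>j<n. c i / L ^ i * (c j / L ^ j) *
      (K ^ k * (fact (i + j) / fact (i + j + k)) * (L + real k * C) ^ (i + j + k)))"
    using c_nonneg L_pos by (intro sum_mono mult_left_mono dim_upper) auto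
  also have "\<dots> = K ^ k * J1"
    unfolding sum_distrib_left by (intro sum.cong refl) (simp add: power_add mult_ac)
  finally show ?thesis .
qed

lemma inner_lower:
  assumes "V \<subseteq> P"
  shows "\<delta> * (\<Prod>p\<in>V. 1 - 1 / real p) * (\<Sum>i<n. c i / (L ^ i * real (Suc i)) * tpow (i + 1) (L - lnprod V)) \<le>
    (\<Sum>T\<in>Pow (P - V). (\<Prod>p\<in>T. 1 / (real p - 1)) * y (V \<union> T))"
proof -
  have "\<delta> * (\<Prod>p\<in>V. 1 - 1 / real p) * (\<Sum>i<n. c i / (L ^ i * real (Suc i)) * tpow (i + 1) (L - lnprod V)) =
    (\<Sum>i<n. c i / L ^ i * (\<delta> * (\<Prod>p\<in>V. 1 - 1 / real p) * tpow (Suc i) (L - lnprod V) / real (Suc i)))"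
    unfolding sum_distrib_left by (intro sum.cong refl) (simp add: field_simps del: of_nat_Suc)
  also have "\<dots> \<le> (\<Sum>i<n. c i / L ^ i * dim_sum (P - V) (\<lambda>p. 1 / (real p - 1)) i (L - lnprod V))"
    unfolding primorial_density_eq
  proof (intro sum_mono mult_left_mono)
    fix i
    show "(\<Prod>p\<in>small_primes D. 1 - 1 / real p) * (\<Prod>p\<in>V. 1 - 1 / real p) * tpow (Suc i) (L - lnprod V) / real (Suc i) \<le>
      dim_sum (P - V) (\<lambda>p. 1 / (real p - 1)) i (L - lnprod V)"
      by (rule sum_Pow_inner_lower[where L = L])
         (use assms lnprod_P_nonneg[OF assms] primes_covered small_primes_P finite_sieve_primes finite_small_primes in auto)
    show "0 \<le> c i / L ^ i" using c_nonneg L_pos by simp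
  qed
  also have "\<dots> = (\<Sum>T\<in>Pow (P - V). \<Sum>i<n. c i / L ^ i * ((\<Prod>p\<in>T. 1 / (real p - 1)) * tpow i (L - lnprod V - lnprod T)))"
    unfolding sum_distrib_left by (rule sum.swap)
  also have "\<dots> = (\<Sum>T\<in>Pow (P - V). (\<Prod>p\<in>T. 1 / (real p - 1)) * y (V \<union> T))"
  proof (rule sum.cong[OF refl])
    fix T assume "T \<in> Pow (P - V)"
    hence "lnprod (V \<union> T) = lnprod V + lnprod T"
      using assms subset_P_finite[of V] subset_P_finite[of T] by (intro lnprod_Un_disjoint) auto
    thus "(\<Sum>i<n. c i / L ^ i * ((\<Prod>p\<in>T. 1 / (real p - 1)) * tpow i (L - lnprod V - lnprod T))) =
      (\<Prod>p\<in>T. 1 / (real p - 1)) * y (V \<union> T)"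
      by (simp add: gpy_profile_def sum_distrib_left diff_diff_eq mult_ac)
  qed
  finally show ?thesis .
qed

text \<open>Supplies the absorption hypothesis of \<open>sum_Pow_iterated_lower\<close> with
  exponent k - 2: by Bernoulli, (1 - 1/p)^(k - 1) \<ge> 1 - (k - 1)/p \<ge> 1 - k/p.\<close>

lemma Bernoulli_primes:
  assumes "p \<in> P"
  shows "1 / (real p - 1) \<le> 1 / (real p - real k) * (1 - 1 / real p) ^ (k - 2)"
proof -
  have p: "real p > 2 * real k" "real p > 0" "real k \<ge> 2" using P_real[OF assms] k_ge by auto
  have *: "1 + real (k - 1) * (- 1 / real p) \<le> (1 + (- 1 / real p)) ^ (k - 1)"
    using p by (intro Bernoulli_inequality) (auto simp: field_simps)
  have "1 - real (k - 1) / real p \<le> (1 - 1 / real p) ^ Suc (k - 2)"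
  proof -
    have "Suc (k - 2) = k - 1" using k_ge by simp
    with * show ?thesis by simp
  qed
  moreover have "1 - real k / real p \<le> 1 - real (k - 1) / real p"
    using p by (simp add: divide_right_mono)
  ultimately have "1 - real k / real p \<le> (1 - 1 / real p) * (1 - 1 / real p) ^ (k - 2)" by simp
  moreover have "1 - real k / real p = (real p - real k) / real p" "1 - 1 / real p = (real p - 1) / real p"
    using p by (auto simp: field_simps)
  ultimately have "(real p - real k) / real p \<le> ((real p - 1) / real p) * (1 - 1 / real p) ^ (k - 2)"
    by metis
  hence "real p - real k \<le> (real p - 1) * (1 - 1 / real p) ^ (k - 2)"
    using p by (simp add: divide_le_cancel)
  thus ?thesis using p by (simp add: field_simps)
qed

text \<open>The inner averages of \<open>y\<close> are bounded below with one factor \<delta> each,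
  giving \<delta>^2 after squaring; the remaining sum over V has dimension k - 1 and gives
  \<delta>^(k - 1). The chain below starts from the closed bound and climbs to the form.\<close>

lemma form_primes_ge:
  "form_primes \<ge>
    \<delta> ^ (k + 1) * L ^ (k + 1) *
     J2"
proof -
  let ?Z = "\<lambda>V. \<Sum>i<n. c i / (L ^ i * real (Suc i)) * tpow (i + 1) (L - lnprod V)"
  let ?a = "\<lambda>i. c i / (L ^ i * real (Suc i))"
  \<comment> \<open>\<open>Suc r\<close> = k - 1 is the dimension of the outer sum, and r = k - 2
    the exponent in \<open>Bernoulli_primes\<close>.\<close>
  obtain r where r: "k = Suc (Suc r)" using k_ge by (metis Suc_le_D numeral_2_eq_2 Suc_le_mono)
  have "\<delta> ^ (k + 1) * L ^ (k + 1) *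
     J2 =
    \<delta>\<^sup>2 * (\<Sum>i<n. \<Sum>j<n. ?a i * ?a j * (\<delta> ^ Suc r * (fact (i + j + 2) / fact (i + j + 2 + Suc r)) * tpow (i + j + 2 + Suc r) L))"
    unfolding sum_distrib_left
  proof (intro sum.cong refl)
    fix i j
    have 1: "?a i * ?a j * tpow (i + j + 2 + Suc r) L = c i * c j / (real (Suc i) * real (Suc j)) * L ^ (k + 1)"
      using L_pos r by (simp add: tpow_def field_simps power_add del: of_nat_Suc)
    have 2: "i + j + k + 1 = i + j + 2 + Suc r" using r by simp
    have 3: "\<delta>\<^sup>2 * \<delta> ^ Suc r = \<delta> ^ (k + 1)" using r by (simp add: power2_eq_square)
    have "\<delta>\<^sup>2 * (?a i * ?a j * (\<delta> ^ Suc r * (fact (i + j + 2) / fact (i + j + 2 + Suc r)) * tpow (i + j + 2 + Suc r) L)) =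
      (\<delta>\<^sup>2 * \<delta> ^ Suc r) * (?a i * ?a j * tpow (i + j + 2 + Suc r) L) * (fact (i + j + 2) / fact (i + j + 2 + Suc r))"
      by (simp only: mult_ac)
    also have "\<dots> = \<delta> ^ (k + 1) * L ^ (k + 1) * (c i * c j / (real (Suc i) * real (Suc j)) * (fact (i + j + 2) / fact (i + j + k + 1)))"
      unfolding 1 2 3 by (simp only: mult_ac)
    finally show "\<delta> ^ (k + 1) * L ^ (k + 1) * (c i * c j / (real (Suc i) * real (Suc j)) * (fact (i + j + 2) / fact (i + j + k + 1))) =
      \<delta>\<^sup>2 * (?a i * ?a j * (\<delta> ^ Suc r * (fact (i + j + 2) / fact (i + j + 2 + Suc r)) * tpow (i + j + 2 + Suc r) L))" ..
  qed
  also have "\<dots> \<le> \<delta>\<^sup>2 * (\<Sum>i<n. \<Sum>j<n. ?a i * ?a j * dim_sum P (\<lambda>p. real (Suc r) * (1 / (real p - real k))) (i + j + 2) L)"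
    unfolding primorial_density_eq
  proof (intro mult_left_mono sum_mono sum_Pow_iterated_lower[where L = L] finite_sieve_primes finite_small_primes)
    show "1 / (real p - 1) \<le> 1 / (real p - real k) * (1 - 1 / real p) ^ r" if "p \<in> P" for p
      using Bernoulli_primes[OF that] r by simp
  qed (use c_nonneg L_pos primes_covered small_primes_P in \<open>auto simp del: of_nat_Suc\<close>)
  also have "\<dots> = \<delta>\<^sup>2 * (\<Sum>V\<in>Pow P. (\<Prod>p\<in>V. (real k - 1) / (real p - real k)) * (?Z V)\<^sup>2)"
  proof -
    have "(\<Sum>i<n. \<Sum>j<n. ?a i * ?a j * dim_sum P (\<lambda>p. real (Suc r) * (1 / (real p - real k))) (i + j + 2) L) =
      (\<Sum>i<n. \<Sum>j<n. \<Sum>V\<in>Pow P. (\<Prod>p\<in>V. (real k - 1) / (real p - real k)) * (?a i * ?a j * tpow (i + j + 2) (L - lnprod V)))"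
      unfolding sum_distrib_left using r by (intro sum.cong refl) (simp add: mult_ac)
    also have "\<dots> = (\<Sum>i<n. \<Sum>V\<in>Pow P. \<Sum>j<n. (\<Prod>p\<in>V. (real k - 1) / (real p - real k)) * (?a i * ?a j * tpow (i + j + 2) (L - lnprod V)))"
      by (intro sum.cong refl sum.swap)
    also have "\<dots> = (\<Sum>V\<in>Pow P. \<Sum>i<n. \<Sum>j<n. (\<Prod>p\<in>V. (real k - 1) / (real p - real k)) * (?a i * ?a j * tpow (i + j + 2) (L - lnprod V)))"
      by (rule sum.swap)
    also have "\<dots> = (\<Sum>V\<in>Pow P. (\<Prod>p\<in>V. (real k - 1) / (real p - real k)) * (?Z V)\<^sup>2)"
      unfolding profile_square[of ?a 1] by (simp only: sum_distrib_left mult_1_right)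
    finally show ?thesis by (simp only:)
  qed
  \<comment> \<open>The local factor (p/(p - 1))^2 of the diagonalised form exactly offsets the loss
    (1 - 1/p)^2 from requiring T to avoid V.\<close>
  also have "\<dots> = (\<Sum>V\<in>Pow P. (\<Prod>p\<in>V. (real k - 1) / (real p - real k) * (real p / (real p - 1))\<^sup>2) * (\<delta> * (\<Prod>p\<in>V. 1 - 1 / real p) * ?Z V)\<^sup>2)"
  proof (subst sum_distrib_left, rule sum.cong[OF refl])
    fix V assume V: "V \<in> Pow P"
    have *: "(\<Prod>p\<in>V. (real k - 1) / (real p - real k)) = (\<Prod>p\<in>V. (real k - 1) / (real p - real k) * (real p / (real p - 1))\<^sup>2 * (1 - 1 / real p)\<^sup>2)"
    proof (rule prod.cong[OF refl])
      fix q assume "q \<in> V"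
      hence "real q > 2 * real k" "real k \<ge> 2" using V P_real k_ge by auto
      hence q: "real q > 1" by linarith
      have "(real q / (real q - 1))\<^sup>2 * (1 - 1 / real q)\<^sup>2 = (real q / (real q - 1) * (1 - 1 / real q))\<^sup>2"
        by (simp only: power_mult_distrib)
      also have "real q / (real q - 1) * (1 - 1 / real q) = 1" using q by (simp add: field_simps)
      finally show "(real k - 1) / (real q - real k) = (real k - 1) / (real q - real k) * (real q / (real q - 1))\<^sup>2 * (1 - 1 / real q)\<^sup>2"
        by (simp only: mult.assoc) simp
    qed
    show "\<delta>\<^sup>2 * ((\<Prod>p\<in>V. (real k - 1) / (real p - real k)) * (?Z V)\<^sup>2) =
      (\<Prod>p\<in>V. (real k - 1) / (real p - real k) * (real p / (real p - 1))\<^sup>2) * (\<delta> * (\<Prod>p\<in>V. 1 - 1 / real p) * ?Z V)\<^sup>2"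
      unfolding * by (simp only: power_mult_distrib prod.distrib prod_power_distrib mult_ac)
  qed
  also have "\<dots> \<le> (\<Sum>V\<in>Pow P. (\<Prod>p\<in>V. (real k - 1) / (real p - real k) * (real p / (real p - 1))\<^sup>2) *
      (\<Sum>T\<in>Pow (P - V). (\<Prod>p\<in>T. 1 / (real p - 1)) * y (V \<union> T))\<^sup>2)"
  proof (intro sum_mono mult_left_mono power_mono inner_lower prod_nonneg)
    fix V assume V: "V \<in> Pow P"
    have pq: "real q > 2 * real k" "real k \<ge> 2" if "q \<in> V" for q using V P_real k_ge that by auto
    show "0 \<le> (real k - 1) / (real p - real k) * (real p / (real p - 1))\<^sup>2" if "p \<in> V" for p
      using pq[OF that] by simp
    have "0 \<le> 1 - 1 / real p" if "p \<in> V" for p using pq[OF that] by simp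
    hence "0 \<le> (\<Prod>p\<in>V. 1 - 1 / real p)" by (intro prod_nonneg) auto
    moreover have "?Z V \<ge> 0" using c_nonneg L_pos
      by (intro sum_nonneg mult_nonneg_nonneg tpow_nonneg divide_nonneg_nonneg) auto
    ultimately show "0 \<le> \<delta> * (\<Prod>p\<in>V. 1 - 1 / real p) * ?Z V"
      using primorial_density_pos[of D] by (intro mult_nonneg_nonneg) auto
  qed auto
  also have "\<dots> = form_primes"
    using k_ge P_real by (intro sieve_form_primes[symmetric] finite_sieve_primes) (auto, fastforce)
  finally show ?thesis .
qed

section \<open>Size of the sieve weights\<close>

definition "weight_bound = (\<Sum>i<n. c i) * (K ^ k * (1 / fact k) * (L + real k * C) ^ k)"

lemma profile_nonneg: "y T \<ge> 0"
  unfolding gpy_profile_def using c_nonneg L_pos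
  by (intro sum_nonneg mult_nonneg_nonneg tpow_nonneg divide_nonneg_nonneg) auto

lemma profile_le: "T \<subseteq> P \<Longrightarrow> y T \<le> (\<Sum>i<n. c i) * tpow 0 (L - lnprod T)"
proof -
  assume "T \<subseteq> P"
  hence T: "lnprod T \<ge> 0" by (rule lnprod_P_nonneg)
  have "c i / L ^ i * tpow i (L - lnprod T) \<le> c i * tpow 0 (L - lnprod T)" for i
  proof -
    have "tpow i (L - lnprod T) \<le> L ^ i * tpow 0 (L - lnprod T)"
      using T L_pos by (auto simp: tpow_def intro!: power_mono)
    hence "c i / L ^ i * tpow i (L - lnprod T) \<le> c i / L ^ i * (L ^ i * tpow 0 (L - lnprod T))"
      using c_nonneg L_pos by (intro mult_left_mono) auto
    thus ?thesis using L_pos by simp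
  qed
  thus ?thesis unfolding gpy_profile_def sum_distrib_right by (intro sum_mono)
qed

lemma weight_bound_nonneg: "weight_bound \<ge> 0"
  unfolding weight_bound_def using c_nonneg L_pos C_nonneg primorial_density_pos[of D]
  by (intro mult_nonneg_nonneg sum_nonneg zero_le_power add_nonneg_nonneg) auto

text \<open>Each prime of S contributes (p/k)(k/(p - k)) = p/(p - k) \<le> 2, and the sum over B has
  dimension k, which gives a power of log R. The truncated factor records that the weights are
  supported on products at most R = exp L.\<close>

lemma abs_weight_le:
  assumes "S \<subseteq> P"
  shows "\<bar>lam S\<bar> \<le> weight_bound * 2 ^ card S * tpow 0 (L - lnprod S)"
proof -
  have fin: "finite S" using assms subset_P_finite by auto
  let ?r = "\<lambda>p. real k / (real p - real k)"
  have r: "?r p \<ge> 0" if "p \<in> P" for p using P_real[OF that] by simp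
  have rr: "prod ?r T \<ge> 0" if "T \<subseteq> P" for T using r that by (intro prod_nonneg) auto
  have "\<bar>lam S\<bar> = (\<Prod>p\<in>S. real p / real k) * (\<Sum>B\<in>Pow (P - S). y (S \<union> B) * prod ?r (S \<union> B))"
  proof -
    have "0 \<le> (\<Sum>B\<in>Pow (P - S). y (S \<union> B) * prod ?r (S \<union> B))"
      using assms by (intro sum_nonneg mult_nonneg_nonneg profile_nonneg rr) auto
    thus ?thesis by (simp add: sieve_weight_def abs_mult abs_prod)
  qed
  also have "(\<Sum>B\<in>Pow (P - S). y (S \<union> B) * prod ?r (S \<union> B)) \<le>
     (\<Sum>B\<in>Pow (P - S). (\<Sum>i<n. c i) * tpow 0 (L - lnprod S) * prod ?r S * (prod ?r B * tpow 0 (L - lnprod B)))"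
  proof (rule sum_mono)
    fix B assume "B \<in> Pow (P - S)"
    hence B: "B \<subseteq> P" "S \<inter> B = {}" "finite B" using subset_P_finite[of B] by auto
    have l: "lnprod (S \<union> B) = lnprod S + lnprod B" using B fin by (intro lnprod_Un_disjoint)
    \<comment> \<open>The joint cut-off is relaxed to two separate ones, so that the sum over B no
      longer depends on the size of S.\<close>
    have t: "tpow 0 (L - lnprod (S \<union> B)) \<le> tpow 0 (L - lnprod S) * tpow 0 (L - lnprod B)"
      using lnprod_P_nonneg[OF assms] lnprod_P_nonneg[OF B(1)] by (auto simp: tpow_def l)
    have pr: "prod ?r (S \<union> B) = prod ?r S * prod ?r B"
      using B fin by (intro prod.union_disjoint) auto
    have "y (S \<union> B) \<le> (\<Sum>i<n. c i) * tpow 0 (L - lnprod (S \<union> B))"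
      using assms B by (intro profile_le) auto
    also have "\<dots> \<le> (\<Sum>i<n. c i) * (tpow 0 (L - lnprod S) * tpow 0 (L - lnprod B))"
      using t c_nonneg by (intro mult_left_mono sum_nonneg) auto
    finally have "y (S \<union> B) * prod ?r (S \<union> B) \<le> (\<Sum>i<n. c i) * (tpow 0 (L - lnprod S) * tpow 0 (L - lnprod B)) * prod ?r (S \<union> B)"
      using assms B by (intro mult_right_mono rr) auto
    thus "y (S \<union> B) * prod ?r (S \<union> B) \<le> (\<Sum>i<n. c i) * tpow 0 (L - lnprod S) * prod ?r S * (prod ?r B * tpow 0 (L - lnprod B))"
      unfolding pr by (simp only: mult_ac)
  qed
  also have "\<dots> \<le> (\<Sum>i<n. c i) * tpow 0 (L - lnprod S) * prod ?r S * dim_sum P ?r 0 L"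
    unfolding sum_distrib_left[symmetric] using c_nonneg assms finite_sieve_primes
    by (intro mult_left_mono sum_mono2 mult_nonneg_nonneg sum_nonneg tpow_nonneg rr) auto
  also have "\<dots> \<le> (\<Sum>i<n. c i) * tpow 0 (L - lnprod S) * prod ?r S * (K ^ k * (fact 0 / fact (0 + k)) * (L + real k * C) ^ (0 + k))"
    using c_nonneg assms L_pos by (intro mult_left_mono dim_upper mult_nonneg_nonneg sum_nonneg tpow_nonneg rr) auto
  finally have "\<bar>lam S\<bar> \<le> (\<Prod>p\<in>S. real p / real k) * ((\<Sum>i<n. c i) * tpow 0 (L - lnprod S) * prod ?r S * (K ^ k * (fact 0 / fact (0 + k)) * (L + real k * C) ^ (0 + k)))"
    by (simp add: mult_left_mono prod_nonneg)
  also have "\<dots> = weight_bound * (\<Prod>p\<in>S. real p / real k * ?r p) * tpow 0 (L - lnprod S)"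
    by (simp only: weight_bound_def prod.distrib mult_ac fact_0 add_0)
  also have "\<dots> \<le> weight_bound * (\<Prod>p\<in>S. 2) * tpow 0 (L - lnprod S)"
  proof (intro mult_right_mono mult_left_mono prod_mono tpow_nonneg weight_bound_nonneg conjI)
    fix q assume "q \<in> S"
    hence q: "real q > 2 * real k" "real k \<ge> 2" using assms P_real k_ge by auto
    show "0 \<le> real q / real k * ?r q" using q by simp
    show "real q / real k * ?r q \<le> 2" using q by (simp add: field_simps)
  qed
  finally show ?thesis by simp
qed

end

section \<open>Residue classes\<close>

definition residue_set :: "nat \<Rightarrow> nat \<Rightarrow> nat set \<Rightarrow> (nat \<Rightarrow> nat set) \<Rightarrow> nat set" where
  "residue_set W \<nu> U A = {a. a < W * \<Prod>U \<and> [a = \<nu>] (mod W) \<and> (\<forall>p\<in>U. a mod p \<in> A p)}"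

lemma finite_residue_set: "finite (residue_set W \<nu> U A)"
  by (rule finite_subset[of _ "{..<W * \<Prod>U}"]) (auto simp: residue_set_def)

text \<open>Chinese remainder theorem, adjoining one prime at a time.\<close>

lemma card_residue_set:
  assumes "finite U" "W > 0" "\<And>p. p \<in> U \<Longrightarrow> prime p" "\<And>p. p \<in> U \<Longrightarrow> coprime p W"
    and "\<And>p. p \<in> U \<Longrightarrow> A p \<subseteq> {..<p}"
  shows "card (residue_set W \<nu> U A) = (\<Prod>p\<in>U. card (A p))"
  using assms(1,3-5)
proof (induction U rule: finite_induct)
  case empty
  have "residue_set W \<nu> {} A = {\<nu> mod W}"
    using \<open>W > 0\<close> by (auto simp: residue_set_def cong_def)
  thus ?case by simp
next
  case (insert p U)
  let ?q = "W * \<Prod>U"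
  have q0: "?q > 0" using insert.prems \<open>W > 0\<close> by (auto intro!: prod_pos simp: prime_gt_0_nat)
  have p0: "p > 0" using insert.prems by (auto simp: prime_gt_0_nat)
  have cop: "coprime ?q p"
  proof -
    have "coprime (\<Prod>U) p" using insert by (intro prod_coprime_left primes_coprime) auto
    moreover have "coprime W p" using insert.prems(2)[of p] by (simp add: coprime_commute)
    ultimately show ?thesis by simp
  qed
  have eq: "W * \<Prod>(insert p U) = ?q * p" using insert.hyps by simp
  have dvdU: "r dvd ?q" if "r \<in> U" for r using that insert.hyps dvd_prodI[of U r "\<lambda>x. x"] by simp
  have "bij_betw (\<lambda>a. (a mod ?q, a mod p)) (residue_set W \<nu> (insert p U) A) (residue_set W \<nu> U A \<times> A p)"
    unfolding bij_betw_def
  proof (intro conjI)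
    show "inj_on (\<lambda>a. (a mod ?q, a mod p)) (residue_set W \<nu> (insert p U) A)"
    proof (rule inj_onI)
      fix a b assume a: "a \<in> residue_set W \<nu> (insert p U) A" and b: "b \<in> residue_set W \<nu> (insert p U) A"
        and "(a mod ?q, a mod p) = (b mod ?q, b mod p)"
      hence "[a = b] (mod ?q)" "[a = b] (mod p)" by (auto simp: cong_def)
      hence "[a = b] (mod ?q * p)" using cop by (rule coprime_cong_mult_nat)
      moreover have "a < ?q * p" "b < ?q * p" using a b unfolding residue_set_def eq by auto
      ultimately show "a = b" by (simp add: cong_def)
    qed
    show "(\<lambda>a. (a mod ?q, a mod p)) ` residue_set W \<nu> (insert p U) A = residue_set W \<nu> U A \<times> A p"
    proof (intro equalityI subsetI)
      fix z assume "z \<in> (\<lambda>a. (a mod ?q, a mod p)) ` residue_set W \<nu> (insert p U) A"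
      then obtain a where a: "a \<in> residue_set W \<nu> (insert p U) A" "z = (a mod ?q, a mod p)" by auto
      have "a mod ?q mod r = a mod r" if "r \<in> U" for r using dvdU[OF that] by (simp add: mod_mod_cancel)
      moreover have "a mod ?q mod W = a mod W" by (simp add: mod_mod_cancel)
      ultimately show "z \<in> residue_set W \<nu> U A \<times> A p"
        using a q0 by (auto simp: residue_set_def cong_def)
    next
      fix z assume z: "z \<in> residue_set W \<nu> U A \<times> A p"
      then obtain b d where bd: "z = (b, d)" "b \<in> residue_set W \<nu> U A" "d \<in> A p" by auto
      have "d < p" using bd insert.prems(3)[of p] by auto
      have "b < ?q" using bd by (auto simp: residue_set_def)
      obtain a where a: "a < ?q * p" "[a = b] (mod ?q)" "[a = d] (mod p)"
        using binary_chinese_remainder_unique_nat[OF cop, of b d] q0 p0 by auto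
      have ab: "a mod ?q = b" and ad: "a mod p = d" using a \<open>b < ?q\<close> \<open>d < p\<close> by (auto simp: cong_def)
      have "a mod r = b mod r" if "r \<in> U" for r
        using dvdU[OF that] a(2) by (metis cong_def cong_dvd_modulus_nat)
      moreover have "a mod W = b mod W" using a(2) by (metis cong_def cong_dvd_modulus_nat dvd_triv_left)
      ultimately have "a \<in> residue_set W \<nu> (insert p U) A"
        using bd a(1) ad unfolding residue_set_def eq by (auto simp: cong_def)
      thus "z \<in> (\<lambda>a. (a mod ?q, a mod p)) ` residue_set W \<nu> (insert p U) A"
        using ab ad bd(1) by force
    qed
  qed
  hence "card (residue_set W \<nu> (insert p U) A) = card (residue_set W \<nu> U A) * card (A p)"
    by (simp add: bij_betw_same_card card_cartesian_product)
  thus ?case using insert by simp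
qed

lemma sum_residue_set:
  fixes f :: "nat \<Rightarrow> real"
  assumes "finite I" "finite U" "W * \<Prod>U > 0"
  shows "(\<Sum>n\<in>{n\<in>I. [n = \<nu>] (mod W) \<and> (\<forall>p\<in>U. n mod p \<in> A p)}. f n) =
    (\<Sum>a\<in>residue_set W \<nu> U A. \<Sum>n\<in>{n\<in>I. [n = a] (mod W * \<Prod>U)}. f n)"
proof -
  let ?q = "W * \<Prod>U" and ?S = "{n\<in>I. [n = \<nu>] (mod W) \<and> (\<forall>p\<in>U. n mod p \<in> A p)}"
  have dvdU: "r dvd ?q" if "r \<in> U" for r using that assms dvd_prodI[of U r "\<lambda>x. x"] by simp
  have m: "n mod ?q mod r = n mod r" if "r \<in> U" for r n using dvdU[OF that] by (simp add: mod_mod_cancel)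
  have mW: "n mod ?q mod W = n mod W" for n by (simp add: mod_mod_cancel)
  have "(\<Sum>n\<in>?S. f n) = (\<Sum>a\<in>residue_set W \<nu> U A. \<Sum>n\<in>{n\<in>?S. n mod ?q = a}. f n)"
    by (rule sum.group[symmetric])
       (use assms m mW finite_residue_set in \<open>auto simp: residue_set_def cong_def\<close>)
  also have "\<dots> = (\<Sum>a\<in>residue_set W \<nu> U A. \<Sum>n\<in>{n\<in>I. [n = a] (mod ?q)}. f n)"
  proof (intro sum.cong refl)
    fix a assume a: "a \<in> residue_set W \<nu> U A"
    show "{n\<in>?S. n mod ?q = a} = {n\<in>I. [n = a] (mod ?q)}"
    proof (intro equalityI subsetI)
      fix n assume "n \<in> {n\<in>I. [n = a] (mod ?q)}"
      hence n: "n \<in> I" "n mod ?q = a" using a by (auto simp: cong_def residue_set_def)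
      thus "n \<in> {n\<in>?S. n mod ?q = a}" using a m[of _ n] mW[of n] by (auto simp: residue_set_def cong_def)
    qed (use a in \<open>auto simp: cong_def residue_set_def\<close>)
  qed
  finally show ?thesis .
qed

text \<open>The class consists of the b + t q with t in a half-open interval of length M / q; the
  count is a difference of two floors, so rounding costs at most 1.\<close>

lemma card_cong_interval:
  assumes "q > 0"
  shows "\<bar>real (card {n\<in>{N<..N+M}. [n = a] (mod q)}) - real M / real q\<bar> \<le> 1"
proof -
  define b where "b = a mod q"
  have b: "b < q" using assms by (simp add: b_def)
  define x where "x = (real N - real b) / real q"
  define z where "z = x + real M / real q"
  have iff: "N < m \<and> m \<le> N + M \<longleftrightarrow> x < real_of_int t \<and> real_of_int t \<le> z" if "int m = int b + t * int q" for m t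
  proof -
    have "real m = real b + real_of_int t * real q" using that by (metis of_int_add of_int_mult of_int_of_nat_eq)
    moreover have "x < real_of_int t \<longleftrightarrow> real N < real b + real_of_int t * real q"
      unfolding x_def using assms by (simp add: field_simps)
    moreover have "real_of_int t \<le> z \<longleftrightarrow> real b + real_of_int t * real q \<le> real (N + M)"
      unfolding z_def x_def using assms by (simp add: field_simps add_divide_distrib[symmetric])
    ultimately show ?thesis by (metis of_nat_le_iff of_nat_less_iff)
  qed
  have "bij_betw (\<lambda>t. nat (int b + t * int q)) {\<lfloor>x\<rfloor><..\<lfloor>z\<rfloor>} {n\<in>{N<..N+M}. [n = a] (mod q)}"
  proof (rule bij_betwI[where g = "\<lambda>n. (int n - int b) div int q"])
    have *: "int b + t * int q \<ge> 0" if "t \<in> {\<lfloor>x\<rfloor><..\<lfloor>z\<rfloor>}" for t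
    proof -
      have "x < real_of_int t" using that by (simp add: floor_less_iff)
      hence "- real b < real_of_int t * real q" unfolding x_def using assms by (simp add: field_simps)
      hence "real_of_int (int b + t * int q) > 0" by simp
      thus ?thesis by linarith
    qed
    show "(\<lambda>t. nat (int b + t * int q)) \<in> {\<lfloor>x\<rfloor><..\<lfloor>z\<rfloor>} \<rightarrow> {n\<in>{N<..N+M}. [n = a] (mod q)}"
    proof
      fix t assume t: "t \<in> {\<lfloor>x\<rfloor><..\<lfloor>z\<rfloor>}"
      define m where "m = nat (int b + t * int q)"
      have m: "int m = int b + t * int q" using *[OF t] by (simp add: m_def)
      have "x < real_of_int t \<and> real_of_int t \<le> z" using t by (simp add: floor_less_iff le_floor_iff)
      hence "m \<in> {N<..N+M}" using iff[OF m] by simp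
      moreover have "[int m = int b] (mod int q)" unfolding m by (simp add: cong_def)
      hence "[m = b] (mod q)" by (simp add: cong_int_iff)
      hence "[m = a] (mod q)" by (simp add: b_def cong_def)
      ultimately show "nat (int b + t * int q) \<in> {n\<in>{N<..N+M}. [n = a] (mod q)}" by (simp add: m_def)
    qed
    have dv: "int m = int b + (int m - int b) div int q * int q" if "[m = a] (mod q)" for m
    proof -
      have "[m = b] (mod q)" using that by (simp add: b_def cong_def)
      hence "int q dvd int m - int b" by (simp add: cong_iff_dvd_diff flip: cong_int_iff)
      thus ?thesis by simp
    qed
    show "(\<lambda>n. (int n - int b) div int q) \<in> {n\<in>{N<..N+M}. [n = a] (mod q)} \<rightarrow> {\<lfloor>x\<rfloor><..\<lfloor>z\<rfloor>}"
    proof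
      fix m assume m: "m \<in> {n\<in>{N<..N+M}. [n = a] (mod q)}"
      show "(int m - int b) div int q \<in> {\<lfloor>x\<rfloor><..\<lfloor>z\<rfloor>}"
        using iff[OF dv[of m]] m by (simp add: floor_less_iff le_floor_iff)
    qed
    show "(int (nat (int b + t * int q)) - int b) div int q = t" if "t \<in> {\<lfloor>x\<rfloor><..\<lfloor>z\<rfloor>}" for t
      using *[OF that] assms by simp
    show "nat (int b + (int m - int b) div int q * int q) = m" if "m \<in> {n\<in>{N<..N+M}. [n = a] (mod q)}" for m
      using dv[of m] that by (metis (no_types, lifting) mem_Collect_eq nat_int)
  qed
  hence "card {n\<in>{N<..N+M}. [n = a] (mod q)} = nat (\<lfloor>z\<rfloor> - \<lfloor>x\<rfloor>)"
    by (metis bij_betw_same_card card_greaterThanAtMost_int)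
  moreover have "\<lfloor>z\<rfloor> \<ge> \<lfloor>x\<rfloor>" by (intro floor_mono) (simp add: z_def)
  ultimately have "real (card {n\<in>{N<..N+M}. [n = a] (mod q)}) = real_of_int (\<lfloor>z\<rfloor> - \<lfloor>x\<rfloor>)" by simp
  thus ?thesis unfolding z_def by linarith
qed

text \<open>The zeros modulo p of the polynomial with factors n + h.\<close>

definition tuple_roots :: "nat set \<Rightarrow> nat \<Rightarrow> nat set" where
  "tuple_roots H p = {a. a < p \<and> (\<exists>h\<in>H. p dvd a + h)}"

lemma mod_tuple_roots:
  assumes "p > 0"
  shows "n mod p \<in> tuple_roots H p \<longleftrightarrow> (\<exists>h\<in>H. p dvd n + h)"
  using assms by (simp add: tuple_roots_def dvd_eq_mod_eq_0 mod_add_left_eq)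

lemma card_tuple_roots:
  assumes "H \<subseteq> {..<p}"
  shows "card (tuple_roots H p) = card H"
proof -
  have "bij_betw (\<lambda>h. if h = 0 then 0 else p - h) H (tuple_roots H p)"
    unfolding bij_betw_def
  proof (intro conjI)
    show "inj_on (\<lambda>h. if h = 0 then 0 else p - h) H"
      using assms by (auto simp: inj_on_def split: if_splits)
    show "(\<lambda>h. if h = 0 then 0 else p - h) ` H = tuple_roots H p"
    proof (intro equalityI subsetI)
      fix a assume "a \<in> (\<lambda>h. if h = 0 then 0 else p - h) ` H"
      then obtain h where h: "h \<in> H" "a = (if h = 0 then 0 else p - h)" by blast
      have "h < p" using h assms by auto
      hence "a < p" "p dvd a + h" using h by auto
      thus "a \<in> tuple_roots H p" using h by (auto simp: tuple_roots_def)
    next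
      fix a assume "a \<in> tuple_roots H p"
      then obtain h where h: "a < p" "h \<in> H" "p dvd a + h" by (auto simp: tuple_roots_def)
      have "h < p" using h assms by auto
      then obtain t where t: "a + h = p * t" using h by blast
      have "p * t < p * 2" using t h \<open>h < p\<close> by linarith
      hence "t < 2" by simp
      hence "t = 0 \<or> t = 1" by linarith
      hence "a = (if h = 0 then 0 else p - h)" using t h \<open>h < p\<close> by auto
      thus "a \<in> (\<lambda>h. if h = 0 then 0 else p - h) ` H" using h by blast
    qed
  qed
  thus ?thesis by (simp add: bij_betw_same_card)
qed

section \<open>Weighted sums over progressions\<close>

text \<open>Pairs with union U are pairs of subsets of U. Their exact number is 3^|U|; the cruder
  4^|U| is enough.\<close>

lemma sum_Pow_Un_le:
  fixes \<Phi> :: "'a set \<Rightarrow> real"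
  assumes "finite P" "\<And>U. U \<subseteq> P \<Longrightarrow> 0 \<le> \<Phi> U"
  shows "(\<Sum>S\<in>Pow P. \<Sum>T\<in>Pow P. \<Phi> (S \<union> T)) \<le> (\<Sum>U\<in>Pow P. 4 ^ card U * \<Phi> U)"
proof -
  have "(\<Sum>S\<in>Pow P. \<Sum>T\<in>Pow P. \<Phi> (S \<union> T)) = (\<Sum>z\<in>Pow P \<times> Pow P. \<Phi> (fst z \<union> snd z))"
    by (simp add: sum.cartesian_product case_prod_beta)
  also have "\<dots> = (\<Sum>U\<in>Pow P. \<Sum>z\<in>{z\<in>Pow P \<times> Pow P. fst z \<union> snd z = U}. \<Phi> (fst z \<union> snd z))"
    using assms(1) by (intro sum.group[symmetric]) auto
  also have "\<dots> \<le> (\<Sum>U\<in>Pow P. 4 ^ card U * \<Phi> U)"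
  proof (rule sum_mono)
    fix U assume "U \<in> Pow P"
    hence U: "U \<subseteq> P" "finite U" using assms(1) finite_subset by auto
    let ?A = "{z\<in>Pow P \<times> Pow P. fst z \<union> snd z = U}"
    have "card ?A \<le> card (Pow U \<times> Pow U)" using U by (intro card_mono) auto
    also have "\<dots> = 4 ^ card U" using U by (simp add: card_cartesian_product card_Pow flip: power_mult_distrib)
    finally have "card ?A \<le> 4 ^ card U" .
    hence "real (card ?A) \<le> real (4 ^ card U)" by (rule of_nat_mono)
    hence c: "real (card ?A) \<le> 4 ^ card U" by simp
    have "(\<Sum>z\<in>?A. \<Phi> (fst z \<union> snd z)) = (\<Sum>z\<in>?A. \<Phi> U)" by (intro sum.cong) auto
    also have "\<dots> = real (card ?A) * \<Phi> U" by (simp only: sum_constant)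
    also have "\<dots> \<le> 4 ^ card U * \<Phi> U" using c assms(2)[OF U(1)] by (intro mult_right_mono)
    finally show "(\<Sum>z\<in>?A. \<Phi> (fst z \<union> snd z)) \<le> 4 ^ card U * \<Phi> U" .
  qed
  finally show ?thesis .
qed

text \<open>For a squarefree d with set S of prime factors, this says that d divides the product of
  the n + h.\<close>

definition hits :: "nat set \<Rightarrow> nat \<Rightarrow> nat set \<Rightarrow> bool" where
  "hits H n S \<longleftrightarrow> (\<forall>p\<in>S. \<exists>h\<in>H. p dvd n + h)"

lemma hits_Un: "hits H n (S \<union> T) \<longleftrightarrow> hits H n S \<and> hits H n T"
  by (auto simp: hits_def)

abbreviation moduli_sum :: "real \<Rightarrow> (nat \<Rightarrow> real) \<Rightarrow> real" where
  "moduli_sum z E \<equiv> (\<Sum>q\<in>{q. 1 \<le> q \<and> real q \<le> z}. E q)"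

context gpy
begin

definition wt :: "nat set \<Rightarrow> nat \<Rightarrow> real" where
  "wt H m = (\<Sum>S\<in>Pow P. of_bool (hits H m S) * lam S)\<^sup>2"

lemma wt_nonneg: "wt H m \<ge> 0"
  by (simp add: wt_def)

lemma lnprod_Un_le:
  assumes "S \<subseteq> P" "T \<subseteq> P"
  shows "lnprod (S \<union> T) \<le> lnprod S + lnprod T"
proof -
  have "S \<union> T = S \<union> (T - S)" by auto
  hence "lnprod (S \<union> T) = lnprod (S \<union> (T - S))" by simp
  also have "\<dots> = lnprod S + lnprod (T - S)"
    using assms subset_P_finite by (intro lnprod_Un_disjoint) auto
  also have "lnprod (T - S) \<le> lnprod T"
    using assms subset_P_finite P_prime by (intro lnprod_mono) auto
  finally show ?thesis by simp
qed

text \<open>The base 16 k is 4 * 4 * k: one 4 counts pairs S, T with union U, the other is 2^2 from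
  the bounds on two weights, and k bounds the number of residue classes per prime. The cut-off is 2
  L because both S and T have \<open>lnprod\<close> at most L.\<close>

definition err :: "(nat set \<Rightarrow> real) \<Rightarrow> real" where
  "err E = (\<Sum>U\<in>Pow P. (16 * real k) ^ card U * tpow 0 (2 * L - lnprod U) * E U)"

lemma prod_P_pos: "U \<subseteq> P \<Longrightarrow> 0 < W * \<Prod>U"
  using P_prime primorial_pos[of D] by (auto intro!: prod_pos simp: prime_gt_0_nat subset_iff)

text \<open>Opening the square and sorting by residues modulo W times the product of S \<union> T
  reduces everything to sums of F in single classes. It is used for F constant, Liouville and
  prime-detecting; \<open>card H\<close> may be below k, since in the last case the tuple loses one
  element.\<close>

lemma weighted_sum:
  fixes F :: "nat \<Rightarrow> real" and H :: "nat set"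
  assumes H: "H \<subseteq> {..D}" "card H \<le> k" and "finite I" and E: "\<And>U. U \<subseteq> P \<Longrightarrow> E U \<ge> 0"
    and approx: "\<And>U a. U \<subseteq> P \<Longrightarrow> lnprod U \<le> 2 * L \<Longrightarrow> a \<in> residue_set W \<nu> U (tuple_roots H) \<Longrightarrow>
      \<bar>(\<Sum>m\<in>{m\<in>I. [m = a] (mod W * \<Prod>U)}. F m) - X * \<mu> U\<bar> \<le> E U"
  shows "\<bar>(\<Sum>m\<in>{m\<in>I. [m = \<nu>] (mod W)}. F m * wt H m) -
     X * (\<Sum>S\<in>Pow P. \<Sum>T\<in>Pow P. lam S * lam T * (real (card H) ^ card (S \<union> T) * \<mu> (S \<union> T)))\<bar> \<le>
     weight_bound\<^sup>2 * err E"
proof -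
  let ?\<mu> = "\<lambda>U. real (card H) ^ card U * \<mu> U"
  let ?I = "{m\<in>I. [m = \<nu>] (mod W)}"
  define G where "G = (\<lambda>U. \<Sum>m\<in>?I. F m * of_bool (hits H m U))"
  have "(\<Sum>m\<in>?I. F m * wt H m) = (\<Sum>m\<in>?I. \<Sum>S\<in>Pow P. \<Sum>T\<in>Pow P. lam S * lam T * (F m * of_bool (hits H m (S \<union> T))))"
  proof (rule sum.cong[OF refl])
    fix m
    have "wt H m = (\<Sum>S\<in>Pow P. \<Sum>T\<in>Pow P. (of_bool (hits H m S) * lam S) * (of_bool (hits H m T) * lam T))"
      unfolding wt_def power2_eq_square by (rule sum_product)
    hence "F m * wt H m = (\<Sum>S\<in>Pow P. \<Sum>T\<in>Pow P. F m * ((of_bool (hits H m S) * lam S) * (of_bool (hits H m T) * lam T)))"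
      by (simp only: sum_distrib_left)
    also have "\<dots> = (\<Sum>S\<in>Pow P. \<Sum>T\<in>Pow P. lam S * lam T * (F m * of_bool (hits H m (S \<union> T))))"
      by (intro sum.cong refl) (auto simp: hits_Un)
    finally show "F m * wt H m = (\<Sum>S\<in>Pow P. \<Sum>T\<in>Pow P. lam S * lam T * (F m * of_bool (hits H m (S \<union> T))))" .
  qed
  also have "\<dots> = (\<Sum>S\<in>Pow P. \<Sum>m\<in>?I. \<Sum>T\<in>Pow P. lam S * lam T * (F m * of_bool (hits H m (S \<union> T))))"
    by (rule sum.swap)
  also have "\<dots> = (\<Sum>S\<in>Pow P. \<Sum>T\<in>Pow P. \<Sum>m\<in>?I. lam S * lam T * (F m * of_bool (hits H m (S \<union> T))))"
    by (intro sum.cong refl sum.swap)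
  also have "\<dots> = (\<Sum>S\<in>Pow P. \<Sum>T\<in>Pow P. lam S * lam T * G (S \<union> T))"
    unfolding G_def by (simp only: sum_distrib_left)
  finally have 1: "(\<Sum>m\<in>?I. F m * wt H m) = (\<Sum>S\<in>Pow P. \<Sum>T\<in>Pow P. lam S * lam T * G (S \<union> T))" .
  have G: "\<bar>G U - X * ?\<mu> U\<bar> \<le> real k ^ card U * E U"
    if U: "U \<subseteq> P" "lnprod U \<le> 2 * L" for U
  proof -
    have fU: "finite U" using U subset_P_finite by auto
    let ?R = "residue_set W \<nu> U (tuple_roots H)"
    have cR: "card ?R = card H ^ card U"
    proof -
      have "card ?R = (\<Prod>p\<in>U. card (tuple_roots H p))"
        using fU primorial_pos[of D] U P_prime P_gt coprime_primorial
        by (intro card_residue_set) (auto simp: tuple_roots_def subset_iff)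
      also have "\<dots> = (\<Prod>p\<in>U. card H)"
      proof (intro prod.cong refl card_tuple_roots)
        fix p assume "p \<in> U"
        hence "D < p" using U P_gt by auto
        thus "H \<subseteq> {..<p}" using H(1) by (auto simp: subset_iff dest: order_le_less_trans)
      qed
      finally show ?thesis by simp
    qed
    have "G U = (\<Sum>m\<in>{m\<in>I. [m = \<nu>] (mod W) \<and> (\<forall>p\<in>U. m mod p \<in> tuple_roots H p)}. F m)"
      unfolding G_def
    proof (rule sum.mono_neutral_cong_right)
      show "finite ?I" using \<open>finite I\<close> by simp
      have *: "m mod p \<in> tuple_roots H p \<longleftrightarrow> (\<exists>h\<in>H. p dvd m + h)" if "p \<in> U" for m p
        using U P_prime[of p] that by (intro mod_tuple_roots) (auto simp: prime_gt_0_nat)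
      show "\<forall>m\<in>?I - {m\<in>I. [m = \<nu>] (mod W) \<and> (\<forall>p\<in>U. m mod p \<in> tuple_roots H p)}. F m * of_bool (hits H m U) = 0"
        using * by (auto simp: hits_def)
      show "F m * of_bool (hits H m U) = F m" if "m \<in> {m\<in>I. [m = \<nu>] (mod W) \<and> (\<forall>p\<in>U. m mod p \<in> tuple_roots H p)}" for m
        using * that by (auto simp: hits_def)
    qed auto
    also have "\<dots> = (\<Sum>a\<in>?R. \<Sum>m\<in>{m\<in>I. [m = a] (mod W * \<Prod>U)}. F m)"
      using \<open>finite I\<close> fU prod_P_pos[OF U(1)] by (rule sum_residue_set)
    finally have "G U - X * ?\<mu> U =
      (\<Sum>a\<in>?R. (\<Sum>m\<in>{m\<in>I. [m = a] (mod W * \<Prod>U)}. F m) - X * \<mu> U)"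
      by (simp add: sum_subtractf cR)
    hence "\<bar>G U - X * ?\<mu> U\<bar> \<le> (\<Sum>a\<in>?R. \<bar>(\<Sum>m\<in>{m\<in>I. [m = a] (mod W * \<Prod>U)}. F m) - X * \<mu> U\<bar>)"
      by (simp only: sum_abs)
    also have "\<dots> \<le> (\<Sum>a\<in>?R. E U)" using U by (intro sum_mono approx)
    also have "\<dots> = real (card H) ^ card U * E U" by (simp add: cR)
    also have "\<dots> \<le> real k ^ card U * E U" using E[OF U(1)] H(2) by (intro mult_right_mono power_mono) auto
    finally show ?thesis .
  qed
  let ?\<Phi> = "\<lambda>U. weight_bound\<^sup>2 * (4 ^ card U * tpow 0 (2 * L - lnprod U) * (real k ^ card U * E U))"
  have trm: "\<bar>lam S * lam T * (G (S \<union> T) - X * ?\<mu> (S \<union> T))\<bar> \<le> ?\<Phi> (S \<union> T)"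
    if ST: "S \<subseteq> P" "T \<subseteq> P" for S T
  proof (cases "lnprod S \<le> L \<and> lnprod T \<le> L")
    case True
    let ?U = "S \<union> T"
    have U: "?U \<subseteq> P" using ST by auto
    have lU: "lnprod ?U \<le> 2 * L" using lnprod_Un_le[OF ST] True by linarith
    have fU: "finite ?U" using U subset_P_finite by auto
    have "\<bar>lam S\<bar> \<le> weight_bound * 2 ^ card ?U"
    proof -
      have "\<bar>lam S\<bar> \<le> weight_bound * 2 ^ card S" using abs_weight_le[OF ST(1)] True by (simp add: tpow_def)
      also have "\<dots> \<le> weight_bound * 2 ^ card ?U"
        using weight_bound_nonneg fU by (intro mult_left_mono power_increasing card_mono) auto
      finally show ?thesis .
    qed
    moreover have "\<bar>lam T\<bar> \<le> weight_bound * 2 ^ card ?U"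
    proof -
      have "\<bar>lam T\<bar> \<le> weight_bound * 2 ^ card T" using abs_weight_le[OF ST(2)] True by (simp add: tpow_def)
      also have "\<dots> \<le> weight_bound * 2 ^ card ?U"
        using weight_bound_nonneg fU by (intro mult_left_mono power_increasing card_mono) auto
      finally show ?thesis .
    qed
    ultimately have "\<bar>lam S\<bar> * \<bar>lam T\<bar> \<le> (weight_bound * 2 ^ card ?U) * (weight_bound * 2 ^ card ?U)"
      using weight_bound_nonneg by (intro mult_mono) auto
    also have "\<dots> = weight_bound\<^sup>2 * 4 ^ card ?U"
      by (simp add: power2_eq_square mult_ac flip: power_mult_distrib)
    finally have "\<bar>lam S\<bar> * \<bar>lam T\<bar> * \<bar>G ?U - X * ?\<mu> ?U\<bar> \<le>
       weight_bound\<^sup>2 * 4 ^ card ?U * (real k ^ card ?U * E ?U)"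
      using G[OF U lU] by (rule mult_mono) auto
    thus ?thesis using lU by (simp add: abs_mult tpow_def mult_ac)
  next
    case False
    hence "lam S = 0 \<or> lam T = 0"
      using abs_weight_le[OF ST(1)] abs_weight_le[OF ST(2)] by (auto simp: tpow_def split: if_splits)
    moreover have "?\<Phi> (S \<union> T) \<ge> 0" using ST E[of "S \<union> T"] by (intro mult_nonneg_nonneg tpow_nonneg) auto
    ultimately show ?thesis by auto
  qed
  have "(\<Sum>m\<in>?I. F m * wt H m) - X * (\<Sum>S\<in>Pow P. \<Sum>T\<in>Pow P. lam S * lam T * ?\<mu> (S \<union> T)) =
    (\<Sum>S\<in>Pow P. \<Sum>T\<in>Pow P. lam S * lam T * (G (S \<union> T) - X * ?\<mu> (S \<union> T)))"
    unfolding 1 sum_distrib_left sum_subtractf[symmetric] by (intro sum.cong refl) (simp add: right_diff_distrib mult_ac)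
  hence "\<bar>(\<Sum>m\<in>?I. F m * wt H m) - X * (\<Sum>S\<in>Pow P. \<Sum>T\<in>Pow P. lam S * lam T * ?\<mu> (S \<union> T))\<bar> \<le>
    (\<Sum>S\<in>Pow P. \<Sum>T\<in>Pow P. ?\<Phi> (S \<union> T))"
    by (simp only:) (intro order_trans[OF sum_abs] sum_mono trm; auto)
  also have "\<dots> \<le> (\<Sum>U\<in>Pow P. 4 ^ card U * ?\<Phi> U)"
    using E by (intro sum_Pow_Un_le finite_sieve_primes mult_nonneg_nonneg tpow_nonneg) auto
  also have "\<dots> = weight_bound\<^sup>2 * err E"
    unfolding err_def sum_distrib_left
  proof (intro sum.cong refl)
    fix U :: "nat set"
    have "16 * real k = 4 * 4 * real k" by simp
    hence e: "(16 * real k) ^ card U = 4 ^ card U * 4 ^ card U * real k ^ card U"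
      by (simp only: power_mult_distrib)
    show "4 ^ card U * ?\<Phi> U = weight_bound\<^sup>2 * ((16 * real k) ^ card U * tpow 0 (2 * L - lnprod U) * E U)"
      unfolding e by (simp only: mult_ac)
  qed
  finally show ?thesis .
qed

section \<open>Estimating the error sums\<close>

lemma dim_zero_upper:
  assumes "0 \<le> v"
  shows "(\<Sum>V\<in>Pow P. real j ^ card V * (\<rho> V * tpow 0 (v - lnprod V))) \<le>
    K ^ j / fact j * (v + real j * C) ^ j"
proof -
  have "(\<Sum>V\<in>Pow P. real j ^ card V * (\<rho> V * tpow 0 (v - lnprod V))) =
    (\<Sum>V\<in>Pow P. (\<Prod>p\<in>V. real j / (real p - real k)) * tpow 0 (v - lnprod V))"
  proof (intro sum.cong refl)
    fix V assume "V \<in> Pow P"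
    have "(\<Prod>p\<in>V. real j / (real p - real k)) = (\<Prod>p\<in>V. real j * (1 / (real p - real k)))" by simp
    also have "\<dots> = real j ^ card V * \<rho> V" by (simp only: prod.distrib prod_constant)
    finally show "real j ^ card V * (\<rho> V * tpow 0 (v - lnprod V)) =
      (\<Prod>p\<in>V. real j / (real p - real k)) * tpow 0 (v - lnprod V)" by (simp only: mult.assoc)
  qed
  thus ?thesis using dim_upper[OF assms, of j 0] by simp
qed

lemma prod_inverse_shifted_ge:
  assumes "U \<subseteq> P"
  shows "1 / real (\<Prod>U) \<le> \<rho> U"
    and "1 / real (totient (W * \<Prod>U)) \<le> \<rho> U"
    and "1 / real (totient (W * \<Prod>U)) = 1 / real (totient W) * (\<Prod>p\<in>U. 1 / (real p - 1))"
proof -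
  have fU: "finite U" using assms subset_P_finite by auto
  have p: "real p > 2 * real k" "real k \<ge> 2" if "p \<in> U" for p using assms P_real k_ge that by auto
  have "1 / real (\<Prod>U) = (\<Prod>p\<in>U. 1 / real p)" by (simp add: prod_dividef)
  also have "\<dots> \<le> \<rho> U"
  proof (intro prod_mono conjI divide_left_mono)
    fix q assume "q \<in> U"
    from p[OF this] show "0 \<le> 1 / real q" "real q - real k \<le> real q" "0 < real q * (real q - real k)" by auto
  qed auto
  finally show "1 / real (\<Prod>U) \<le> \<rho> U" .
  have cop: "coprime W (\<Prod>U)"
    using assms P_prime P_gt coprime_primorial by (intro prod_coprime_right) (auto simp: coprime_commute subset_iff)
  have "totient (\<Prod>U) = (\<Prod>p\<in>U. totient p)"
    using totient_prod_coprime[of "\<lambda>x. x" U] assms P_prime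
    by (auto simp: pairwise_def subset_iff intro!: primes_coprime)
  also have "\<dots> = (\<Prod>p\<in>U. p - 1)" using assms P_prime by (intro prod.cong refl totient_prime) auto
  finally have t: "real (totient (\<Prod>U)) = (\<Prod>p\<in>U. real p - 1)"
  proof -
    assume "totient (\<Prod>U) = (\<Prod>p\<in>U. p - 1)"
    hence "real (totient (\<Prod>U)) = (\<Prod>p\<in>U. real (p - 1))" by simp
    also have "\<dots> = (\<Prod>p\<in>U. real p - 1)"
      using p by (intro prod.cong refl of_nat_diff[of 1, simplified]) force
    finally show ?thesis .
  qed
  have "real (totient (W * \<Prod>U)) = real (totient W) * (\<Prod>p\<in>U. real p - 1)"
    using cop by (simp add: totient_mult_coprime t)
  thus eq: "1 / real (totient (W * \<Prod>U)) = 1 / real (totient W) * (\<Prod>p\<in>U. 1 / (real p - 1))"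
    by (simp add: prod_dividef)
  have "real (totient W) \<ge> 1" using primorial_pos[of D] by (simp add: Suc_le_eq)
  hence "1 / real (totient W) * (\<Prod>p\<in>U. 1 / (real p - 1)) \<le> 1 * (\<Prod>p\<in>U. 1 / (real p - 1))"
  proof (intro mult_right_mono prod_nonneg)
    fix q assume "q \<in> U"
    thus "0 \<le> 1 / (real q - 1)" using p[of q] by simp
  next
    show "1 / real (totient W) \<le> 1" using \<open>real (totient W) \<ge> 1\<close> by (simp only: divide_le_eq_1_pos)
  qed
  also have "\<dots> \<le> \<rho> U" unfolding mult_1
  proof (intro prod_mono conjI divide_left_mono)
    fix q assume "q \<in> U"
    from p[OF this] show "0 \<le> 1 / (real q - 1)" "real q - real k \<le> real q - 1" "0 < (real q - 1) * (real q - real k)" by auto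
  qed auto
  finally show "1 / real (totient (W * \<Prod>U)) \<le> \<rho> U" using eq by simp
qed

lemma real_prod_P: "U \<subseteq> P \<Longrightarrow> real (\<Prod>U) = exp (lnprod U)"
proof -
  assume U: "U \<subseteq> P"
  have "0 < \<Prod>U" using prod_P_pos[OF U] by simp
  hence "exp (ln (real (\<Prod>U))) = real (\<Prod>U)" by (simp only: exp_ln of_nat_0_less_iff)
  moreover have "ln (real (\<Prod>U)) = lnprod U" using U subset_P_finite P_prime by (intro ln_prod_primes) auto
  ultimately show ?thesis by metis
qed

text \<open>Rankin's trick: on the support, 1 is at most exp(2 L) divided by the product of U. The
  result is R^2 times a power of the logarithm.\<close>

lemma err_one_le:
  "err (\<lambda>_. 1) \<le> exp (2 * L) * (K ^ (16 * k) / fact (16 * k) * (2 * L + real (16 * k) * C) ^ (16 * k))"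
proof -
  have "err (\<lambda>_. 1) \<le> (\<Sum>U\<in>Pow P. exp (2 * L) * (real (16 * k) ^ card U * (\<rho> U * tpow 0 (2 * L - lnprod U))))"
    unfolding err_def
  proof (rule sum_mono)
    fix U assume "U \<in> Pow P"
    hence U: "U \<subseteq> P" by simp
    have "tpow 0 (2 * L - lnprod U) \<le> exp (2 * L - lnprod U) * tpow 0 (2 * L - lnprod U)"
      by (auto simp: tpow_def)
    also have "exp (2 * L - lnprod U) = exp (2 * L) * (1 / real (\<Prod>U))" by (simp only: exp_diff real_prod_P[OF U] times_divide_eq_right mult_1_right)
    also have "\<dots> * tpow 0 (2 * L - lnprod U) \<le> exp (2 * L) * \<rho> U * tpow 0 (2 * L - lnprod U)"
      using prod_inverse_shifted_ge(1)[OF U] by (intro mult_right_mono mult_left_mono tpow_nonneg) auto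
    finally have "(16 * real k) ^ card U * tpow 0 (2 * L - lnprod U) \<le>
      (16 * real k) ^ card U * (exp (2 * L) * \<rho> U * tpow 0 (2 * L - lnprod U))"
      by (intro mult_left_mono) auto
    thus "(16 * real k) ^ card U * tpow 0 (2 * L - lnprod U) * 1 \<le>
      exp (2 * L) * (real (16 * k) ^ card U * (\<rho> U * tpow 0 (2 * L - lnprod U)))"
      by (simp add: mult_ac)
  qed
  also have "\<dots> \<le> exp (2 * L) * (K ^ (16 * k) / fact (16 * k) * (2 * L + real (16 * k) * C) ^ (16 * k))"
    unfolding sum_distrib_left[symmetric] using L_pos by (intro mult_left_mono dim_zero_upper) auto
  finally show ?thesis .
qed

text \<open>Here E has a pointwise bound \<open>X\<close> and a bound \<open>Y\<close> on average.
  Squaring the weight (16 k)^|U| makes the first part a sum of dimension M^2; the free parameter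
  \<open>T\<close>, later a power of log N, balances the two.\<close>

lemma err_le:
  assumes E: "\<And>U. U \<subseteq> P \<Longrightarrow> 0 \<le> E U"
    and X: "\<And>U. U \<subseteq> P \<Longrightarrow> lnprod U \<le> 2 * L \<Longrightarrow> E U \<le> X * \<rho> U"
    and Y: "(\<Sum>U\<in>small_sets. E U) \<le> Y"
    and T: "T > 0" and M: "M = 16 * k" and X0: "X \<ge> 0"
  shows "err E \<le> X / T * (K ^ M\<^sup>2 / fact (M\<^sup>2) * (2 * L + real (M\<^sup>2) * C) ^ M\<^sup>2) + T * Y"
proof -
  \<comment> \<open>Replaces Cauchy--Schwarz: large weights are paid for by the trivial bound, small ones by \<open>Y\<close>.\<close>
  have ineq: "m \<le> m\<^sup>2 / T + T" if "m \<ge> 0" for m :: real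
  proof (cases "m \<le> T")
    case False
    hence "m * T \<le> m\<^sup>2" using that by (simp add: power2_eq_square mult_left_mono)
    hence "m \<le> m\<^sup>2 / T" using T by (simp add: field_simps)
    thus ?thesis using T by simp
  qed (use T in \<open>auto intro: add_increasing\<close>)
  have "err E \<le> (\<Sum>U\<in>Pow P. X / T * (real (M\<^sup>2) ^ card U * (\<rho> U * tpow 0 (2 * L - lnprod U))) +
      T * (tpow 0 (2 * L - lnprod U) * E U))"
    unfolding err_def
  proof (rule sum_mono)
    fix U assume "U \<in> Pow P"
    hence U: "U \<subseteq> P" by simp
    show "(16 * real k) ^ card U * tpow 0 (2 * L - lnprod U) * E U \<le>
      X / T * (real (M\<^sup>2) ^ card U * (\<rho> U * tpow 0 (2 * L - lnprod U))) + T * (tpow 0 (2 * L - lnprod U) * E U)"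
    proof (cases "lnprod U \<le> 2 * L")
      case True
      have "(16 * real k) ^ card U * E U \<le> (((16 * real k) ^ card U)\<^sup>2 / T + T) * E U"
        using E[OF U] by (intro mult_right_mono ineq) auto
      also have "\<dots> = ((16 * real k) ^ card U)\<^sup>2 / T * E U + T * E U" by (simp add: distrib_right)
      also have "\<dots> \<le> ((16 * real k) ^ card U)\<^sup>2 / T * (X * \<rho> U) + T * E U"
        using T X[OF U True] by (intro add_right_mono mult_left_mono) auto
      also have "((16 * real k) ^ card U)\<^sup>2 = real (M\<^sup>2) ^ card U" 
        by (simp only: M of_nat_power of_nat_mult of_nat_numeral power_mult[symmetric] mult.commute)
      finally show ?thesis using True by (simp add: tpow_def mult_ac)
    next
      case False
      thus ?thesis by (simp add: tpow_def)
    qed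
  qed
  also have "\<dots> = X / T * (\<Sum>U\<in>Pow P. real (M\<^sup>2) ^ card U * (\<rho> U * tpow 0 (2 * L - lnprod U))) +
      T * (\<Sum>U\<in>Pow P. tpow 0 (2 * L - lnprod U) * E U)"
    by (simp only: sum.distrib sum_distrib_left)
  also have "(\<Sum>U\<in>Pow P. tpow 0 (2 * L - lnprod U) * E U) = (\<Sum>U\<in>small_sets. E U)"
    using finite_sieve_primes by (intro sum.mono_neutral_cong_right) (auto simp: tpow_def)
  also have "X / T * (\<Sum>U\<in>Pow P. real (M\<^sup>2) ^ card U * (\<rho> U * tpow 0 (2 * L - lnprod U))) + T * \<dots> \<le>
     X / T * (K ^ M\<^sup>2 / fact (M\<^sup>2) * (2 * L + real (M\<^sup>2) * C) ^ M\<^sup>2) + T * Y"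
    using X0 T L_pos Y by (intro add_mono mult_left_mono dim_zero_upper) auto
  finally show ?thesis .
qed

text \<open>Different U give different moduli W times the product of U, none above W R^2. The
  hypothesis on \<open>z\<close> is where the level of distribution limits R.\<close>

lemma sum_moduli_le:
  fixes E :: "nat \<Rightarrow> real"
  assumes "real W * exp (2 * L) \<le> z" "\<And>q. q > 0 \<Longrightarrow> E q \<ge> 0"
  shows "(\<Sum>U\<in>small_sets. E (W * \<Prod>U)) \<le> moduli_sum z E"
proof -
  let ?A = "small_sets"
  have "inj_on (\<lambda>U. W * \<Prod>U) ?A"
  proof (rule inj_onI)
    fix S T assume "S \<in> ?A" "T \<in> ?A" "W * \<Prod>S = W * \<Prod>T"
    thus "S = T" using primorial_pos[of D] inj_on_prod_primes[OF finite_sieve_primes P_prime]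
      by (auto dest: inj_onD)
  qed
  hence "(\<Sum>U\<in>?A. E (W * \<Prod>U)) = (\<Sum>q\<in>(\<lambda>U. W * \<Prod>U) ` ?A. E q)"
    by (simp add: sum.reindex)
  also have "\<dots> \<le> moduli_sum z E"
  proof (intro sum_mono2)
    show "finite {q. 1 \<le> q \<and> real q \<le> z}" by (rule finite_subset[OF _ finite_nat_le_real[of z]]) auto
    show "(\<lambda>U. W * \<Prod>U) ` ?A \<subseteq> {q. 1 \<le> q \<and> real q \<le> z}"
    proof
      fix q assume "q \<in> (\<lambda>U. W * \<Prod>U) ` ?A"
      then obtain U where U: "q = W * \<Prod>U" "U \<subseteq> P" "lnprod U \<le> 2 * L" by auto
      have "real q = real W * exp (lnprod U)" using U real_prod_P[OF U(2)] by simp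
      also have "\<dots> \<le> real W * exp (2 * L)" using U by (intro mult_left_mono) auto
      finally have "real q \<le> z" using assms(1) by linarith
      moreover have "1 \<le> q" using prod_P_pos[OF U(2)] U(1) by linarith
      ultimately show "q \<in> {q. 1 \<le> q \<and> real q \<le> z}" by simp
    qed
  qed (use assms in auto)
  finally show ?thesis .
qed

end

section \<open>The discrepancies of conditions (A) and (B)\<close>

definition prime_disc :: "real \<Rightarrow> nat \<Rightarrow> real" where
  "prime_disc N q =
     Max ((\<lambda>a. \<bar>(\<Sum>p\<in>{p::nat. prime p \<and> real p \<le> N \<and> [p = a] (mod q)}. ln (real p))
                    - N / real (totient q)\<bar>) ` {a. a < q \<and> coprime a q})"

definition liouville_disc :: "real \<Rightarrow> nat \<Rightarrow> real" where
  "liouville_disc N q =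
     Max ((\<lambda>(y, a). \<bar>real_of_int (\<Sum>n\<in>{n::nat. 1 \<le> n \<and> n \<le> y \<and> [n = a] (mod q)}. liouville n)\<bar>)
              ` ({y::nat. real y \<le> N} \<times> {a. a < q}))"

lemma condA_iff: "condA \<theta> \<longleftrightarrow> (\<forall>\<epsilon>>0. \<forall>A>0. \<exists>C. \<forall>\<^sub>F N in at_top.
     moduli_sum (N powr (\<theta> - \<epsilon>)) (prime_disc N) \<le> C * N / (ln N) powr A)"
  by (simp add: condA_def prime_disc_def)

lemma condB_iff: "condB \<theta> \<longleftrightarrow> (\<forall>\<epsilon>>0. \<forall>A>0. \<exists>C. \<forall>\<^sub>F N in at_top.
     moduli_sum (N powr (\<theta> - \<epsilon>)) (liouville_disc N) \<le> C * N / (ln N) powr A)"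
  by (simp add: condB_def liouville_disc_def)

lemma cong_mod_right_iff: "[n = a mod q] (mod q) \<longleftrightarrow> [n = a] (mod (q::nat))"
  by (simp add: cong_def)

lemma prime_disc_ge:
  assumes "q > 0" "coprime a q"
  shows "\<bar>(\<Sum>p\<in>{p::nat. prime p \<and> real p \<le> x \<and> [p = a] (mod q)}. ln (real p)) - x / real (totient q)\<bar> \<le>
    prime_disc x q"
proof -
  let ?f = "\<lambda>a. \<bar>(\<Sum>p\<in>{p::nat. prime p \<and> real p \<le> x \<and> [p = a] (mod q)}. ln (real p)) - x / real (totient q)\<bar>"
  have "?f (a mod q) \<le> prime_disc x q"
    unfolding prime_disc_def
  proof (rule Max_ge)
    show "?f (a mod q) \<in> ?f ` {a. a < q \<and> coprime a q}" by (rule imageI) (use assms in simp)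
  qed simp
  thus ?thesis by (simp only: cong_mod_right_iff)
qed

lemma prime_disc_nonneg:
  assumes "q > 0"
  shows "prime_disc x q \<ge> 0"
  using prime_disc_ge[OF assms, of 1 x] by simp

lemma card_cong_le:
  assumes "q > 0"
  shows "real (card {n::nat. 1 \<le> n \<and> n \<le> y \<and> [n = a] (mod q)}) \<le> real y / real q + 1"
proof -
  have "{n::nat. 1 \<le> n \<and> n \<le> y \<and> [n = a] (mod q)} = {n\<in>{0<..0+y}. [n = a] (mod q)}" by auto
  thus ?thesis using card_cong_interval[OF assms, of 0 y a] by (simp only:)
qed

text \<open>Trivial bound: the integers in the class are counted, each with weight ln x; q \<le> x
  lets x / q absorb the rounding term. It serves as the pointwise bound in
  \<open>err_le\<close>.\<close>

lemma prime_disc_le: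
  assumes "q > 0" "real q \<le> x"
  shows "prime_disc x q \<le> 2 * x / real q * ln x + x / real (totient q)"
proof -
  have x: "x \<ge> 1" using assms by linarith
  have ne: "{a. a < q \<and> coprime a q} \<noteq> {}" using assms by (auto intro!: exI[of _ "1 mod q"])
  show ?thesis unfolding prime_disc_def
  proof (subst Max_le_iff, goal_cases)
    case 3
    show ?case
    proof safe
      fix a
      let ?P = "{p::nat. prime p \<and> real p \<le> x \<and> [p = a] (mod q)}" and ?y = "nat \<lfloor>x\<rfloor>"
      let ?A = "{n::nat. 1 \<le> n \<and> n \<le> ?y \<and> [n = a] (mod q)}"
      have sub: "?P \<subseteq> ?A" by (auto simp: le_nat_floor Suc_le_eq prime_gt_0_nat)
      have finA: "finite ?A" by simp
      have y: "real ?y \<le> x" using x by simp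
      have "0 \<le> (\<Sum>p\<in>?P. ln (real p))"
        by (intro sum_nonneg) (auto simp: Suc_le_eq prime_gt_0_nat)
      moreover have "(\<Sum>p\<in>?P. ln (real p)) \<le> (\<Sum>p\<in>?A. ln x)"
      proof (rule order_trans)
        show "(\<Sum>p\<in>?P. ln (real p)) \<le> (\<Sum>p\<in>?P. ln x)"
          using x by (intro sum_mono) (auto simp: prime_gt_0_nat intro!: ln_mono)
        show "(\<Sum>p\<in>?P. ln x) \<le> (\<Sum>p\<in>?A. ln x)" using sub finA x by (intro sum_mono2) auto
      qed
      moreover have "(\<Sum>p\<in>?A. ln x) = real (card ?A) * ln x" by (simp only: sum_constant)
      moreover have "real (card ?A) * ln x \<le> (2 * x / real q) * ln x"
      proof (intro mult_right_mono)
        have "real (card ?A) \<le> real ?y / real q + 1" by (rule card_cong_le) fact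
        also have "\<dots> \<le> x / real q + x / real q" using y assms by (intro add_mono divide_right_mono) auto
        finally show "real (card ?A) \<le> 2 * x / real q" by simp
      qed (use x in auto)
      moreover have "x / real (totient q) \<ge> 0" using x by simp
      moreover have "2 * x / real q * ln x \<ge> 0" using x by simp
      ultimately show "\<bar>(\<Sum>p\<in>?P. ln (real p)) - x / real (totient q)\<bar> \<le> 2 * x / real q * ln x + x / real (totient q)"
        by linarith
    qed
  qed (use ne in auto)
qed

lemma liouville_disc_ge:
  assumes "q > 0" "real y \<le> x"
  shows "\<bar>\<Sum>n\<in>{n::nat. 1 \<le> n \<and> n \<le> y \<and> [n = a] (mod q)}. real_of_int (liouville n)\<bar> \<le> liouville_disc x q"
proof -
  let ?f = "\<lambda>(y, a). \<bar>real_of_int (\<Sum>n\<in>{n::nat. 1 \<le> n \<and> n \<le> y \<and> [n = a] (mod q)}. liouville n)\<bar>"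
  have "?f (y, a mod q) \<le> liouville_disc x q"
    unfolding liouville_disc_def
  proof (rule Max_ge)
    show "?f (y, a mod q) \<in> ?f ` ({y. real y \<le> x} \<times> {a. a < q})" by (rule imageI) (use assms in simp)
  qed (use finite_nat_le_real[of x] in simp)
  thus ?thesis by (simp only: cong_mod_right_iff case_prod_conv of_int_sum)
qed

lemma liouville_disc_nonneg:
  assumes "q > 0" "x \<ge> 0"
  shows "liouville_disc x q \<ge> 0"
  using liouville_disc_ge[OF assms(1), of 0 x 0] assms by simp

lemma abs_liouville: "\<bar>real_of_int (liouville n)\<bar> = 1"
  by (simp add: liouville_def power_abs)

lemma liouville_disc_le:
  assumes "q > 0" "real q \<le> x"
  shows "liouville_disc x q \<le> 2 * x / real q"
proof -
  have x: "x \<ge> 1" using assms by linarith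
  have ne: "{y::nat. real y \<le> x} \<times> {a. a < q} \<noteq> {}" using assms x by (auto intro!: exI[of _ 0])
  show ?thesis unfolding liouville_disc_def
  proof (subst Max_le_iff, goal_cases)
    case 1
    then show ?case using finite_nat_le_real[of x] by auto
  next
    case 2
    then show ?case using ne by simp
  next
    case 3
    show ?case
    proof safe
      fix y a assume y: "real y \<le> x"
      let ?A = "{n::nat. 1 \<le> n \<and> n \<le> y \<and> [n = a] (mod q)}"
      have "\<bar>real_of_int (\<Sum>n\<in>?A. liouville n)\<bar> \<le> (\<Sum>n\<in>?A. \<bar>real_of_int (liouville n)\<bar>)"
        unfolding of_int_sum by (rule sum_abs)
      also have "\<dots> = real (card ?A)" by (simp only: abs_liouville) simp
      also have "\<dots> \<le> real y / real q + 1" by (rule card_cong_le) fact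
      also have "\<dots> \<le> x / real q + x / real q" using y assms by (intro add_mono divide_right_mono) auto
      finally show "\<bar>real_of_int (\<Sum>n\<in>?A. liouville n)\<bar> \<le> 2 * x / real q" by simp
    qed
  qed
qed

text \<open>Conditions (A) and (B) concern initial segments, so a dyadic range becomes a difference
  of two of them.\<close>

lemma sum_shifted_progression:
  fixes f :: "nat \<Rightarrow> real"
  shows "(\<Sum>m\<in>{m\<in>{N<..N+M}. [m = a] (mod q)}. f (m + c)) =
    (\<Sum>n\<in>{n. 1 \<le> n \<and> n \<le> N + M + c \<and> [n = a + c] (mod q)}. f n) -
    (\<Sum>n\<in>{n. 1 \<le> n \<and> n \<le> N + c \<and> [n = a + c] (mod q)}. f n)"
proof -
  let ?B = "{n. 1 \<le> n \<and> n \<le> N + M + c \<and> [n = a + c] (mod q)}"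
  let ?A = "{n. 1 \<le> n \<and> n \<le> N + c \<and> [n = a + c] (mod q)}"
  have "(\<Sum>m\<in>{m\<in>{N<..N+M}. [m = a] (mod q)}. f (m + c)) = (\<Sum>n\<in>?B - ?A. f n)"
  proof (rule sum.reindex_bij_witness[of _ "\<lambda>n. n - c" "\<lambda>m. m + c"])
    fix n assume n: "n \<in> ?B - ?A"
    hence "n > N + c" by auto
    then obtain m where m: "n = m + c" by (metis add.commute le_Suc_ex less_imp_le_nat le_add2 le_trans)
    show "n - c \<in> {m\<in>{N<..N+M}. [m = a] (mod q)}" using n \<open>n > N + c\<close> unfolding m
      by (auto simp: cong_add_rcancel_nat)
  qed (auto simp: cong_add_rcancel_nat)
  also have "\<dots> = sum f ?B - sum f ?A" by (rule sum_diff) auto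
  finally show ?thesis .
qed

definition vartheta :: "nat \<Rightarrow> real" where
  "vartheta n = (if prime n then ln (real n) else 0)"

lemma sum_vartheta:
  "(\<Sum>n\<in>{n. 1 \<le> n \<and> n \<le> y \<and> [n = a] (mod q)}. vartheta n) =
   (\<Sum>p\<in>{p::nat. prime p \<and> real p \<le> real y \<and> [p = a] (mod q)}. ln (real p))"
  by (rule sum.mono_neutral_cong_right) (auto simp: vartheta_def Suc_le_eq prime_gt_0_nat)

context gpy
begin

section \<open>The total, Liouville and prime sums\<close>

lemma sum_wt_approx:
  assumes "H \<subseteq> {..D}" "card H = k"
  shows "\<bar>(\<Sum>m\<in>range_set N \<nu>. wt H m) -
     real N / real W * form_all\<bar> \<le>
     weight_bound\<^sup>2 * err (\<lambda>_. 1)"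
proof -
  have "\<bar>(\<Sum>m\<in>range_set N \<nu>. 1 * wt H m) -
     real N * (\<Sum>S\<in>Pow P. \<Sum>T\<in>Pow P. lam S * lam T * (real (card H) ^ card (S \<union> T) * (1 / real (W * \<Prod>(S \<union> T)))))\<bar> \<le>
     weight_bound\<^sup>2 * err (\<lambda>_. 1)"
  proof (rule weighted_sum)
    fix U a assume U: "U \<subseteq> P"
    have "(\<Sum>m\<in>{m\<in>{N<..N+N}. [m = a] (mod W * \<Prod>U)}. 1::real) = real (card {m\<in>{N<..N+N}. [m = a] (mod W * \<Prod>U)})" by simp
    thus "\<bar>(\<Sum>m\<in>{m\<in>{N<..N+N}. [m = a] (mod W * \<Prod>U)}. 1) - real N * (1 / real (W * \<Prod>U))\<bar> \<le> 1"
      using card_cong_interval[OF prod_P_pos[OF U], of N N a] by (simp only: times_divide_eq_right mult_1_right)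
  qed (use assms in auto)
  moreover have "real N * (\<Sum>S\<in>Pow P. \<Sum>T\<in>Pow P. lam S * lam T * (real (card H) ^ card (S \<union> T) * (1 / real (W * \<Prod>(S \<union> T))))) =
    real N / real W * form_all"
    unfolding sum_distrib_left
  proof (intro sum.cong refl)
    fix S T :: "nat set"
    have "real (card H) ^ card (S \<union> T) * (1 / real (W * \<Prod>(S \<union> T))) = 1 / real W * (\<Prod>p\<in>S \<union> T. real k / real p)"
      using assms by (simp add: prod_dividef)
    thus "real N * (lam S * lam T * (real (card H) ^ card (S \<union> T) * (1 / real (W * \<Prod>(S \<union> T))))) =
      real N / real W * (lam S * lam T * (\<Prod>p\<in>S \<union> T. real k / real p))" by (simp only:) simp
  qed
  ultimately show ?thesis by simp
qed

text \<open>The main term is zero. Since (B) has a maximum over y \<le> N, one \<open>x\<close>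
  serves both initial segments, whence the factor 2; since it has a maximum over all classes, a + b
  need not be coprime to the modulus.\<close>

lemma sum_wt_liouville_le:
  assumes "H \<subseteq> {..D}" "card H = k" "real (N + N + b) \<le> x"
  shows "\<bar>\<Sum>m\<in>range_set N \<nu>. real_of_int (liouville (m + b)) * wt H m\<bar> \<le>
     weight_bound\<^sup>2 * err (\<lambda>U. 2 * liouville_disc x (W * \<Prod>U))"
proof -
  have "\<bar>(\<Sum>m\<in>range_set N \<nu>. real_of_int (liouville (m + b)) * wt H m) -
     0 * (\<Sum>S\<in>Pow P. \<Sum>T\<in>Pow P. lam S * lam T * (real (card H) ^ card (S \<union> T) * 0))\<bar> \<le>
     weight_bound\<^sup>2 * err (\<lambda>U. 2 * liouville_disc x (W * \<Prod>U))"
  proof (rule weighted_sum)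
    fix U assume U: "U \<subseteq> P"
    show "0 \<le> 2 * liouville_disc x (W * \<Prod>U)"
      using liouville_disc_nonneg[OF prod_P_pos[OF U], of x] assms(3) by simp
    fix a
    have "\<bar>\<Sum>n\<in>{n. 1 \<le> n \<and> n \<le> N + N + b \<and> [n = a + b] (mod W * \<Prod>U)}. real_of_int (liouville n)\<bar> \<le> liouville_disc x (W * \<Prod>U)"
      using prod_P_pos[OF U] assms(3) by (rule liouville_disc_ge)
    moreover have "\<bar>\<Sum>n\<in>{n. 1 \<le> n \<and> n \<le> N + b \<and> [n = a + b] (mod W * \<Prod>U)}. real_of_int (liouville n)\<bar> \<le> liouville_disc x (W * \<Prod>U)"
      using prod_P_pos[OF U] by (rule liouville_disc_ge) (use assms(3) in simp)
    ultimately show "\<bar>(\<Sum>m\<in>{m\<in>{N<..N+N}. [m = a] (mod W * \<Prod>U)}. real_of_int (liouville (m + b))) - 0 * 0\<bar> \<le> 2 * liouville_disc x (W * \<Prod>U)"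
      unfolding sum_shifted_progression[where f = "\<lambda>n. real_of_int (liouville n)"] by linarith
  qed (use assms in auto)
  thus ?thesis by simp
qed

text \<open>A prime m + h larger than R is divisible by no sieving prime, so h never produces a
  hit.\<close>

lemma wt_prime_shift:
  assumes "prime (m + h)" "exp L < real m"
  shows "wt H m = wt (H - {h}) m"
proof -
  have "hits H m S = hits (H - {h}) m S" if "S \<subseteq> P" for S
  proof -
    have "\<not> p dvd m + h" if p: "p \<in> S" for p
    proof
      assume "p dvd m + h"
      moreover have pp: "prime p" "ln (real p) \<le> L" using p \<open>S \<subseteq> P\<close> by (auto simp: sieve_primes_def)
      ultimately have "p = m + h" using assms(1) by (simp add: primes_dvd_imp_eq)
      have "exp (ln (real p)) \<le> exp L" using pp(2) by (subst exp_le_cancel_iff)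
      hence "real p \<le> exp L" using pp(1) by (simp add: prime_gt_0_nat)
      thus False using assms(2) \<open>p = m + h\<close> by simp
    qed
    thus ?thesis by (auto simp: hits_def)
  qed
  hence "(\<Sum>S\<in>Pow P. of_bool (hits H m S) * lam S) = (\<Sum>S\<in>Pow P. of_bool (hits (H - {h}) m S) * lam S)"
    by (intro sum.cong refl) simp
  thus ?thesis unfolding wt_def by (simp only:)
qed

text \<open>Dropping h from the tuple is what puts a + h in a reduced class, as (A) demands: p
  divides a + h' for some other h', and h, h' are distinct modulo p > D. As (A) has no maximum over
  initial segments, its discrepancy is taken at both end points.\<close>

lemma sum_wt_primes_ge:
  assumes H: "H \<subseteq> {..D}" "card H = k" "h \<in> H" and \<nu>: "coprime (\<nu> + h) W" and N: "exp L < real N"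
  shows "(\<Sum>m\<in>range_set N \<nu>. vartheta (m + h) * wt H m) \<ge>
     real N / real (totient W) * form_primes -
     weight_bound\<^sup>2 * err (\<lambda>U. prime_disc (real (N + N + h)) (W * \<Prod>U) + prime_disc (real (N + h)) (W * \<Prod>U))"
proof -
  let ?H = "H - {h}"
  let ?E = "\<lambda>U. prime_disc (real (N + N + h)) (W * \<Prod>U) + prime_disc (real (N + h)) (W * \<Prod>U)"
  have finH: "finite H" using H(1) finite_subset by blast
  have cH: "card ?H = k - 1" using H finH by simp
  have 1: "\<bar>(\<Sum>m\<in>range_set N \<nu>. vartheta (m + h) * wt ?H m) -
     real N * (\<Sum>S\<in>Pow P. \<Sum>T\<in>Pow P. lam S * lam T * (real (card ?H) ^ card (S \<union> T) * (1 / real (totient (W * \<Prod>(S \<union> T))))))\<bar> \<le>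
     weight_bound\<^sup>2 * err ?E"
  proof (rule weighted_sum)
    fix U assume U: "U \<subseteq> P"
    note pos = prod_P_pos[OF U]
    show "0 \<le> ?E U" using prime_disc_nonneg[OF pos] by (intro add_nonneg_nonneg) auto
    fix a assume a: "a \<in> residue_set W \<nu> U (tuple_roots ?H)"
    have "coprime (a + h) W"
    proof -
      have "[a + h = \<nu> + h] (mod W)" using a by (simp add: residue_set_def cong_add_rcancel_nat)
      thus ?thesis using \<nu> by (metis cong_imp_coprime cong_sym)
    qed
    moreover have "coprime (a + h) p" if p: "p \<in> U" for p
    proof -
      have pp: "prime p" "D < p" using U p P_prime P_gt by auto
      have "a mod p \<in> tuple_roots ?H p" using a p by (auto simp: residue_set_def)
      hence "\<exists>h'\<in>?H. p dvd a + h'" using pp mod_tuple_roots[of p a ?H] prime_gt_0_nat by blast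
      then obtain h' where h': "h' \<in> H" "h' \<noteq> h" "p dvd a + h'" by auto
      have "\<not> p dvd a + h"
      proof
        assume "p dvd a + h"
        hence "[a + h = a + h'] (mod p)" using h'(3) by (metis cong_0_iff cong_sym cong_trans)
        hence "[h = h'] (mod p)" by (simp add: cong_add_lcancel_nat)
        moreover have "h < p" "h' < p" using H(1,3) h'(1) pp(2) by force+
        ultimately show False using h'(2) by (simp add: cong_def)
      qed
      thus ?thesis using pp(1) by (metis coprime_commute prime_imp_coprime)
    qed
    hence "coprime (a + h) (\<Prod>U)" by (intro prod_coprime_right) auto
    ultimately have cop: "coprime (a + h) (W * \<Prod>U)" by simp
    have e: "real N * (1 / real (totient (W * \<Prod>U))) =
       real (N + N + h) / real (totient (W * \<Prod>U)) - real (N + h) / real (totient (W * \<Prod>U))"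
      by (simp add: diff_divide_distrib[symmetric])
    show "\<bar>(\<Sum>m\<in>{m\<in>{N<..N+N}. [m = a] (mod W * \<Prod>U)}. vartheta (m + h)) - real N * (1 / real (totient (W * \<Prod>U)))\<bar> \<le> ?E U"
      unfolding sum_shifted_progression[where f = vartheta] sum_vartheta e
      using prime_disc_ge[OF pos cop, of "real (N + N + h)"] prime_disc_ge[OF pos cop, of "real (N + h)"]
      by linarith
  qed (use H cH in auto)
  have 2: "(\<Sum>m\<in>range_set N \<nu>. vartheta (m + h) * wt ?H m) =
    (\<Sum>m\<in>range_set N \<nu>. vartheta (m + h) * wt H m)"
  proof (intro sum.cong refl)
    fix m assume m: "m \<in> range_set N \<nu>"
    show "vartheta (m + h) * wt ?H m = vartheta (m + h) * wt H m"
    proof (cases "prime (m + h)")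
      case True
      have "exp L < real m" using N m by auto
      from wt_prime_shift[OF True this] show ?thesis by simp
    qed (simp add: vartheta_def)
  qed
  have 3: "real N * (\<Sum>S\<in>Pow P. \<Sum>T\<in>Pow P. lam S * lam T * (real (card ?H) ^ card (S \<union> T) * (1 / real (totient (W * \<Prod>(S \<union> T)))))) =
    real N / real (totient W) * form_primes"
    unfolding sum_distrib_left
  proof (intro sum.cong refl)
    fix S T assume "S \<in> Pow P" "T \<in> Pow P"
    hence ST: "S \<union> T \<subseteq> P" by auto
    have "(\<Prod>p\<in>S \<union> T. (real k - 1) / (real p - 1)) = (\<Prod>p\<in>S \<union> T. (real k - 1) * (1 / (real p - 1)))" by simp
    also have "\<dots> = (real k - 1) ^ card (S \<union> T) * (\<Prod>p\<in>S \<union> T. 1 / (real p - 1))"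
      by (simp only: prod.distrib prod_constant)
    finally have 1: "(\<Prod>p\<in>S \<union> T. (real k - 1) / (real p - 1)) = (real k - 1) ^ card (S \<union> T) * (\<Prod>p\<in>S \<union> T. 1 / (real p - 1))" .
    have 2: "real (card ?H) = real k - 1" using cH k_ge by simp
    show "real N * (lam S * lam T * (real (card ?H) ^ card (S \<union> T) * (1 / real (totient (W * \<Prod>(S \<union> T)))))) =
      real N / real (totient W) * (lam S * lam T * (\<Prod>p\<in>S \<union> T. (real k - 1) / (real p - 1)))"
      unfolding 1 2 prod_inverse_shifted_ge(3)[OF ST] by simp
  qed
  have "y - e \<le> a" if "\<bar>a - y\<bar> \<le> e" for a y e :: real using that by linarith
  from this[OF 1[unfolded 2 3]] show ?thesis .
qed

end

section \<open>Error terms\<close>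

context gpy
begin

text \<open>These constants and \<open>dim_const\<close> depend on k, D, c and n but not on L; all
  growth is moved into powers of l, later log N.\<close>

definition "weight_const = (\<Sum>i<n. c i) * (K ^ k * (1 / fact k) * (1 + real k * C) ^ k)"
definition "dim_const j = K ^ j / fact j * (2 + real j * C) ^ j"

lemma dim_const_nonneg: "dim_const j \<ge> 0"
  unfolding dim_const_def using C_nonneg primorial_density_pos[of D]
  by (intro mult_nonneg_nonneg divide_nonneg_nonneg zero_le_power add_nonneg_nonneg) auto

lemma weight_bound_le:
  assumes "1 \<le> l" "L \<le> l"
  shows "weight_bound \<le> weight_const * l ^ k"
proof -
  have "L + real k * C \<le> l + real k * C * l"
    using assms C_nonneg mult_left_mono[OF assms(1), of "real k * C"] by auto
  also have "\<dots> = (1 + real k * C) * l" by (simp only: distrib_right mult_1)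
  finally have "(L + real k * C) ^ k \<le> ((1 + real k * C) * l) ^ k"
    using L_pos C_nonneg by (intro power_mono) auto
  hence "(\<Sum>i<n. c i) * (K ^ k * (1 / fact k) * (L + real k * C) ^ k) \<le>
     (\<Sum>i<n. c i) * (K ^ k * (1 / fact k) * ((1 + real k * C) * l) ^ k)"
    using c_nonneg primorial_density_pos[of D] by (intro mult_left_mono sum_nonneg mult_nonneg_nonneg) auto
  thus ?thesis unfolding weight_bound_def weight_const_def by (simp only: power_mult_distrib mult_ac)
qed

lemma dim_bound_le:
  assumes "1 \<le> l" "L \<le> l"
  shows "K ^ j / fact j * (2 * L + real j * C) ^ j \<le> dim_const j * l ^ j"
proof -
  have "2 * L + real j * C \<le> 2 * l + real j * C * l"
    using assms C_nonneg mult_left_mono[OF assms(1), of "real j * C"] by auto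
  also have "\<dots> = (2 + real j * C) * l" by (simp only: distrib_right)
  finally have "(2 * L + real j * C) ^ j \<le> ((2 + real j * C) * l) ^ j"
    using L_pos C_nonneg by (intro power_mono) auto
  hence "K ^ j / fact j * (2 * L + real j * C) ^ j \<le> K ^ j / fact j * ((2 + real j * C) * l) ^ j"
    using primorial_density_pos[of D] by (intro mult_left_mono) auto
  thus ?thesis unfolding dim_const_def by (simp only: power_mult_distrib mult_ac)
qed

text \<open>Apply \<open>err_le\<close> with T = l^a. The pointwise part is l * l^(M^2) / l^a =
  l^(-2 k) and the averaged part is l^a / l^(a + 2 k), also l^(-2 k). This cancels the l^(2 k) in
  the squared weight bound and leaves O(Z), which explains the choice of \<open>a\<close> and of the
  exponent a + 2 k demanded from (A) and (B).\<close>

lemma weight_err_le: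
  assumes l: "1 \<le> l" "L \<le> l"
    and E: "\<And>U. U \<subseteq> P \<Longrightarrow> 0 \<le> E U"
    and X: "\<And>U. U \<subseteq> P \<Longrightarrow> lnprod U \<le> 2 * L \<Longrightarrow> E U \<le> (X0 * Z * l) * \<rho> U"
    and M: "M = 16 * k" and a: "a = M\<^sup>2 + 2 * k + 1"
    and Y: "(\<Sum>U\<in>small_sets. E U) \<le> Y0 * Z / l ^ (a + 2 * k)"
    and X0: "X0 \<ge> 0" and Z: "Z \<ge> 0"
  shows "weight_bound\<^sup>2 * err E \<le> weight_const\<^sup>2 * (X0 * dim_const (M\<^sup>2) + Y0) * Z"
proof -
  have l0: "l > 0" using l by simp
  have errn: "0 \<le> err E" unfolding err_def using E by (intro sum_nonneg mult_nonneg_nonneg tpow_nonneg) auto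
  have "err E \<le> (X0 * Z * l) / l ^ a * (K ^ M\<^sup>2 / fact (M\<^sup>2) * (2 * L + real (M\<^sup>2) * C) ^ M\<^sup>2) +
      l ^ a * (Y0 * Z / l ^ (a + 2 * k))"
    using l0 X0 Z by (intro err_le E X Y M) auto
  also have "\<dots> \<le> (X0 * Z * l) / l ^ a * (dim_const (M\<^sup>2) * l ^ M\<^sup>2) + l ^ a * (Y0 * Z / l ^ (a + 2 * k))"
    using l0 X0 Z l by (intro add_right_mono mult_left_mono dim_bound_le) auto
  also have "\<dots> = (X0 * dim_const (M\<^sup>2) + Y0) * Z / l ^ (2 * k)"
  proof -
    have "l ^ a = l * l ^ M\<^sup>2 * l ^ (2 * k)" by (simp add: a power_add mult_ac)
    hence "(X0 * Z * l) / l ^ a * (dim_const (M\<^sup>2) * l ^ M\<^sup>2) = X0 * dim_const (M\<^sup>2) * Z / l ^ (2 * k)"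
      using l0 by (simp add: field_simps)
    moreover have "l ^ a * (Y0 * Z / l ^ (a + 2 * k)) = Y0 * Z / l ^ (2 * k)"
      using l0 by (simp add: power_add field_simps)
    ultimately show ?thesis by (simp only: distrib_right add_divide_distrib)
  qed
  finally have 1: "err E \<le> (X0 * dim_const (M\<^sup>2) + Y0) * Z / l ^ (2 * k)" .
  have "weight_bound\<^sup>2 * err E \<le> (weight_const * l ^ k)\<^sup>2 * ((X0 * dim_const (M\<^sup>2) + Y0) * Z / l ^ (2 * k))"
    using weight_bound_le[OF l] weight_bound_nonneg 1 errn by (intro mult_mono power_mono) auto
  also have "(weight_const * l ^ k)\<^sup>2 = weight_const\<^sup>2 * l ^ (2 * k)"
    by (simp add: power_mult_distrib mult.commute flip: power_mult)
  also have "weight_const\<^sup>2 * l ^ (2 * k) * ((X0 * dim_const (M\<^sup>2) + Y0) * Z / l ^ (2 * k)) = weight_const\<^sup>2 * (X0 * dim_const (M\<^sup>2) + Y0) * Z"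
    using l0 by simp
  finally show ?thesis .
qed

lemma modulus_le:
  assumes "U \<subseteq> P" "lnprod U \<le> 2 * L"
  shows "real (W * \<Prod>U) \<le> real W * exp (2 * L)"
proof -
  have "real (W * \<Prod>U) = real W * exp (lnprod U)" using real_prod_P[OF assms(1)] by (simp only: of_nat_mult)
  also have "\<dots> \<le> real W * exp (2 * L)" using assms by (intro mult_left_mono) auto
  finally show ?thesis .
qed

lemma inverse_modulus_le:
  assumes "U \<subseteq> P"
  shows "1 / real (W * \<Prod>U) \<le> \<rho> U"
proof -
  have pos: "0 < \<Prod>U" "0 < W" using prod_P_pos[OF assms] by auto
  have "1 / real (W * \<Prod>U) \<le> 1 / real (\<Prod>U)"
  proof (rule divide_left_mono)
    have "1 * \<Prod>U \<le> W * \<Prod>U" using pos by (intro mult_right_mono) auto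
    thus "real (\<Prod>U) \<le> real (W * \<Prod>U)" by (simp only: of_nat_le_iff mult_1)
    show "0 < real (W * \<Prod>U) * real (\<Prod>U)" using pos by (simp only: of_nat_0_less_iff mult_pos_pos)
  qed simp
  also have "\<dots> \<le> \<rho> U" by (rule prod_inverse_shifted_ge) fact
  finally show ?thesis .
qed

lemma prod_shifted_nonneg: "U \<subseteq> P \<Longrightarrow> 0 \<le> \<rho> U"
  using inverse_modulus_le[of U] by (rule order_trans[rotated]) (simp_all only: zero_le_divide_1_iff of_nat_0_le_iff)

lemma liouville_err_le:
  assumes l: "1 \<le> l" "L \<le> l" and x: "0 \<le> Z" "x \<le> 3 * Z"
    and z: "real W * exp (2 * L) \<le> z" "real W * exp (2 * L) \<le> x"
    and a: "a = (16 * k)\<^sup>2 + 2 * k + 1"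
    and Y: "moduli_sum z (liouville_disc x) \<le> Y0 * Z / l ^ (a + 2 * k)"
  shows "weight_bound\<^sup>2 * err (\<lambda>U. 2 * liouville_disc x (W * \<Prod>U)) \<le>
    weight_const\<^sup>2 * (12 * dim_const ((16 * k)\<^sup>2) + 2 * Y0) * Z"
proof (rule weight_err_le[where a = a])
  have x0: "x \<ge> 0"
    using z by (metis exp_ge_zero mult_nonneg_nonneg of_nat_0_le_iff order_trans)
  show "0 \<le> 2 * liouville_disc x (W * \<Prod>U)" if "U \<subseteq> P" for U
    using liouville_disc_nonneg[OF prod_P_pos[OF that] x0] by simp
  show "2 * liouville_disc x (W * \<Prod>U) \<le> 12 * Z * l * \<rho> U"
    if U: "U \<subseteq> P" "lnprod U \<le> 2 * L" for U
  proof -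
    have "real (W * \<Prod>U) \<le> x" using modulus_le[OF U] z by linarith
    hence "liouville_disc x (W * \<Prod>U) \<le> 2 * x / real (W * \<Prod>U)"
      using prod_P_pos[OF U(1)] by (intro liouville_disc_le)
    also have "\<dots> = 2 * x * (1 / real (W * \<Prod>U))" by simp
    also have "\<dots> \<le> 2 * x * \<rho> U"
      using inverse_modulus_le[OF U(1)] x0 by (intro mult_left_mono) auto
    also have "\<dots> \<le> 2 * (3 * Z * l) * \<rho> U"
    proof (intro mult_right_mono mult_left_mono prod_shifted_nonneg U)
      have "Z * 1 \<le> Z * l" using l x by (intro mult_left_mono) auto
      thus "x \<le> 3 * Z * l" using x by linarith
    qed simp
    finally show ?thesis by simp
  qed
  have "(\<Sum>U\<in>small_sets. liouville_disc x (W * \<Prod>U)) \<le>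
     moduli_sum z (liouville_disc x)"
    using z x0 liouville_disc_nonneg by (intro sum_moduli_le) auto
  also note Y
  finally show "(\<Sum>U\<in>small_sets. 2 * liouville_disc x (W * \<Prod>U)) \<le> 2 * Y0 * Z / l ^ (a + 2 * k)"
    by (simp add: sum_distrib_left[symmetric])
qed (use l a x in auto)

lemma prime_disc_modulus_le:
  assumes l: "1 \<le> l" and x: "0 \<le> Z" "x \<le> 3 * Z" "ln x \<le> 3 * l"
    and z: "real W * exp (2 * L) \<le> x" and U: "U \<subseteq> P" "lnprod U \<le> 2 * L"
  shows "prime_disc x (W * \<Prod>U) \<le> 21 * Z * l * \<rho> U"
proof -
  let ?r = "\<Prod>p\<in>U. 1 / (real p - real k)"
  have qx: "real (W * \<Prod>U) \<le> x" using modulus_le[OF U] z by linarith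
  have x1: "x \<ge> 1" using qx prod_P_pos[OF U(1)] by linarith
  have lx: "ln x \<ge> 0" using x1 by simp
  have r: "?r \<ge> 0" by (rule prod_shifted_nonneg) fact
  have Zl: "Z * 1 \<le> Z * l" using l x by (intro mult_left_mono) auto
  have "prime_disc x (W * \<Prod>U) \<le> 2 * x / real (W * \<Prod>U) * ln x + x / real (totient (W * \<Prod>U))"
    using prod_P_pos[OF U(1)] qx by (rule prime_disc_le)
  also have "\<dots> = (2 * x * ln x) * (1 / real (W * \<Prod>U)) + x * (1 / real (totient (W * \<Prod>U)))" by simp
  also have "\<dots> \<le> (2 * x * ln x) * ?r + x * ?r"
    using inverse_modulus_le[OF U(1)] prod_inverse_shifted_ge(2)[OF U(1)] x1 lx
    by (intro add_mono mult_left_mono mult_nonneg_nonneg) auto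
  also have "\<dots> = (2 * x * ln x + x) * ?r" by (simp only: distrib_right)
  also have "\<dots> \<le> (21 * Z * l) * ?r"
  proof (intro mult_right_mono r)
    \<comment> \<open>This gives 2 * 9 + 3 = 21.\<close>
    have "x * ln x \<le> (3 * Z) * (3 * l)" using x lx x1 by (intro mult_mono) auto
    thus "2 * x * ln x + x \<le> 21 * Z * l" using x Zl by linarith
  qed
  finally show ?thesis .
qed

lemma prime_err_le:
  assumes l: "1 \<le> l" "L \<le> l" and Z: "0 \<le> Z" and x: "x \<le> 3 * Z" "ln x \<le> 3 * l" and x': "x' \<le> 3 * Z" "ln x' \<le> 3 * l"
    and z: "real W * exp (2 * L) \<le> z" "real W * exp (2 * L) \<le> x" "real W * exp (2 * L) \<le> z'" "real W * exp (2 * L) \<le> x'"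
    and a: "a = (16 * k)\<^sup>2 + 2 * k + 1"
    and Y: "moduli_sum z (prime_disc x) \<le> Y0 * Z / l ^ (a + 2 * k)"
    and Y': "moduli_sum z' (prime_disc x') \<le> Y0 * Z / l ^ (a + 2 * k)"
  shows "weight_bound\<^sup>2 * err (\<lambda>U. prime_disc x (W * \<Prod>U) + prime_disc x' (W * \<Prod>U)) \<le>
    weight_const\<^sup>2 * (42 * dim_const ((16 * k)\<^sup>2) + 2 * Y0) * Z"
proof (rule weight_err_le[where a = a])
  show "0 \<le> prime_disc x (W * \<Prod>U) + prime_disc x' (W * \<Prod>U)" if "U \<subseteq> P" for U
    using prime_disc_nonneg[OF prod_P_pos[OF that]] by (intro add_nonneg_nonneg) auto
  show "prime_disc x (W * \<Prod>U) + prime_disc x' (W * \<Prod>U) \<le> 42 * Z * l * \<rho> U"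
    if U: "U \<subseteq> P" "lnprod U \<le> 2 * L" for U
  proof -
    have "prime_disc x (W * \<Prod>U) \<le> 21 * Z * l * \<rho> U"
      using z by (intro prime_disc_modulus_le l Z x U) auto
    moreover have "prime_disc x' (W * \<Prod>U) \<le> 21 * Z * l * \<rho> U"
      using z by (intro prime_disc_modulus_le l Z x' U) auto
    ultimately show ?thesis by linarith
  qed
  have "(\<Sum>U\<in>small_sets. prime_disc x (W * \<Prod>U)) \<le>
     moduli_sum z (prime_disc x)"
    using z prime_disc_nonneg by (intro sum_moduli_le) auto
  moreover have "(\<Sum>U\<in>small_sets. prime_disc x' (W * \<Prod>U)) \<le>
     moduli_sum z' (prime_disc x')"
    using z prime_disc_nonneg by (intro sum_moduli_le) auto
  ultimately show "(\<Sum>U\<in>small_sets. prime_disc x (W * \<Prod>U) + prime_disc x' (W * \<Prod>U)) \<le>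
     2 * Y0 * Z / l ^ (a + 2 * k)"
    using Y Y' by (simp add: sum.distrib)
qed (use l a Z in auto)

text \<open>The assumed inequality is multiplied by \<open>wt H m\<close> \<ge> 0 and summed. Each
  prime m + h is at most 2 N + D \<le> 3 N, so its logarithm is at most ln (3 N), which converts the
  count of primes into the \<open>vartheta\<close> sums.\<close>

lemma main_inequality:
  assumes H: "H \<subseteq> {..D}" "card H = k" and \<nu>: "\<And>h. h \<in> H \<Longrightarrow> coprime (\<nu> + h) W"
    and N: "exp L < real N" "D \<le> N"
    and primes: "\<And>m. m > N \<Longrightarrow> (\<Sum>h\<in>H. of_bool (prime (m + h))) \<le> (1 + real_of_int (liouville (m + b))) / 2"
    and err1: "weight_bound\<^sup>2 * err (\<lambda>_. 1) \<le> e1 * real N"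
    and err2: "\<And>h. h \<in> H \<Longrightarrow> weight_bound\<^sup>2 * err (\<lambda>U. prime_disc (real (N + N + h)) (W * \<Prod>U) + prime_disc (real (N + h)) (W * \<Prod>U)) \<le> e2 * real N"
    and err3: "weight_bound\<^sup>2 * err (\<lambda>U. 2 * liouville_disc x (W * \<Prod>U)) \<le> e3 * real N"
    and b: "real (N + N + b) \<le> x"
  shows "real k * (real N / real (totient W) * (\<delta> ^ (k + 1) * L ^ (k + 1) *
     J2) - e2 * real N) \<le>
    ln (3 * real N) / 2 * (real N / real W * (K ^ k * J1) + (e1 + e3) * real N)"
proof -
  let ?I = "range_set N \<nu>"
  have finH: "finite H" using H(1) finite_subset by blast
  have N1: "real N > 1" using N(1) L_pos by (smt (verit) exp_gt_one)
  have l3: "ln (3 * real N) \<ge> 0" using N1 by simp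
  have "real k * (real N / real (totient W) * (\<delta> ^ (k + 1) * L ^ (k + 1) * J2) - e2 * real N) =
    (\<Sum>h\<in>H. real N / real (totient W) * (\<delta> ^ (k + 1) * L ^ (k + 1) * J2) - e2 * real N)"
    using H(2) by simp
  also have "\<dots> \<le> (\<Sum>h\<in>H. \<Sum>m\<in>?I. vartheta (m + h) * wt H m)"
  proof (rule sum_mono)
    fix h assume h: "h \<in> H"
    have "real N / real (totient W) * (\<delta> ^ (k + 1) * L ^ (k + 1) * J2) \<le>
      real N / real (totient W) * form_primes"
      by (intro mult_left_mono form_primes_ge) auto
    thus "real N / real (totient W) * (\<delta> ^ (k + 1) * L ^ (k + 1) * J2) - e2 * real N \<le> (\<Sum>m\<in>?I. vartheta (m + h) * wt H m)"
      using sum_wt_primes_ge[OF H h \<nu>[OF h] N(1)] err2[OF h] by linarith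
  qed
  also have "\<dots> = (\<Sum>m\<in>?I. \<Sum>h\<in>H. vartheta (m + h) * wt H m)" by (rule sum.swap)
  also have "\<dots> \<le> (\<Sum>m\<in>?I. ln (3 * real N) * ((1 + real_of_int (liouville (m + b))) / 2) * wt H m)"
  proof (rule sum_mono)
    fix m assume m: "m \<in> ?I"
    have "(\<Sum>h\<in>H. vartheta (m + h)) \<le> (\<Sum>h\<in>H. ln (3 * real N) * of_bool (prime (m + h)))"
    proof (rule sum_mono)
      fix h assume "h \<in> H"
      hence "h \<le> N" using H(1) N(2) by auto
      hence "m + h \<le> 3 * N" using m by auto
      hence "real (m + h) \<le> 3 * real N" by (metis of_nat_le_iff of_nat_mult of_nat_numeral)
      moreover have "0 < real (m + h)" using m by auto
      ultimately have "ln (real (m + h)) \<le> ln (3 * real N)" by (intro ln_mono) auto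
      thus "vartheta (m + h) \<le> ln (3 * real N) * of_bool (prime (m + h))" by (simp add: vartheta_def)
    qed
    also have "\<dots> = ln (3 * real N) * (\<Sum>h\<in>H. of_bool (prime (m + h)))" by (simp only: sum_distrib_left)
    also have "\<dots> \<le> ln (3 * real N) * ((1 + real_of_int (liouville (m + b))) / 2)"
      using m l3 by (intro mult_left_mono primes) auto
    finally show "(\<Sum>h\<in>H. vartheta (m + h) * wt H m) \<le> ln (3 * real N) * ((1 + real_of_int (liouville (m + b))) / 2) * wt H m"
      unfolding sum_distrib_right[symmetric] by (intro mult_right_mono wt_nonneg)
  qed
  also have "\<dots> = ln (3 * real N) / 2 * ((\<Sum>m\<in>?I. wt H m) + (\<Sum>m\<in>?I. real_of_int (liouville (m + b)) * wt H m))"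
    unfolding sum.distrib[symmetric] sum_distrib_left by (intro sum.cong refl) (simp add: field_simps)
  also have "\<dots> \<le> ln (3 * real N) / 2 * (real N / real W * (K ^ k * J1) + (e1 + e3) * real N)"
  proof (intro mult_left_mono)
    have "real N / real W * form_all \<le> real N / real W * (K ^ k * J1)"
      by (intro mult_left_mono form_all_le) auto
    thus "(\<Sum>m\<in>?I. wt H m) + (\<Sum>m\<in>?I. real_of_int (liouville (m + b)) * wt H m) \<le> real N / real W * (K ^ k * J1) + (e1 + e3) * real N"
      using sum_wt_approx[OF H, of N \<nu>] sum_wt_liouville_le[OF H b, of \<nu>] err1 err3 unfolding distrib_right by linarith
  qed (use l3 in simp)
  finally show ?thesis .
qed

end

section \<open>The limiting inequality\<close>

lemma eventually_ln_power_le: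
  assumes "0 < (q::real)"
  shows "\<forall>\<^sub>F N in sequentially. ln (real N) ^ m \<le> real N powr q"
proof -
  have f: "filterlim (\<lambda>N. q * ln (real N)) at_top sequentially"
    using assms by real_asymp
  have "((\<lambda>N. (q * ln (real N)) ^ m / exp (q * ln (real N))) \<longlongrightarrow> 0) sequentially"
    by (rule filterlim_compose[OF tendsto_power_div_exp_0 f])
  hence "\<forall>\<^sub>F N in sequentially. (q * ln (real N)) ^ m / exp (q * ln (real N)) < q ^ m"
    using assms by (intro order_tendstoD) auto
  thus ?thesis using eventually_gt_at_top[of 0]
  proof eventually_elim
    case (elim N)
    have "exp (q * ln (real N)) = real N powr q" using elim(2) by (simp add: powr_def)
    hence "q ^ m * ln (real N) ^ m \<le> q ^ m * real N powr q"
      using elim by (simp add: field_simps power_mult_distrib)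
    thus ?case using assms by simp
  qed
qed

text \<open>Discrepancies are needed at several points between N and 3 N; their bounds are expressed
  through N alone, at the cost of a constant factor.\<close>

lemma discrepancy_average_bound:
  fixes F :: "real \<Rightarrow> nat \<Rightarrow> real"
  assumes "\<forall>\<epsilon>>0. \<forall>A>0. \<exists>C. \<forall>\<^sub>F N in at_top.
     moduli_sum (N powr (\<theta> - \<epsilon>)) (F N) \<le> C * N / (ln N) powr A"
    and "0 < \<epsilon>" "0 < A"
  obtains C where "0 \<le> C" "\<forall>\<^sub>F N in sequentially. \<forall>x. real N \<le> x \<and> x \<le> 3 * real N \<longrightarrow>
     moduli_sum (x powr (\<theta> - \<epsilon>)) (F x) \<le> C * real N / ln (real N) ^ A"
proof -
  obtain C where "\<forall>\<^sub>F x in at_top. moduli_sum (x powr (\<theta> - \<epsilon>)) (F x) \<le> C * x / (ln x) powr (real A)"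
    using assms by (meson of_nat_0_less_iff)
  then obtain x0 where x0: "\<And>x. x \<ge> x0 \<Longrightarrow> moduli_sum (x powr (\<theta> - \<epsilon>)) (F x) \<le> C * x / (ln x) powr (real A)"
    by (auto simp: eventually_at_top_linorder)
  have ev: "\<forall>\<^sub>F N in sequentially. real N \<ge> max x0 3"
    using filterlim_real_sequentially unfolding filterlim_at_top by blast
  show ?thesis
  proof (rule that[of "3 * \<bar>C\<bar>"])
    show "\<forall>\<^sub>F N in sequentially. \<forall>x. real N \<le> x \<and> x \<le> 3 * real N \<longrightarrow>
     moduli_sum (x powr (\<theta> - \<epsilon>)) (F x) \<le> 3 * \<bar>C\<bar> * real N / ln (real N) ^ A"
      using ev
    proof eventually_elim
      case (elim N)
      show ?case
      proof safe
        fix x assume x: "real N \<le> x" "x \<le> 3 * real N"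
        have pos: "0 < ln (real N)" using elim by simp
        have lnx: "ln (real N) \<le> ln x" using x elim by (intro ln_mono) auto
        have "moduli_sum (x powr (\<theta> - \<epsilon>)) (F x) \<le> C * x / (ln x) powr (real A)"
          using x elim by (intro x0) auto
        also have "\<dots> = C * x / ln x ^ A" using pos lnx by (simp add: powr_realpow)
        also have "\<dots> \<le> (\<bar>C\<bar> * (3 * real N)) / ln x ^ A"
        proof (rule divide_right_mono)
          have "C * x \<le> \<bar>C\<bar> * x" using x by (intro mult_right_mono) auto
          also have "\<dots> \<le> \<bar>C\<bar> * (3 * real N)" using x by (intro mult_left_mono) auto
          finally show "C * x \<le> \<bar>C\<bar> * (3 * real N)" .
        qed (use pos lnx in auto)
        also have "\<dots> \<le> (\<bar>C\<bar> * (3 * real N)) / ln (real N) ^ A"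
          using pos lnx by (intro divide_left_mono power_mono mult_pos_pos zero_less_power) auto
        finally show "moduli_sum (x powr (\<theta> - \<epsilon>)) (F x) \<le> 3 * \<bar>C\<bar> * real N / ln (real N) ^ A"
          by (simp add: mult_ac)
      qed
    qed
  qed simp
qed

text \<open>Divide by N L^(k + 1). Errors of size O(N) disappear, and since ln N = (2 / \<theta>1)
  L, the factor ln (3 N) / 2 becomes L / \<theta>1: the 1/2 from (1 + \<lambda>)/2 cancels the 2
  from R^2 = N^\<theta>1.\<close>

lemma gpy_limit:
  fixes k n :: nat and \<theta>1 :: real
  assumes \<theta>1: "0 < \<theta>1" and L: "\<And>N. L N = \<theta>1 / 2 * ln (real N)"
    and k: "0 < k"
    and ev: "\<forall>\<^sub>F N in sequentially. real k * (real N / t * (d ^ (k + 1) * L N ^ (k + 1) * J2) - e2 * real N) \<le>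
      ln (3 * real N) / 2 * (real N / w * (K ^ k * (\<Sum>i<n. \<Sum>j<n. u i j * ((L N + \<kappa>) ^ (i + j + k) / L N ^ (i + j)))) + e13 * real N)"
  shows "real k * (d ^ (k + 1) * J2 / t) \<le> 1 / \<theta>1 * (K ^ k / w * (\<Sum>i<n. \<Sum>j<n. u i j))"
proof -
  have Lt: "filterlim L at_top sequentially"
    unfolding L using \<theta>1 by real_asymp
  have inv: "((\<lambda>N. 1 / L N) \<longlongrightarrow> 0) sequentially"
    by (rule tendsto_divide_0[OF tendsto_const filterlim_at_top_imp_at_infinity[OF Lt]])
  let ?f = "\<lambda>N. real k * (d ^ (k + 1) * J2 / t - e2 * (1 / L N) ^ (k + 1))"
  let ?g = "\<lambda>N. (1 / \<theta>1 + ln 3 / 2 * (1 / L N)) * (K ^ k / w * (\<Sum>i<n. \<Sum>j<n. u i j * (1 + \<kappa> * (1 / L N)) ^ (i + j + k)) + e13 * (1 / L N) ^ k)"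
  have "(?f \<longlongrightarrow> real k * (d ^ (k + 1) * J2 / t - e2 * 0 ^ (k + 1))) sequentially"
    by (intro tendsto_intros inv)
  moreover have "(?g \<longlongrightarrow> (1 / \<theta>1 + ln 3 / 2 * 0) * (K ^ k / w * (\<Sum>i<n. \<Sum>j<n. u i j * (1 + \<kappa> * 0) ^ (i + j + k)) + e13 * 0 ^ k)) sequentially"
    by (intro tendsto_intros inv)
  moreover have "\<forall>\<^sub>F N in sequentially. L N > 0"
    using Lt by (auto simp: filterlim_at_top_dense)
  hence "\<forall>\<^sub>F N in sequentially. ?f N \<le> ?g N"
    using ev eventually_gt_at_top[of 0]
  proof eventually_elim
    case (elim N)
    have l: "L N > 0" and N: "real N > 0" using elim by auto
    let ?Q = "real N * L N ^ (k + 1)"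
    have Q: "?Q > 0" using l N by simp
    have 1: "real k * (real N / t * (d ^ (k + 1) * L N ^ (k + 1) * J2) - e2 * real N) = ?f N * ?Q"
    proof -
      have p: "(1 / L N) ^ (k + 1) * L N ^ (k + 1) = 1" using l by (simp add: power_divide)
      have "e2 * (1 / L N) ^ (k + 1) * ?Q = e2 * real N * ((1 / L N) ^ (k + 1) * L N ^ (k + 1))"
        by (simp only: mult_ac)
      hence "e2 * real N = e2 * (1 / L N) ^ (k + 1) * ?Q" unfolding p by simp
      moreover have "real N / t * (d ^ (k + 1) * L N ^ (k + 1) * J2) = d ^ (k + 1) * J2 / t * ?Q" by simp
      ultimately show ?thesis by (simp only: left_diff_distrib mult.assoc)
    qed
    have s: "(L N + \<kappa>) ^ (i + j + k) / L N ^ (i + j) = L N ^ k * (1 + \<kappa> * (1 / L N)) ^ (i + j + k)" for i j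
    proof -
      have "L N + \<kappa> = L N * (1 + \<kappa> * (1 / L N))" using l by (simp add: field_simps)
      hence "(L N + \<kappa>) ^ (i + j + k) = L N ^ (i + j + k) * (1 + \<kappa> * (1 / L N)) ^ (i + j + k)"
        by (simp only: power_mult_distrib)
      thus ?thesis using l by (simp add: power_add)
    qed
    have ln3: "ln (3 * real N) / 2 = (1 / \<theta>1 + ln 3 / 2 * (1 / L N)) * L N"
    proof -
      have e: "ln (3 * real N) = ln 3 + 2 / \<theta>1 * L N" using N \<theta>1 by (simp add: ln_mult L)
      show ?thesis unfolding e using l \<theta>1 by (simp add: field_simps)
    qed
    have 2: "ln (3 * real N) / 2 * (real N / w * (K ^ k * (\<Sum>i<n. \<Sum>j<n. u i j * ((L N + \<kappa>) ^ (i + j + k) / L N ^ (i + j)))) + e13 * real N) = ?g N * ?Q"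
    proof -
      let ?S = "\<Sum>i<n. \<Sum>j<n. u i j * (1 + \<kappa> * (1 / L N)) ^ (i + j + k)"
      have s1: "(\<Sum>i<n. \<Sum>j<n. u i j * ((L N + \<kappa>) ^ (i + j + k) / L N ^ (i + j))) = L N ^ k * ?S"
        unfolding s by (simp add: sum_distrib_left mult_ac)
      have p: "(1 / L N) ^ k * L N ^ k = 1" using l by (simp add: power_divide)
      have "e13 * (1 / L N) ^ k * (real N * L N ^ k) = e13 * real N * ((1 / L N) ^ k * L N ^ k)"
        by (simp only: mult_ac)
      hence s2: "e13 * real N = e13 * (1 / L N) ^ k * (real N * L N ^ k)" unfolding p by simp
      have s3: "real N / w * (K ^ k * (L N ^ k * ?S)) = K ^ k / w * ?S * (real N * L N ^ k)" by simp
      have "real N / w * (K ^ k * (\<Sum>i<n. \<Sum>j<n. u i j * ((L N + \<kappa>) ^ (i + j + k) / L N ^ (i + j)))) + e13 * real N =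
        (K ^ k / w * ?S + e13 * (1 / L N) ^ k) * (real N * L N ^ k)"
        unfolding s1 s3 distrib_right using s2 by (simp only:)
      thus ?thesis unfolding ln3 by (simp only: mult_ac power_add power_one_right)
    qed
    show ?case using elim(2) Q unfolding 1 2 by (simp only: mult_le_cancel_right_pos)
  qed
  ultimately have "real k * (d ^ (k + 1) * J2 / t - e2 * 0 ^ (k + 1)) \<le>
    (1 / \<theta>1 + ln 3 / 2 * 0) * (K ^ k / w * (\<Sum>i<n. \<Sum>j<n. u i j * (1 + \<kappa> * 0) ^ (i + j + k)) + e13 * 0 ^ k)"
    by (intro tendsto_le[OF sequentially_bot])
  moreover have "(0::real) ^ k = 0" using k by simp
  ultimately show ?thesis by simp
qed

text \<open>
  Up to normalisation these are the integrals of \<open>F(u)\<^sup>2 u\<close> to the power \<open>k - 1\<close>, and of the square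
  of the primitive of \<open>F\<close> against \<open>u\<close> to the power \<open>k - 2\<close>, for \<open>F(u) = \<Sum> c\<^sub>i (1 - u)\<^sup>i\<close>.
\<close>
definition gpy_J1 :: "nat \<Rightarrow> nat \<Rightarrow> (nat \<Rightarrow> real) \<Rightarrow> real" where
  "gpy_J1 k n c = (\<Sum>i<n. \<Sum>j<n. c i * c j * (fact (i + j) / fact (i + j + k)))"

definition gpy_J2 :: "nat \<Rightarrow> nat \<Rightarrow> (nat \<Rightarrow> real) \<Rightarrow> real" where
  "gpy_J2 k n c = (\<Sum>i<n. \<Sum>j<n. c i * c j / (real (Suc i) * real (Suc j)) * (fact (i + j + 2) / fact (i + j + k + 1)))"

text \<open>D, and with it W and all constants, stays fixed while N grows. In the limit
  \<open>totient W\<close> = d W makes both sides share the factor d^k / W, and only exp(2 k / D)^k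
  remains as a loss.\<close>

lemma gpy_asymptotic:
  fixes k D n b \<nu> N0 :: nat and c :: "nat \<Rightarrow> real" and H :: "nat set" and \<theta> \<theta>1 :: real
  assumes k: "2 \<le> k" "2 * k \<le> D" and c: "\<And>i. 0 \<le> c i"
    and H: "H \<subseteq> {..D}" "card H = k" and \<nu>: "\<And>h. h \<in> H \<Longrightarrow> coprime (\<nu> + h) (primorial D)"
    and \<theta>: "0 < \<theta>1" "\<theta>1 < 1" "\<theta>1 < \<theta>" and AB: "condA \<theta>" "condB \<theta>"
    and primes: "\<And>m. m > N0 \<Longrightarrow> (\<Sum>h\<in>H. of_bool (prime (m + h))) \<le> (1 + real_of_int (liouville (m + b))) / 2"
  shows "\<theta>1 * real k * gpy_J2 k n c \<le> exp (2 * real k / real D) ^ k * gpy_J1 k n c"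
proof -
  define W where "W = primorial D"
  define d where "d = primorial_density D"
  \<comment> \<open>R = exp L is N^(\<theta>1 / 2), so the moduli reach W N^\<theta>1.\<close>
  define L where "L = (\<lambda>N::nat. \<theta>1 / 2 * ln (real N))"
  \<comment> \<open>Half of the spare level, so that \<theta> - \<epsilon> = \<theta>1 + \<epsilon>;
    the remaining N^\<epsilon> absorbs the constant W.\<close>
  define \<epsilon> where "\<epsilon> = (\<theta> - \<theta>1) / 2"
  define a where "a = (16 * k)\<^sup>2 + 2 * k + 1"
  define wc where "wc = gpy.weight_const k D c n"
  define dc where "dc = gpy.dim_const k D"
  have \<epsilon>: "\<epsilon> > 0" "\<theta> - \<epsilon> = \<theta>1 + \<epsilon>" using \<theta> by (auto simp: \<epsilon>_def field_simps)
  have W: "W > 0" unfolding W_def by (rule primorial_pos)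
  obtain CA where CA: "0 \<le> CA" "\<forall>\<^sub>F N in sequentially. \<forall>x. real N \<le> x \<and> x \<le> 3 * real N \<longrightarrow>
     moduli_sum (x powr (\<theta> - \<epsilon>)) (prime_disc x) \<le> CA * real N / ln (real N) ^ (a + 2 * k)"
    using discrepancy_average_bound[OF AB(1)[unfolded condA_iff] \<epsilon>(1), of "a + 2 * k"] by (auto simp: a_def)
  obtain CB where CB: "0 \<le> CB" "\<forall>\<^sub>F N in sequentially. \<forall>x. real N \<le> x \<and> x \<le> 3 * real N \<longrightarrow>
     moduli_sum (x powr (\<theta> - \<epsilon>)) (liouville_disc x) \<le> CB * real N / ln (real N) ^ (a + 2 * k)"
    using discrepancy_average_bound[OF AB(2)[unfolded condB_iff] \<epsilon>(1), of "a + 2 * k"] by (auto simp: a_def)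
  define e1 where "e1 = wc\<^sup>2 * dc (16 * k)"
  define e2 where "e2 = wc\<^sup>2 * (42 * dc ((16 * k)\<^sup>2) + 2 * CA)"
  define e3 where "e3 = wc\<^sup>2 * (12 * dc ((16 * k)\<^sup>2) + 2 * CB)"
  have ev1: "\<forall>\<^sub>F N in sequentially. ln (real N) \<ge> 1" by real_asymp
  have ev2: "\<forall>\<^sub>F N in sequentially. N \<ge> max (max D b) N0" by (rule eventually_ge_at_top)
  have ev3: "\<forall>\<^sub>F N in sequentially. real W \<le> real N powr \<epsilon>"
  proof -
    have "filterlim (\<lambda>N. real N powr \<epsilon>) at_top sequentially" using \<epsilon>(1) by real_asymp
    thus ?thesis by (auto simp: filterlim_at_top)
  qed
  have ev4: "\<forall>\<^sub>F N in sequentially. real W \<le> real N powr (1 - \<theta>1)"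
  proof -
    have "1 - \<theta>1 > 0" using \<theta> by simp
    hence "filterlim (\<lambda>N. real N powr (1 - \<theta>1)) at_top sequentially" by real_asymp
    thus ?thesis by (auto simp: filterlim_at_top)
  qed
  \<comment> \<open>18 k = 2 k + 16 k: the squared weight bound and the dimension-16 k sum in
    \<open>err_one_le\<close>. The room N^(1 - \<theta>1) is where \<theta>1 < 1 enters.\<close>
  have ev5: "\<forall>\<^sub>F N in sequentially. ln (real N) ^ (18 * k) \<le> real N powr (1 - \<theta>1)"
    using \<theta> by (intro eventually_ln_power_le) auto
  have "\<forall>\<^sub>F N in sequentially. real k * (real N / real (totient W) * (d ^ (k + 1) * L N ^ (k + 1) * gpy_J2 k n c) - e2 * real N) \<le>
      ln (3 * real N) / 2 * (real N / real W * ((exp (2 * real k / real D) * d) ^ k *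
        (\<Sum>i<n. \<Sum>j<n. c i * c j * (fact (i + j) / fact (i + j + k)) * ((L N + real k * (real W * real W + 1)) ^ (i + j + k) / L N ^ (i + j)))) + (e1 + e3) * real N)"
    using ev1 ev2 ev3 ev4 ev5 CA(2) CB(2)
  proof eventually_elim
    case (elim N)
    let ?l = "ln (real N)"
    have N1: "real N > 1"
    proof (rule ccontr)
      assume "\<not> real N > 1"
      hence "ln (real N) \<le> 0" by (cases "N = 0") auto
      thus False using elim(1) by simp
    qed
    have LN: "0 < L N" "L N \<le> ?l"
      unfolding L_def using \<theta> elim(1) by (auto intro!: mult_left_le_one_le)
    interpret gpy k D "L N" c n
      by unfold_locales (use k c LN in auto)
    have expL: "exp (2 * L N) = real N powr \<theta>1" using N1 by (simp add: L_def powr_def)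
    have "exp (L N) < exp ?l"
    proof (subst exp_less_cancel_iff)
      have "\<theta>1 / 2 * ?l < 1 * ?l" using \<theta> elim(1) by (intro mult_strict_right_mono) auto
      thus "L N < ?l" by (simp add: L_def)
    qed
    hence LN2: "exp (L N) < real N" using N1 by simp
    \<comment> \<open>Keeps every modulus below N, as the trivial discrepancy bounds
      require.\<close>
    have WN: "real W * exp (2 * L N) \<le> real N"
    proof -
      have "real W * exp (2 * L N) \<le> real N powr (1 - \<theta>1) * real N powr \<theta>1"
        unfolding expL using elim(4) by (intro mult_right_mono) auto
      also have "\<dots> = real N" using N1 by (simp add: powr_add[symmetric])
      finally show ?thesis .
    qed
    have Wz: "real W * exp (2 * L N) \<le> x powr (\<theta> - \<epsilon>)" if "real N \<le> x" for x
    proof -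
      have "real W * exp (2 * L N) \<le> real N powr \<epsilon> * real N powr \<theta>1"
        unfolding expL using elim(3) by (intro mult_right_mono) auto
      also have "\<dots> = real N powr (\<theta> - \<epsilon>)" unfolding \<epsilon>(2) by (simp add: powr_add)
      also have "\<dots> \<le> x powr (\<theta> - \<epsilon>)" using that N1 \<theta> \<epsilon> by (intro powr_mono2) auto
      finally show ?thesis .
    qed
    have ln3: "ln x \<le> 3 * ?l" if "0 < x" "x \<le> 3 * real N" for x
    proof -
      have "ln x \<le> ln (3 * real N)" using that by (intro ln_mono) auto
      also have "\<dots> = ln 3 + ?l" using N1 by (simp add: ln_mult)
      also have "ln (3::real) \<le> 2" using ln_le_minus_one[of "3::real"] by simp
      finally show ?thesis using elim(1) by linarith
    qed
    show ?case
      unfolding W_def d_def gpy_J2_def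
    proof (rule main_inequality)
      show "exp (L N) < real N" by fact
      show "D \<le> N" using elim(2) by simp
      show "(\<Sum>h\<in>H. of_bool (prime (m + h))) \<le> (1 + real_of_int (liouville (m + b))) / 2" if "N < m" for m
        using that elim(2) by (intro primes) auto
      show "weight_bound\<^sup>2 * err (\<lambda>_. 1) \<le> e1 * real N"
      proof -
        have "err (\<lambda>_. 1) \<le> exp (2 * L N) * (dim_const (16 * k) * ?l ^ (16 * k))"
          by (rule order_trans[OF err_one_le mult_left_mono[OF dim_bound_le[OF elim(1) LN(2)]]]) simp
        moreover have "0 \<le> err (\<lambda>_. 1)" unfolding err_def by (intro sum_nonneg mult_nonneg_nonneg tpow_nonneg) auto
        ultimately have "weight_bound\<^sup>2 * err (\<lambda>_. 1) \<le> (weight_const * ?l ^ k)\<^sup>2 * (exp (2 * L N) * (dim_const (16 * k) * ?l ^ (16 * k)))"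
          using weight_bound_le[OF elim(1) LN(2)] weight_bound_nonneg by (intro mult_mono power_mono) auto
        also have "\<dots> = (weight_const\<^sup>2 * dim_const (16 * k)) * (exp (2 * L N) * ?l ^ (18 * k))"
        proof -
          have "(?l ^ k)\<^sup>2 * ?l ^ (16 * k) = ?l ^ (18 * k)" by (simp flip: power_mult power_add)
          thus ?thesis by (simp add: power_mult_distrib mult_ac)
        qed
        also have "\<dots> \<le> (weight_const\<^sup>2 * dim_const (16 * k)) * (real N powr \<theta>1 * real N powr (1 - \<theta>1))"
          unfolding expL using elim(5) dim_const_nonneg by (intro mult_left_mono mult_nonneg_nonneg) auto
        also have "real N powr \<theta>1 * real N powr (1 - \<theta>1) = real N" using N1 by (simp add: powr_add[symmetric])
        finally show ?thesis by (simp add: e1_def wc_def dc_def)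
      qed
      show "weight_bound\<^sup>2 * err (\<lambda>U. prime_disc (real (N + N + h)) (primorial D * \<Prod>U) + prime_disc (real (N + h)) (primorial D * \<Prod>U)) \<le> e2 * real N"
        if h: "h \<in> H" for h
      proof -
        have hN: "real h \<le> real N" using h H(1) elim(2) by auto
        show ?thesis unfolding e2_def wc_def dc_def
        proof (rule prime_err_le[OF elim(1) LN(2) _ _ _ _ _ _ _ _ _ a_def])
          show "moduli_sum (real (N + N + h) powr (\<theta> - \<epsilon>)) (prime_disc (real (N + N + h))) \<le> CA * real N / ?l ^ (a + 2 * k)"
            using elim(6) hN by auto
          show "moduli_sum (real (N + h) powr (\<theta> - \<epsilon>)) (prime_disc (real (N + h))) \<le> CA * real N / ?l ^ (a + 2 * k)"
            using elim(6) hN by auto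
          show "ln (real (N + N + h)) \<le> 3 * ?l" "ln (real (N + h)) \<le> 3 * ?l" using hN N1 by (intro ln3; simp)+
          show "real (primorial D) * exp (2 * L N) \<le> real (N + N + h) powr (\<theta> - \<epsilon>)"
               "real (primorial D) * exp (2 * L N) \<le> real (N + h) powr (\<theta> - \<epsilon>)" using Wz by (auto simp: W_def)
          show "real (primorial D) * exp (2 * L N) \<le> real (N + N + h)"
               "real (primorial D) * exp (2 * L N) \<le> real (N + h)" using WN by (auto simp: W_def)
        qed (use hN in auto)
      qed
      show "weight_bound\<^sup>2 * err (\<lambda>U. 2 * liouville_disc (3 * real N) (primorial D * \<Prod>U)) \<le> e3 * real N"
        unfolding e3_def wc_def dc_def
      proof (rule liouville_err_le[OF elim(1) LN(2) _ _ _ _ a_def])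
        show "moduli_sum ((3 * real N) powr (\<theta> - \<epsilon>)) (liouville_disc (3 * real N)) \<le> CB * real N / ?l ^ (a + 2 * k)"
          using elim(7) by auto
        show "real (primorial D) * exp (2 * L N) \<le> (3 * real N) powr (\<theta> - \<epsilon>)" using Wz[of "3 * real N"] by (auto simp: W_def)
        show "real (primorial D) * exp (2 * L N) \<le> 3 * real N" using WN N1 by (simp add: W_def)
      qed auto
      show "real (N + N + b) \<le> 3 * real N" using elim(2) by simp
    qed (use H \<nu> in auto)
  qed
  from gpy_limit[OF \<theta>(1) _ _ this] have
    "real k * (d ^ (k + 1) * gpy_J2 k n c / real (totient W)) \<le> 1 / \<theta>1 * ((exp (2 * real k / real D) * d) ^ k / real W * gpy_J1 k n c)"
    unfolding gpy_J1_def using k by (simp add: L_def)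
  moreover have d0: "d > 0" unfolding d_def by (rule primorial_density_pos)
  have "real (totient W) = d * real W" using W by (simp add: d_def W_def primorial_density_def)
  ultimately have "real k * (d ^ (k + 1) * gpy_J2 k n c / (d * real W)) \<le> 1 / \<theta>1 * ((exp (2 * real k / real D) * d) ^ k / real W * gpy_J1 k n c)"
    by simp
  hence "(d ^ k / real W) * (real k * gpy_J2 k n c) \<le> (d ^ k / real W) * (1 / \<theta>1 * (exp (2 * real k / real D) ^ k * gpy_J1 k n c))"
    using d0 by (simp add: power_mult_distrib mult_ac)
  hence "real k * gpy_J2 k n c \<le> 1 / \<theta>1 * (exp (2 * real k / real D) ^ k * gpy_J1 k n c)"
    by (subst (asm) mult_le_cancel_left_pos) (use d0 W in auto)
  thus ?thesis using \<theta>(1) by (simp add: field_simps)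
qed

section \<open>The alternative for prime tuples\<close>

text \<open>The residue -h is the only one that h forbids, so fewer than p shifts leave some residue
  free.\<close>

lemma exists_admissible_residue:
  assumes "finite H" "card H < p"
  shows "\<exists>a. \<forall>h\<in>H. \<not> p dvd a + (h::nat)"
proof (rule ccontr)
  assume *: "\<nexists>a. \<forall>h\<in>H. \<not> p dvd a + h"
  have "{..<p} \<subseteq> (\<lambda>h. (p - h mod p) mod p) ` H"
  proof
    fix a assume a: "a \<in> {..<p}"
    then obtain h where h: "h \<in> H" "p dvd a + h" using * by blast
    have "[a + h mod p = 0] (mod p)" using h(2) by (simp add: cong_def mod_add_right_eq mod_0_imp_dvd)
    moreover have "[p - h mod p + h mod p = 0] (mod p)" using a by (simp add: cong_def)
    ultimately have "[a + h mod p = p - h mod p + h mod p] (mod p)" by (metis cong_sym cong_trans)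
    hence "[a = p - h mod p] (mod p)" by (simp only: cong_add_rcancel_nat)
    hence "a = (p - h mod p) mod p" using a by (simp add: cong_def)
    thus "a \<in> (\<lambda>h. (p - h mod p) mod p) ` H" using h(1) by blast
  qed
  hence "card {..<p} \<le> card ((\<lambda>h. (p - h mod p) mod p) ` H)" using assms by (intro card_mono) auto
  also have "\<dots> \<le> card H" using assms by (intro card_image_le)
  finally show False using assms by simp
qed

text \<open>The strict inequality survives the factor exp(2 k / D)^k once D is large. For that D,
  admissible residues at the primes up to D are glued into one class \<nu> modulo W by the Chinese
  remainder theorem.\<close>

lemma gpy_contradiction:
  fixes H :: "nat set" and b n M :: nat and c :: "nat \<Rightarrow> real" and \<theta> \<eta> :: real
  assumes H: "finite H" "2 \<le> card H"
    and adm: "\<And>p. prime p \<Longrightarrow> p \<le> card H \<Longrightarrow> \<exists>a. \<forall>h\<in>H. \<not> p dvd a + h"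
    and c: "\<And>i. 0 \<le> c i"
    and \<theta>: "0 < \<eta>" "\<eta> < 1" "\<eta> < \<theta>" and AB: "condA \<theta>" "condB \<theta>"
    and primes: "\<And>m. m > M \<Longrightarrow> (\<Sum>h\<in>H. of_bool (prime (m + h))) \<le> (1 + real_of_int (liouville (m + b))) / 2"
    and ineq: "gpy_J1 (card H) n c < \<eta> * real (card H) * gpy_J2 (card H) n c"
  shows False
proof -
  define k where "k = card H"
  have "((\<lambda>D. exp (2 * real k / real D) ^ k * gpy_J1 k n c) \<longlongrightarrow> exp 0 ^ k * gpy_J1 k n c) sequentially"
    by (intro tendsto_intros tendsto_divide_0[OF tendsto_const] filterlim_at_top_imp_at_infinity filterlim_real_sequentially)
  hence "\<forall>\<^sub>F D in sequentially. exp (2 * real k / real D) ^ k * gpy_J1 k n c < \<eta> * real k * gpy_J2 k n c"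
    using ineq by (intro order_tendstoD) (auto simp: k_def)
  hence "\<forall>\<^sub>F D in sequentially. exp (2 * real k / real D) ^ k * gpy_J1 k n c < \<eta> * real k * gpy_J2 k n c \<and> 2 * k + \<Sum>H \<le> D"
    using eventually_ge_at_top[of "2 * k + \<Sum>H"] by eventually_elim auto
  then obtain D where D: "exp (2 * real k / real D) ^ k * gpy_J1 k n c < \<eta> * real k * gpy_J2 k n c" "2 * k + \<Sum>H \<le> D"
    by (auto simp: eventually_sequentially)
  have HD: "H \<subseteq> {..D}"
  proof
    fix h assume "h \<in> H"
    hence "h \<le> \<Sum>H" using H(1) member_le_sum[of h H "\<lambda>x. x"] by simp
    thus "h \<in> {..D}" using D(2) by simp
  qed
  have "\<exists>a. \<forall>h\<in>H. \<not> p dvd a + h" if "prime p" for p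
    using adm[OF that] exists_admissible_residue[OF H(1), of p] by (cases "p \<le> card H") auto
  then obtain r where r: "\<And>p h. prime p \<Longrightarrow> h \<in> H \<Longrightarrow> \<not> p dvd r p + h" by metis
  obtain \<nu> where \<nu>: "\<And>p. p \<in> small_primes D \<Longrightarrow> [\<nu> = r p] (mod p)"
    using chinese_remainder_nat[OF finite_small_primes, of D "\<lambda>p. p" r]
    by (auto simp: small_primes_def primes_coprime)
  have "\<eta> * real k * gpy_J2 k n c \<le> exp (2 * real k / real D) ^ k * gpy_J1 k n c"
  proof (rule gpy_asymptotic[where H = H and \<nu> = \<nu>])
    show "coprime (\<nu> + h) (primorial D)" if h: "h \<in> H" for h
      unfolding primorial_def
    proof (rule prod_coprime_right)
      fix p assume p: "p \<in> small_primes D"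
      hence pp: "prime p" by (simp add: small_primes_def)
      have "[\<nu> + h = r p + h] (mod p)" using \<nu>[OF p] by (simp add: cong_add_rcancel_nat)
      hence "\<not> p dvd \<nu> + h" using r[OF pp h] by (simp add: cong_dvd_iff)
      thus "coprime (\<nu> + h) p" using pp by (metis coprime_commute prime_imp_coprime)
    qed
  qed (use H HD D(2) c \<theta> AB primes in \<open>auto simp: k_def\<close>)
  thus False using D(1) by linarith
qed

lemma liouville_cases: "liouville m = 1 \<or> liouville m = -1"
  by (cases "even (bigOmega m)") (auto simp: liouville_def)

text \<open>A liminf above G makes all late consecutive gaps exceed G, and any prime q > p is at
  least the successor of p.\<close>

lemma prime_gaps_eventually_gt:
  assumes "\<not> liminf (\<lambda>n. ereal (real (nth_prime (Suc n)) - real (nth_prime n))) \<le> ereal (real G)"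
  obtains N0 where "\<And>p q. prime p \<Longrightarrow> prime q \<Longrightarrow> N0 < p \<Longrightarrow> p < q \<Longrightarrow> p + G < q"
proof -
  let ?S = "{p::nat. prime p}"
  have inf: "infinite ?S" by (rule primes_infinite)
  have "ereal (real G) < liminf (\<lambda>n. ereal (real (nth_prime (Suc n)) - real (nth_prime n)))"
    using assms by simp
  hence "\<forall>\<^sub>F n in sequentially. ereal (real G) < ereal (real (nth_prime (Suc n)) - real (nth_prime n))"
    by (rule less_LiminfD)
  then obtain n0 where n0: "\<And>n. n \<ge> n0 \<Longrightarrow> real G < real (nth_prime (Suc n)) - real (nth_prime n)"
    by (auto simp: eventually_sequentially)
  show ?thesis
  proof (rule that[of "nth_prime n0"])
    fix p q :: nat assume pq: "prime p" "prime q" "nth_prime n0 < p" "p < q"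
    obtain i where i: "p = enumerate ?S i" using enumerate_Ex[OF inf, of p] pq by auto
    obtain j where j: "q = enumerate ?S j" using enumerate_Ex[OF inf, of q] pq by auto
    have "n0 < i" using pq(3) inf unfolding i nth_prime_def by (simp add: enumerate_mono_iff)
    moreover have "i < j" using pq(4) inf unfolding i j by (simp add: enumerate_mono_iff)
    hence "enumerate ?S (Suc i) \<le> enumerate ?S j" using inf by (simp add: enumerate_mono_le_iff Suc_le_eq)
    ultimately show "p + G < q" using n0[of i] unfolding i j nth_prime_def by linarith
  qed
qed

text \<open>The negation of both alternatives becomes the pointwise inequality behind
  \<open>gpy_contradiction\<close>, valid beyond two finite thresholds. Only a non-strict numerical
  inequality is required, because \<theta> > \<eta> leaves room.\<close>

lemma gpy_alternative:
  fixes H :: "nat set" and b n D4 D3 :: nat and c :: "nat \<Rightarrow> real" and \<theta> \<eta> :: real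
  assumes H: "finite H" "2 \<le> card H"
    and adm: "\<And>p. prime p \<Longrightarrow> p \<le> card H \<Longrightarrow> \<exists>a. \<forall>h\<in>H. \<not> p dvd a + h"
    and diam: "\<And>h h'. h \<in> H \<Longrightarrow> h' \<in> H \<Longrightarrow> h' \<le> h + D3"
    and centre: "b \<notin> H" "\<And>h. h \<in> H \<Longrightarrow> \<bar>int b - int h\<bar> \<le> int D4"
    and c: "\<And>i. 0 \<le> c i"
    and \<theta>: "0 < \<eta>" "\<eta> < 1" "\<eta> < \<theta>" and AB: "condA \<theta>" "condB \<theta>"
    and ineq: "gpy_J1 (card H) n c \<le> \<eta> * real (card H) * gpy_J2 (card H) n c" "0 < gpy_J2 (card H) n c"
  shows "(\<exists>d::int. d \<noteq> 0 \<and> \<bar>d\<bar> \<le> int D4 \<and>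
            infinite {p::nat. prime p \<and> int p + d > 0 \<and> liouville (nat (int p + d)) = -1})
      \<or> liminf (\<lambda>n. ereal (real (nth_prime (Suc n)) - real (nth_prime n))) \<le> ereal (real D3)"
proof (rule ccontr)
  assume contra: "\<not> ?thesis"
  obtain N1 where N1: "\<And>p q. prime p \<Longrightarrow> prime q \<Longrightarrow> N1 < p \<Longrightarrow> p < q \<Longrightarrow> p + D3 < q"
    using prime_gaps_eventually_gt[of D3] contra by blast
  \<comment> \<open>The exceptional primes. Each shift d = b - h is nonzero because b is not in H,
    and |d| \<le> \<open>D4\<close>, so failure of (i) makes every member of this finite union
    finite.\<close>
  define B where "B = (\<Union>h\<in>H. {p::nat. prime p \<and> int p + (int b - int h) > 0 \<and> liouville (nat (int p + (int b - int h))) = -1})"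
  have "finite B" unfolding B_def
  proof (intro finite_UN_I H(1))
    fix h assume h: "h \<in> H"
    hence "int b - int h \<noteq> 0" using centre(1) by auto
    thus "finite {p::nat. prime p \<and> int p + (int b - int h) > 0 \<and> liouville (nat (int p + (int b - int h))) = -1}"
      using contra centre(2)[OF h] by blast
  qed
  then obtain N2 where N2: "\<And>p. p \<in> B \<Longrightarrow> p \<le> N2" by (meson finite_nat_set_iff_bounded_le)
  \<comment> \<open>A level strictly between \<eta> and both \<theta> and 1; since
    \<open>gpy_J2\<close> is positive, raising \<eta> to \<theta>1 makes the numerical inequality
    strict.\<close>
  define \<theta>1 where "\<theta>1 = (\<eta> + min \<theta> 1) / 2"
  have \<theta>1: "\<eta> < \<theta>1" "\<theta>1 < 1" "\<theta>1 < \<theta>" using \<theta> by (auto simp: \<theta>1_def min_def field_simps)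
  show False
  proof (rule gpy_contradiction[where M = "N1 + N2" and H = H and b = b and n = n and c = c and \<theta> = \<theta> and \<eta> = \<theta>1])
    fix m assume m: "m > N1 + N2"
    show "(\<Sum>h\<in>H. of_bool (prime (m + h))) \<le> (1 + real_of_int (liouville (m + b))) / 2"
    proof (cases "\<exists>h\<in>H. prime (m + h)")
      case False
      hence "(\<Sum>h\<in>H. of_bool (prime (m + h))) = (0::real)" by (intro sum.neutral) auto
      thus ?thesis using liouville_cases[of "m + b"] by auto
    next
      case True
      then obtain h where h: "h \<in> H" "prime (m + h)" by auto
      \<comment> \<open>Two primes among the m + h would differ by at most the diameter of H, hence
        by at most \<open>D3\<close>.\<close>
      have uniq: "h' = h" if h': "h' \<in> H" "prime (m + h')" for h'
      proof (rule ccontr)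
        assume "h' \<noteq> h"
        thus False
          using N1[of "m + h" "m + h'"] N1[of "m + h'" "m + h"] diam[OF h(1) h'(1)] diam[OF h'(1) h(1)] h h' m by force
      qed
      have "(\<Sum>h\<in>H. of_bool (prime (m + h))) = (\<Sum>h'\<in>{h}. of_bool (prime (m + h')) :: real)"
      proof (rule sum.mono_neutral_right)
        show "\<forall>h'\<in>H - {h}. of_bool (prime (m + h')) = (0::real)"
        proof
          fix h' assume "h' \<in> H - {h}"
          hence "\<not> prime (m + h')" using uniq[of h'] by blast
          thus "of_bool (prime (m + h')) = (0::real)" by simp
        qed
      qed (use H(1) h(1) in simp_all)
      also have "\<dots> = 1" using h by simp
      finally have 1: "(\<Sum>h\<in>H. of_bool (prime (m + h))) = (1::real)" .
      have "m + h \<notin> B" using N2[of "m + h"] m by auto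
      moreover have "nat (int (m + h) + (int b - int h)) = m + b" "int (m + h) + (int b - int h) > 0" using m by auto
      ultimately have "liouville (m + b) \<noteq> -1" using h unfolding B_def by auto
      hence "liouville (m + b) = 1" using liouville_cases[of "m + b"] by auto
      thus ?thesis using 1 by simp
    qed
  next
    have "\<eta> * real (card H) * gpy_J2 (card H) n c < \<theta>1 * real (card H) * gpy_J2 (card H) n c"
      using \<theta>1 H(2) ineq(2) by (intro mult_strict_right_mono) auto
    thus "gpy_J1 (card H) n c < \<theta>1 * real (card H) * gpy_J2 (card H) n c" using ineq(1) by linarith
  qed (use H adm c \<theta> \<theta>1 AB in auto)
qed

text \<open>Residues 1, 2, 1 work modulo 2, 3, 5. All four tuples lie in {0, 2, 6, 8, 12}, whose
  elements are even, are 0 or 2 modulo 3, and avoid 4 modulo 5.\<close>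

lemma admissible_small_primes:
  assumes "prime p" "p \<le> 5" "\<And>h. h \<in> H \<Longrightarrow> even h" "\<And>h. h \<in> H \<Longrightarrow> h mod 3 \<noteq> 1" "\<And>h. h \<in> H \<Longrightarrow> h mod 5 \<noteq> 4"
  shows "\<exists>a. \<forall>h\<in>H. \<not> p dvd a + (h::nat)"
proof -
  have "p = 2 \<or> p = 3 \<or> p = 4 \<or> p = 5" using assms(1,2) prime_ge_2_nat[of p] by linarith
  moreover have "p \<noteq> 4" using assms(1) by (auto simp: prime_nat_iff dest!: spec[of _ 2])
  ultimately consider "p = 2" | "p = 3" | "p = 5" by blast
  thus ?thesis
  proof cases
    case 1
    thus ?thesis using assms(3) by (intro exI[of _ 1]) auto
  next
    case 2
    have "\<not> 3 dvd 2 + h" if "h mod 3 \<noteq> 1" for h :: nat using that by presburger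
    thus ?thesis using 2 assms(4) by (intro exI[of _ 2]) auto
  next
    case 3
    have "\<not> 5 dvd 1 + h" if "h mod 5 \<noteq> 4" for h :: nat using that by presburger
    thus ?thesis using 3 assms(5) by (intro exI[of _ 1]) auto
  qed
qed

text \<open>The slopes 1, 3, 6, 9 used below are integers close to the optimal ones 1.28, 3.16, 5.69, 8.87.\<close>
definition linear_coeff :: "real \<Rightarrow> nat \<Rightarrow> real" where
  "linear_coeff u i = (if i = 0 then 1 else u)"

theorem theorem7:
  fixes \<theta>0 \<theta> :: real and D4 D3 :: nat
  assumes "(\<theta>0, D4, D3) \<in> {(0.729, 1, 2), (0.616, 3, 6), (0.554, 4, 8), (0.515, 7, 12)}"
    and "\<theta> > \<theta>0" and "condA \<theta>" and "condB \<theta>"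
  shows "(\<exists>d::int. d \<noteq> 0 \<and> \<bar>d\<bar> \<le> int D4 \<and>
            infinite {p::nat. prime p \<and> int p + d > 0 \<and> liouville (nat (int p + d)) = -1})
      \<or> liminf (\<lambda>n. ereal (real (nth_prime (Suc n)) - real (nth_prime n))) \<le> ereal (real D3)"
proof -
  \<comment> \<open>With the slopes 1, 3, 6, 9 the quotients \<open>gpy_J1\<close> / (k
    \<open>gpy_J2\<close>) are about 0.7237, 0.6126, 0.5516 and 0.5126, each below its \<theta>0;
    expanding the definitions leaves rational arithmetic.\<close>
  note expand = gpy_J1_def gpy_J2_def linear_coeff_def numeral_2_eq_2 lessThan_Suc fact_numeral
  consider "\<theta>0 = 0.729" "D4 = 1" "D3 = 2" | "\<theta>0 = 0.616" "D4 = 3" "D3 = 6"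
    | "\<theta>0 = 0.554" "D4 = 4" "D3 = 8" | "\<theta>0 = 0.515" "D4 = 7" "D3 = 12"
    using assms(1) by auto
  thus ?thesis
  proof cases
    case 1
    show ?thesis
    proof (rule gpy_alternative[where H = "{0, 2}" and b = 1 and n = 2 and c = "linear_coeff 1" and \<eta> = \<theta>0 and \<theta> = \<theta>])
      fix p :: nat assume "prime p" "p \<le> card {0::nat, 2}"
      thus "\<exists>a. \<forall>h\<in>{0, 2}. \<not> p dvd a + h" by (intro admissible_small_primes) auto
    qed (use 1 assms(2-4) in \<open>auto simp: expand\<close>)
  next
    case 2
    show ?thesis
    proof (rule gpy_alternative[where H = "{0, 2, 6}" and b = 3 and n = 2 and c = "linear_coeff 3" and \<eta> = \<theta>0 and \<theta> = \<theta>])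
      fix p :: nat assume "prime p" "p \<le> card {0::nat, 2, 6}"
      thus "\<exists>a. \<forall>h\<in>{0, 2, 6}. \<not> p dvd a + h" by (intro admissible_small_primes) auto
    qed (use 2 assms(2-4) in \<open>auto simp: expand\<close>)
  next
    case 3
    show ?thesis
    proof (rule gpy_alternative[where H = "{0, 2, 6, 8}" and b = 4 and n = 2 and c = "linear_coeff 6" and \<eta> = \<theta>0 and \<theta> = \<theta>])
      fix p :: nat assume "prime p" "p \<le> card {0::nat, 2, 6, 8}"
      thus "\<exists>a. \<forall>h\<in>{0, 2, 6, 8}. \<not> p dvd a + h" by (intro admissible_small_primes) auto
    qed (use 3 assms(2-4) in \<open>auto simp: expand\<close>)
  next
    case 4
    show ?thesis
    \<comment> \<open>The midpoint 6 belongs to H, so the centre moves to 5, whose distance to 12 is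
      the value 7 of \<open>D4\<close>.\<close>
    proof (rule gpy_alternative[where H = "{0, 2, 6, 8, 12}" and b = 5 and n = 2 and c = "linear_coeff 9" and \<eta> = \<theta>0 and \<theta> = \<theta>])
      fix p :: nat assume "prime p" "p \<le> card {0::nat, 2, 6, 8, 12}"
      thus "\<exists>a. \<forall>h\<in>{0, 2, 6, 8, 12}. \<not> p dvd a + h" by (intro admissible_small_primes) auto
    qed (use 4 assms(2-4) in \<open>auto simp: expand\<close>)
  qed
qed

end
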